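(* Let $(\mathcal A,\varphi)$ be a C$^*$-probability space (not necessarily tracial), let $X=\{x_r\}_{r\in\Lambda}\subset\mathcal A$ be a family whose joint $*$-distribution is invariant under free complexification, and let $\mathcal B\subseteq\mathcal A$ be the norm-closed, non-self-adjoint, unital operator algebra generated by $X$. For $t\ge0$ define, on the Hilbert space $L^2(\mathcal B)$, $$\Gamma_t=\sum_{d=0}^\infty e^{-dt}P_d,$$ where $P_d$ is the orthogonal projection of $L^2(\mathcal B)$ onto its degree $d$ subspace $L^2_d(\mathcal B)$. Then $\{\Gamma_t\}_{t\ge0}$ is a contraction semigroup on $L^2(\mathcal B)$; furthermore, for each $t\ge0$, $\Gamma_t$ restricts to a unital complete contraction $\Gamma_t:\mathcal B\to\mathcal B$.
   Context: A C$^*$-probability space $(\mathcal A,\varphi)$ is a unital C$^*$-algebra with a faithful state. $L^2(\mathcal A,\varphi)$ is the associated GNS Hilbert space. $L^2(\mathcal B)$ is the closure of $\mathcal B$ in $L^2(\mathcal A,\varphi)$ (and $\mathcal B$ is regarded as a subspace of $L^2(\mathcal B)$). For $d\ge1$, $L^2_d(\mathcal B)$ is the closure in $L^2(\mathcal B)$ of $\mathrm{span}\{x_{i(1)}\cdots x_{i(d)}:i:\{1,\dots,d\}\to\Lambda\}$, and $L^2_0(\mathcal B)=\mathbb C1_{\mathcal A}$. Under the hypothesis of invariance under free complexification the subspaces $L^2_d(\mathcal B)$, $d\ge0$, are mutually orthogonal. The sum defining $\Gamma_t$ is taken in the strong operator topology. The joint $*$-distribution of a family is the collection of all its $*$-moments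 with respect to $\varphi$. A Haar unitary is a unitary $z$ with $\varphi(z^n)=\delta_{n,0}$ for all $n\in\mathbb Z$. Unital subalgebras $\mathcal A_1,\mathcal A_2$ are free if $\varphi(a_1\cdots a_k)=0$ whenever each $\varphi(a_j)=0$ and the $a_j$ come alternately from $\mathcal A_1$ and $\mathcal A_2$; $z$ is $*$-free from $X$ if the unital $*$-algebras generated by $z$ and by $X$ are free. The joint $*$-distribution of $X$ is invariant under free complexification if $\{zx_r\}$ and $\{x_r\}$ have the same joint $*$-distribution, where $z$ is a Haar unitary $*$-free from $X$ (lying in $\mathcal A$, or in an enlargement of $(\mathcal A,\varphi)$ such as its free product with $C(\mathbb T)$ with Haar measure; the joint $*$-distribution of $\{zx_r\}$ does not depend on the choice of $z$). *)

theory Defs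
  imports "HOL-Analysis.Analysis"
begin

section \<open>Complex Hilbert spaces and unital C*-algebras\<close>

class complex_vector = real_vector +
  fixes scaleC :: "complex \<Rightarrow> 'a \<Rightarrow> 'a"  (infixr \<open>*\<^sub>C\<close> 75)
  assumes scaleC_add_right: "c *\<^sub>C (x + y) = c *\<^sub>C x + c *\<^sub>C y"
    and scaleC_add_left: "(c + d) *\<^sub>C x = c *\<^sub>C x + d *\<^sub>C x"
    and scaleC_scaleC: "c *\<^sub>C (d *\<^sub>C x) = (c * d) *\<^sub>C x"
    and scaleC_one: "1 *\<^sub>C x = x"
    and scaleR_scaleC: "r *\<^sub>R x = complex_of_real r *\<^sub>C x"

interpretation complex_vector: vector_space
    "scaleC :: complex \<Rightarrow> 'a \<Rightarrow> 'a::complex_vector"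
  by unfold_locales
    (rule scaleC_add_right scaleC_add_left scaleC_scaleC scaleC_one)+

abbreviation csubspace :: "'a::complex_vector set \<Rightarrow> bool"
  where "csubspace \<equiv> module.subspace scaleC"

abbreviation cspan :: "'a::complex_vector set \<Rightarrow> 'a set"
  where "cspan \<equiv> module.span scaleC"

abbreviation clinear :: "('a::complex_vector \<Rightarrow> 'b::complex_vector) \<Rightarrow> bool"
  where "clinear \<equiv> Vector_Spaces.linear scaleC scaleC"

class complex_normed_vector = complex_vector + real_normed_vector +
  assumes norm_scaleC: "norm (c *\<^sub>C x) = cmod c * norm x"

text \<open>The complex inner product is linear in the first and conjugate linear in the
  second argument; its real part is the inner product of the underlying real inner
  product space, so that the norm of x is the square root of \<open>cinner x x\<close>.\<close>

class chilbert_space = complex_normed_vector + real_inner + complete_space +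
  fixes cinner :: "'a \<Rightarrow> 'a \<Rightarrow> complex"
  assumes cinner_commute: "cinner x y = cnj (cinner y x)"
    and cinner_add_left: "cinner (x + y) z = cinner x z + cinner y z"
    and cinner_scaleC_left: "cinner (c *\<^sub>C x) y = c * cinner x y"
    and inner_cinner: "inner x y = Re (cinner x y)"

class cstar_algebra = complex_normed_vector + real_normed_algebra_1 + banach +
  fixes star :: "'a \<Rightarrow> 'a"
  assumes scaleC_mult_left: "(c *\<^sub>C x) * y = c *\<^sub>C (x * y)"
    and scaleC_mult_right: "x * (c *\<^sub>C y) = c *\<^sub>C (x * y)"
    and star_star: "star (star x) = x"
    and star_add: "star (x + y) = star x + star y"
    and star_scaleC: "star (c *\<^sub>C x) = cnj c *\<^sub>C star x"
    and star_mult: "star (x * y) = star y * star x"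
    and cstar_identity: "norm (star x * x) = (norm x)\<^sup>2"

definition is_unital_star_hom :: "('a::cstar_algebra \<Rightarrow> 'b::cstar_algebra) \<Rightarrow> bool"
  where "is_unital_star_hom h \<longleftrightarrow> clinear h \<and> h 1 = 1 \<and>
    (\<forall>a b. h (a * b) = h a * h b) \<and> (\<forall>a. h (star a) = star (h a))"

definition is_unital_subalgebra :: "'a::cstar_algebra set \<Rightarrow> bool"
  where "is_unital_subalgebra S \<longleftrightarrow>
    csubspace S \<and> 1 \<in> S \<and> (\<forall>a\<in>S. \<forall>b\<in>S. a * b \<in> S)"

definition operator_algebra_gen :: "'a::cstar_algebra set \<Rightarrow> 'a set"
  where "operator_algebra_gen X = (\<lambda>S. is_unital_subalgebra S \<and> closed S) hull X"

definition star_algebra_gen :: "'a::cstar_algebra set \<Rightarrow> 'a set"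
  where "star_algebra_gen X = (\<lambda>S. is_unital_subalgebra S \<and> (\<forall>a\<in>S. star a \<in> S)) hull X"


section \<open>C*-probability spaces, *-distributions and freeness\<close>

text \<open>A C*-probability space is a type of class \<open>cstar_algebra\<close> together with a
  function satisfying the following predicate.\<close>

definition is_faithful_state :: "('a::cstar_algebra \<Rightarrow> complex) \<Rightarrow> bool"
  where "is_faithful_state \<phi> \<longleftrightarrow>
    Vector_Spaces.linear scaleC (*) \<phi> \<and> \<phi> 1 = 1 \<and>
    (\<forall>a. \<phi> (star a * a) \<in> \<real>\<^sub>\<ge>\<^sub>0) \<and> (\<forall>a. \<phi> (star a * a) = 0 \<longrightarrow> a = 0)"

text \<open>A letter \<open>(r, s)\<close> of a *-word stands for the adjoint of \<open>x r\<close> if \<open>s\<close> holds, and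
  for \<open>x r\<close> otherwise.\<close>

definition star_moment ::
    "('a::cstar_algebra \<Rightarrow> complex) \<Rightarrow> ('i \<Rightarrow> 'a) \<Rightarrow> ('i \<times> bool) list \<Rightarrow> complex"
  where "star_moment \<phi> x w =
    \<phi> (prod_list (map (\<lambda>(r, s). if s then star (x r) else x r) w))"

definition same_star_distribution ::
    "'i set \<Rightarrow> ('a::cstar_algebra \<Rightarrow> complex) \<Rightarrow> ('i \<Rightarrow> 'a)
      \<Rightarrow> ('b::cstar_algebra \<Rightarrow> complex) \<Rightarrow> ('i \<Rightarrow> 'b) \<Rightarrow> bool"
  where "same_star_distribution \<Lambda> \<phi> x \<psi> y \<longleftrightarrow>
    (\<forall>w\<in>lists (\<Lambda> \<times> UNIV). star_moment \<phi> x w = star_moment \<psi> y w)"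

definition is_haar_unitary :: "('a::cstar_algebra \<Rightarrow> complex) \<Rightarrow> 'a \<Rightarrow> bool"
  where "is_haar_unitary \<phi> z \<longleftrightarrow> star z * z = 1 \<and> z * star z = 1 \<and>
    (\<forall>n::int. \<phi> (if 0 \<le> n then z ^ nat n else star z ^ nat (- n)) =
      (if n = 0 then 1 else 0))"

definition free_pair :: "('a::cstar_algebra \<Rightarrow> complex) \<Rightarrow> 'a set \<Rightarrow> 'a set \<Rightarrow> bool"
  where "free_pair \<phi> A\<^sub>1 A\<^sub>2 \<longleftrightarrow>
    (\<forall>as. as \<noteq> [] \<and> (\<forall>a\<in>set as. \<phi> a = 0) \<and>
      ((\<forall>j<length as. as ! j \<in> (if even j then A\<^sub>1 else A\<^sub>2)) \<or>
       (\<forall>j<length as. as ! j \<in> (if even j then A\<^sub>2 else A\<^sub>1)))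
      \<longrightarrow> \<phi> (prod_list as) = 0)"

definition star_free :: "('a::cstar_algebra \<Rightarrow> complex) \<Rightarrow> 'a set \<Rightarrow> 'a set \<Rightarrow> bool"
  where "star_free \<phi> X Y \<longleftrightarrow> free_pair \<phi> (star_algebra_gen X) (star_algebra_gen Y)"

text \<open>A state preserving unital *-homomorphism between C*-probability spaces is injective
  (hence isometric), because the state on its domain is faithful.\<close>

definition is_enlargement ::
    "('a::cstar_algebra \<Rightarrow> complex) \<Rightarrow> ('b::cstar_algebra \<Rightarrow> complex) \<Rightarrow> ('a \<Rightarrow> 'b) \<Rightarrow> bool"
  where "is_enlargement \<phi> \<psi> \<iota> \<longleftrightarrow>
    is_faithful_state \<psi> \<and> is_unital_star_hom \<iota> \<and> (\<forall>a. \<psi> (\<iota> a) = \<phi> a)"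

text \<open>The Haar unitary lives in an enlargement of the given C*-probability space (the
  identity map is allowed).\<close>

definition invariant_under_free_complexification ::
    "('a::cstar_algebra \<Rightarrow> complex) \<Rightarrow> 'i set \<Rightarrow> ('i \<Rightarrow> 'a)
      \<Rightarrow> ('b::cstar_algebra \<Rightarrow> complex) \<Rightarrow> ('a \<Rightarrow> 'b) \<Rightarrow> bool"
  where "invariant_under_free_complexification \<phi> \<Lambda> x \<psi> \<iota> \<longleftrightarrow>
    is_enlargement \<phi> \<psi> \<iota> \<and>
    (\<exists>z. is_haar_unitary \<psi> z \<and> star_free \<psi> {z} (\<iota> ` x ` \<Lambda>) \<and>
      same_star_distribution \<Lambda> \<psi> (\<lambda>r. z * \<iota> (x r)) \<phi> x)"


section \<open>The GNS space and its subspaces\<close>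

definition is_star_rep :: "('a::cstar_algebra \<Rightarrow> 'h::chilbert_space \<Rightarrow> 'h) \<Rightarrow> bool"
  where "is_star_rep \<pi> \<longleftrightarrow>
    (\<forall>a. bounded_linear (\<pi> a) \<and> clinear (\<pi> a)) \<and>
    (\<forall>a b \<xi>. \<pi> (a + b) \<xi> = \<pi> a \<xi> + \<pi> b \<xi>) \<and>
    (\<forall>c a \<xi>. \<pi> (c *\<^sub>C a) \<xi> = c *\<^sub>C \<pi> a \<xi>) \<and>
    (\<forall>a b \<xi>. \<pi> (a * b) \<xi> = \<pi> a (\<pi> b \<xi>)) \<and>
    (\<forall>\<xi>. \<pi> 1 \<xi> = \<xi>) \<and>
    (\<forall>a \<xi> \<zeta>. cinner (\<pi> (star a) \<xi>) \<zeta> = cinner \<xi> (\<pi> a \<zeta>))"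

text \<open>The GNS triple of a state: the Hilbert space is the type \<open>'h\<close>, and it is
  determined by these conditions up to unitary equivalence.\<close>

definition is_gns_triple ::
    "('a::cstar_algebra \<Rightarrow> complex) \<Rightarrow> ('a \<Rightarrow> 'h::chilbert_space \<Rightarrow> 'h) \<Rightarrow> 'h \<Rightarrow> bool"
  where "is_gns_triple \<phi> \<pi> \<Omega> \<longleftrightarrow> is_star_rep \<pi> \<and>
    (\<forall>a. \<phi> a = cinner (\<pi> a \<Omega>) \<Omega>) \<and> closure (range (\<lambda>a. \<pi> a \<Omega>)) = UNIV"

text \<open>The canonical map of the algebra into its GNS space (injective for a faithful state).\<close>

definition gns_emb :: "('a \<Rightarrow> 'h \<Rightarrow> 'h) \<Rightarrow> 'h \<Rightarrow> 'a \<Rightarrow> 'h"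
  where "gns_emb \<pi> \<Omega> a = \<pi> a \<Omega>"

definition L2 :: "('a::cstar_algebra \<Rightarrow> 'h::chilbert_space \<Rightarrow> 'h) \<Rightarrow> 'h \<Rightarrow> 'a set \<Rightarrow> 'h set"
  where "L2 \<pi> \<Omega> S = closure (gns_emb \<pi> \<Omega> ` S)"

definition words :: "'i set \<Rightarrow> ('i \<Rightarrow> 'a::cstar_algebra) \<Rightarrow> nat \<Rightarrow> 'a set"
  where "words \<Lambda> x d = {prod_list (map x is) | is. is \<in> lists \<Lambda> \<and> length is = d}"

definition L2_deg ::
    "('a::cstar_algebra \<Rightarrow> 'h::chilbert_space \<Rightarrow> 'h) \<Rightarrow> 'h \<Rightarrow> 'i set \<Rightarrow> ('i \<Rightarrow> 'a) \<Rightarrow> nat \<Rightarrow> 'h set"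
  where "L2_deg \<pi> \<Omega> \<Lambda> x d =
    (if d = 0 then gns_emb \<pi> \<Omega> ` {c *\<^sub>C 1 | c. True}
     else closure (gns_emb \<pi> \<Omega> ` cspan (words \<Lambda> x d)))"

definition ortho_proj :: "'h::chilbert_space set \<Rightarrow> 'h \<Rightarrow> 'h"
  where "ortho_proj M \<xi> = (THE \<eta>. \<eta> \<in> M \<and> (\<forall>\<zeta>\<in>M. cinner (\<xi> - \<eta>) \<zeta> = 0))"

definition Gamma_term ::
    "('a::cstar_algebra \<Rightarrow> 'h::chilbert_space \<Rightarrow> 'h) \<Rightarrow> 'h \<Rightarrow> 'i set \<Rightarrow> ('i \<Rightarrow> 'a)
      \<Rightarrow> real \<Rightarrow> 'h \<Rightarrow> nat \<Rightarrow> 'h"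
  where "Gamma_term \<pi> \<Omega> \<Lambda> x t \<xi> d =
    exp (- (real d * t)) *\<^sub>R ortho_proj (L2_deg \<pi> \<Omega> \<Lambda> x d) \<xi>"

text \<open>Convergence in the strong operator topology is norm convergence at each vector. The
  operator is only meaningful on the closed subspace \<open>L2\<close> of the operator algebra
  generated by the family.\<close>

definition Gamma_op ::
    "('a::cstar_algebra \<Rightarrow> 'h::chilbert_space \<Rightarrow> 'h) \<Rightarrow> 'h \<Rightarrow> 'i set \<Rightarrow> ('i \<Rightarrow> 'a)
      \<Rightarrow> real \<Rightarrow> 'h \<Rightarrow> 'h"
  where "Gamma_op \<pi> \<Omega> \<Lambda> x t \<xi> = (\<Sum>d. Gamma_term \<pi> \<Omega> \<Lambda> x t \<xi> d)"


section \<open>Contraction semigroups and complete contractions\<close>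

definition clinear_on ::
    "'a::complex_vector set \<Rightarrow> ('a \<Rightarrow> 'b::complex_vector) \<Rightarrow> bool"
  where "clinear_on K T \<longleftrightarrow>
    (\<forall>\<xi>\<in>K. \<forall>\<zeta>\<in>K. T (\<xi> + \<zeta>) = T \<xi> + T \<zeta>) \<and> (\<forall>c. \<forall>\<xi>\<in>K. T (c *\<^sub>C \<xi>) = c *\<^sub>C T \<xi>)"

text \<open>Strongly continuous one-parameter semigroup of linear contractions of the closed
  subspace K.\<close>

definition is_contraction_semigroup_on ::
    "'h::chilbert_space set \<Rightarrow> (real \<Rightarrow> 'h \<Rightarrow> 'h) \<Rightarrow> bool"
  where "is_contraction_semigroup_on K T \<longleftrightarrow>
    csubspace K \<and> closed K \<and>
    (\<forall>t\<ge>0. clinear_on K (T t) \<and> (\<forall>\<xi>\<in>K. T t \<xi> \<in> K \<and> norm (T t \<xi>) \<le> norm \<xi>)) \<and>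
    (\<forall>\<xi>\<in>K. T 0 \<xi> = \<xi>) \<and>
    (\<forall>s\<ge>0. \<forall>t\<ge>0. \<forall>\<xi>\<in>K. T (s + t) \<xi> = T s (T t \<xi>)) \<and>
    (\<forall>\<xi>\<in>K. continuous_on {0..} (\<lambda>t. T t \<xi>))"

text \<open>The norm of the n by n matrix with entries \<open>a i j\<close> (\<open>i, j < n\<close>), acting via \<open>\<pi>\<close>
  as an operator on the direct sum of n copies of the Hilbert space. If \<open>\<pi>\<close> is faithful,
  as is the GNS representation of a faithful state, this is the C*-norm on the n by n
  matrices over the algebra.\<close>

definition matrix_norm ::
    "('a::cstar_algebra \<Rightarrow> 'h::chilbert_space \<Rightarrow> 'h) \<Rightarrow> nat \<Rightarrow> (nat \<Rightarrow> nat \<Rightarrow> 'a) \<Rightarrow> real"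
  where "matrix_norm \<pi> n a =
    Sup {sqrt (\<Sum>i<n. (norm (\<Sum>j<n. \<pi> (a i j) (\<xi> j)))\<^sup>2) | \<xi>. (\<Sum>j<n. (norm (\<xi> j))\<^sup>2) \<le> 1}"

definition is_complete_contraction_on ::
    "('a::cstar_algebra \<Rightarrow> 'h::chilbert_space \<Rightarrow> 'h) \<Rightarrow> 'a set \<Rightarrow> ('a \<Rightarrow> 'a) \<Rightarrow> bool"
  where "is_complete_contraction_on \<pi> B G \<longleftrightarrow> clinear_on B G \<and>
    (\<forall>n\<ge>1. \<forall>a. (\<forall>i<n. \<forall>j<n. a i j \<in> B) \<longrightarrow>
      matrix_norm \<pi> n (\<lambda>i j. G (a i j)) \<le> matrix_norm \<pi> n a)"

end

theory Submission
  imports Defs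
begin

text \<open>
  By freeness, a *-moment of \<open>(z x\<^sub>r)\<close> vanishes unless it contains as many adjoints as
  non-adjoints. Hence invariance under free complexification makes the *-distribution of the family
  invariant under \<open>x\<^sub>r \<mapsto> c x\<^sub>r\<close> for \<open>\<bar>c\<bar> = 1\<close>. As the state is faithful, this rotation extends
  to an isometric *-homomorphism \<open>\<alpha>\<^sub>c\<close> of the C*-algebra generated by the family, and \<open>\<alpha>\<^sub>c\<close>
  multiplies words of length \<open>d\<close> by \<open>c\<^sup>d\<close>. Averaging the completely contractive maps \<open>\<alpha>\<^sub>c\<close> against the
  Poisson kernel with parameter \<open>r = e\<^sup>-\<^sup>t\<close> multiplies words of length \<open>d\<close> by \<open>r\<^sup>d\<close>, which is \<open>\<Gamma>\<^sub>t\<close>.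

  That *-homomorphisms preserving faithful states are isometric, and that *-homomorphisms are completely
  contractive, needs no spectral theory: square roots of \<open>1 - v\<close> for \<open>\<parallel>v\<parallel> \<le> 1\<close> come from the
  iteration \<open>y \<mapsto> (v + y\<^sup>2) / 2\<close>, and if \<open>s, u\<close> are commuting self-adjoint elements with
  \<open>s\<^sup>2 + u\<^sup>2 = 1\<close>, then \<open>s + iu\<close> is unitary.
\<close>

subsection \<open>The square root iteration\<close>

text \<open>A *-distribution controls norms because, for a faithful state, the norm of a
  self-adjoint \<open>b\<close> is bounded through inequalities between \<phi> at
  \<open>star (b * d) * (b * d)\<close> and \<phi> at \<open>star d * d\<close>, where
  \<open>d\<close> ranges only over a closed subalgebra containing \<open>b\<close>. For
  *-polynomials these values are combinations of *-moments, and only left multiplication occurs,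
  which suits a state that is not tracial. Matrix norms are measured on the GNS space of the whole
  algebra, whereas a rotation is defined only on the C*-algebra generated by the family, so no
  unitary on that space is at hand to conjugate with. This is why complete contractivity is obtained
  algebraically, from square roots with entries in the subalgebra. The average over the circle is
  replaced by finite sums over roots of unity, so that regularity of the rotations in their
  parameter never comes up. Cutting the Poisson kernel off at degree \<open>N\<close> multiplies its
  moment of order \<open>d\<close> by \<open>1 - r^(2(N - d))\<close>, which tends to 1 for
  \<open>r < 1\<close>. At \<open>r = 1\<close> the kernel degenerates, and t = 0 is treated
  apart.\<close>

text \<open>Comparison with the scalar iteration \<open>t\<close>, the case v = 1: it stays below 1,
  so its increments telescope to at most 1 and dominate \<open>d\<close>. This covers norm 1, where
  the iteration is no strict contraction. Stated for real sequences, it serves both algebra norms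
  and matrix norms.\<close>

lemma sqrt_iteration_bounds:
  fixes a d :: "nat \<Rightarrow> real"
  assumes a0: "a 0 = 0" and aS: "\<And>k. a (Suc k) \<le> (1 + (a k)\<^sup>2) / 2" and an: "\<And>k. 0 \<le> a k"
    and d0: "d 0 \<le> 1/2" and dS: "\<And>k. d (Suc k) \<le> (a (Suc k) + a k) * d k / 2" and dn: "\<And>k. 0 \<le> d k"
  shows "a k \<le> 1" and "summable d"
proof -
  define t :: "nat \<Rightarrow> real" where "t = rec_nat 0 (\<lambda>_ u. (1 + u\<^sup>2) / 2)"
  have t0: "t 0 = 0" and tS: "\<And>k. t (Suc k) = (1 + (t k)\<^sup>2) / 2" by (simp_all add: t_def)
  have tb: "0 \<le> t k \<and> t k \<le> 1" for k
  proof (induction k)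
    case (Suc k)
    then have "(t k)\<^sup>2 \<le> 1" by (simp add: power_le_one)
    then show ?case by (simp add: tS)
  qed (simp add: t0)
  have at: "a k \<le> t k" for k
  proof (induction k)
    case (Suc k)
    have "(a k)\<^sup>2 \<le> (t k)\<^sup>2" using Suc an by (intro power_mono) auto
    then show ?case using aS[of k] by (simp add: tS)
  qed (simp add: a0 t0)
  then show "a k \<le> 1" using tb by (meson order_trans)
  have dt: "d k \<le> t (Suc k) - t k" for k
  proof (induction k)
    case 0 then show ?case using d0 by (simp add: t0 tS)
  next
    case (Suc k)
    have "d (Suc k) \<le> (t (Suc k) + t k) * (t (Suc k) - t k) / 2"
      by (rule order_trans[OF dS], rule divide_right_mono, rule mult_mono)
        (use Suc at an dn tb in \<open>auto intro: add_mono add_nonneg_nonneg\<close>)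
    also have "\<dots> = t (Suc (Suc k)) - t (Suc k)"
      by (simp only: tS[of "Suc k"] tS[of k]) (simp add: field_simps power2_eq_square)
    finally show ?case .
  qed
  show "summable d"
  proof (rule bounded_imp_summable[where B = 1])
    fix n
    have "sum d {..n} \<le> (\<Sum>k\<le>n. t (Suc k) - t k)" by (intro sum_mono dt)
    also have "\<dots> = t (Suc n) - t 0" by (simp add: sum_telescope lessThan_Suc_atMost[symmetric] sum_lessThan_telescope)
    finally show "sum d {..n} \<le> 1" using tb[of "Suc n"] t0 by simp
  qed (rule dn)
qed

lemma summable_differences_convergent:
  fixes y :: "nat \<Rightarrow> 'a::banach"
  assumes "summable (\<lambda>k. norm (y (Suc k) - y k))"
  shows "convergent y"
proof -
  have "summable (\<lambda>k. y (Suc k) - y k)" using assms by (rule summable_norm_cancel)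
  then have "convergent (\<lambda>n. \<Sum>k<n. y (Suc k) - y k)" by (simp add: summable_iff_convergent)
  then have "convergent (\<lambda>n. y n - y 0)" by (simp add: sum_lessThan_telescope)
  then show ?thesis using convergent_diff_const_right_iff by blast
qed

text \<open>The fixed point equation says that \<open>1 - y\<close> squares to \<open>1 - v\<close>
  once a unit is present. The closed set \<open>Q\<close> transports to the limit whatever the
  iteration preserves: membership, self-adjointness, commutation.\<close>

lemma sqrt_iteration_limit:
  fixes v :: "'a::{real_normed_algebra, banach}"
  assumes v: "norm v \<le> 1" and Q: "closed Q" "0 \<in> Q" "\<And>y. y \<in> Q \<Longrightarrow> (1/2) *\<^sub>R (v + y * y) \<in> Q"
  obtains y where "y \<in> Q" "norm y \<le> 1" "y = (1/2) *\<^sub>R (v + y * y)"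
proof -
  define Y where "Y = rec_nat 0 (\<lambda>_ u. (1/2) *\<^sub>R (v + u * u))"
  have Y0: "Y 0 = 0" and YS: "\<And>k. Y (Suc k) = (1/2) *\<^sub>R (v + Y k * Y k)" by (simp_all add: Y_def)
  \<comment> \<open>A difference of squares, factored without commutativity.\<close>
  have diff: "Y (Suc (Suc k)) - Y (Suc k) =
      (1/2) *\<^sub>R (Y (Suc k) * (Y (Suc k) - Y k) + (Y (Suc k) - Y k) * Y k)" for k
    by (simp only: YS[of "Suc k"] YS[of k]) (simp add: algebra_simps)
  note b = sqrt_iteration_bounds[of "\<lambda>k. norm (Y k)" "\<lambda>k. norm (Y (Suc k) - Y k)"]
  have 1: "norm (Y 0) = 0" by (simp add: Y0)
  have 2: "norm (Y (Suc k)) \<le> (1 + (norm (Y k))\<^sup>2) / 2" for k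
  proof -
    have "norm (v + Y k * Y k) \<le> 1 + (norm (Y k))\<^sup>2"
      using norm_triangle_ineq[of v "Y k * Y k"] norm_mult_ineq[of "Y k" "Y k"] v
      by (simp add: power2_eq_square)
    then show ?thesis by (simp add: YS)
  qed
  have 3: "norm (Y (Suc 0) - Y 0) \<le> 1/2" using v by (simp add: Y0 YS)
  have 4: "norm (Y (Suc (Suc k)) - Y (Suc k)) \<le>
      (norm (Y (Suc k)) + norm (Y k)) * norm (Y (Suc k) - Y k) / 2" for k
  proof -
    have "norm (Y (Suc k) * (Y (Suc k) - Y k) + (Y (Suc k) - Y k) * Y k) \<le>
        norm (Y (Suc k)) * norm (Y (Suc k) - Y k) + norm (Y (Suc k) - Y k) * norm (Y k)"
      by (rule norm_triangle_le, rule add_mono) (rule norm_mult_ineq)+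
    moreover have "norm (Y (Suc (Suc k)) - Y (Suc k)) =
        norm (Y (Suc k) * (Y (Suc k) - Y k) + (Y (Suc k) - Y k) * Y k) / 2"
      unfolding diff norm_scaleR by simp
    moreover have "(a + b) * c / 2 = (a * c + c * b) / 2" for a b c :: real by (simp add: algebra_simps)
    ultimately show ?thesis by simp
  qed
  have bd: "norm (Y k) \<le> 1" for k using 1 2 3 4 by (intro b(1)) auto
  have "summable (\<lambda>k. norm (Y (Suc k) - Y k))" using 1 2 3 4 by (intro b(2)) auto
  then obtain y where y: "Y \<longlonglongrightarrow> y" using summable_differences_convergent convergentD by blast
  have "(\<lambda>k. (1/2) *\<^sub>R (v + Y k * Y k)) \<longlonglongrightarrow> (1/2) *\<^sub>R (v + y * y)"
    by (intro tendsto_intros y)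
  moreover have "(\<lambda>k. (1/2) *\<^sub>R (v + Y k * Y k)) \<longlonglongrightarrow> y"
    using LIMSEQ_Suc[OF y] by (simp add: YS)
  ultimately have fp: "y = (1/2) *\<^sub>R (v + y * y)" by (rule LIMSEQ_unique[rotated])
  have "Y k \<in> Q" for k by (induction k) (auto simp: Y0 YS intro!: Q)
  then have "y \<in> Q" using Q(1) y closed_sequentially by blast
  moreover have "norm y \<le> 1" using bd y by (intro Lim_bounded[OF tendsto_norm[OF y], of 0]) auto
  ultimately show thesis using fp that by blast
qed

subsection \<open>C*-algebras\<close>

lemma star_zero [simp]: "star (0::'a::cstar_algebra) = 0"
  using star_scaleC[of 0 "0::'a"] by simp

lemma star_minus [simp]: "star (- a) = - star (a::'a::cstar_algebra)"
  by (metis add.right_inverse minus_unique star_add star_zero)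

lemma star_diff: "star (a - b) = star a - star (b::'a::cstar_algebra)"
  using star_add[of a "- b"] by simp

lemma star_one [simp]: "star (1::'a::cstar_algebra) = 1"
  by (metis mult_1 mult_1_right star_mult star_star)

lemma star_scaleR: "star (r *\<^sub>R a) = r *\<^sub>R star (a::'a::cstar_algebra)"
  by (simp add: scaleR_scaleC star_scaleC)

lemma star_sum: "star (\<Sum>i\<in>I. f i) = (\<Sum>i\<in>I. star (f i :: 'a::cstar_algebra))"
  by (induction I rule: infinite_finite_induct) (auto simp: star_add)

lemma norm_star [simp]: "norm (star a) = norm (a::'a::cstar_algebra)"
proof -
  have le: "norm b \<le> norm (star b)" for b :: 'a
  proof (cases "b = 0")
    case False
    have "(norm b)\<^sup>2 \<le> norm (star b) * norm b"
      using norm_mult_ineq[of "star b" b] by (simp add: cstar_identity)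
    then show ?thesis using False by (simp add: power2_eq_square)
  qed simp
  show ?thesis using le[of a] le[of "star a"] by (simp add: star_star)
qed

lemma star_mult_self_eq_0: "star a * a = 0 \<longleftrightarrow> a = (0::'a::cstar_algebra)"
  by (metis cstar_identity mult_zero_right norm_eq_zero power2_eq_iff_nonneg norm_ge_zero zero_power2 power_eq_0_iff)

lemma bounded_linear_star: "bounded_linear (star :: 'a::cstar_algebra \<Rightarrow> 'a)"
  by (rule bounded_linear_intro[where K = 1]) (auto simp: star_add star_scaleR)

lemmas tendsto_star [tendsto_intros] = bounded_linear.tendsto[OF bounded_linear_star]
lemmas continuous_on_star [continuous_intros] = bounded_linear.continuous_on[OF bounded_linear_star]

lemma bounded_linear_scaleC: "bounded_linear (\<lambda>a. c *\<^sub>C (a::'a::complex_normed_vector))"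
  by (rule bounded_linear_intro[where K = "cmod c"])
    (auto simp: scaleC_add_right norm_scaleC scaleR_scaleC scaleC_scaleC mult.commute)

lemmas tendsto_scaleC [tendsto_intros] = bounded_linear.tendsto[OF bounded_linear_scaleC]

section \<open>Subalgebras and their closures\<close>

definition star_subalgebra :: "'a::cstar_algebra set \<Rightarrow> bool"
  where "star_subalgebra S \<longleftrightarrow> is_unital_subalgebra S \<and> (\<forall>a\<in>S. star a \<in> S)"

lemma unital_subalgebra_closed_ops:
  assumes "is_unital_subalgebra S"
  shows "0 \<in> S" "1 \<in> S" "a \<in> S \<Longrightarrow> b \<in> S \<Longrightarrow> a + b \<in> S" "a \<in> S \<Longrightarrow> b \<in> S \<Longrightarrow> a - b \<in> S"
    "a \<in> S \<Longrightarrow> b \<in> S \<Longrightarrow> a * b \<in> S" "a \<in> S \<Longrightarrow> c *\<^sub>C a \<in> S" "a \<in> S \<Longrightarrow> r *\<^sub>R a \<in> S"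
    "(\<And>i. i \<in> I \<Longrightarrow> f i \<in> S) \<Longrightarrow> (\<Sum>i\<in>I. f i) \<in> S"
  using assms unfolding is_unital_subalgebra_def
  by (auto simp: scaleR_scaleC complex_vector.subspace_0 complex_vector.subspace_add
      complex_vector.subspace_diff complex_vector.subspace_scale complex_vector.subspace_sum)

lemma star_subalgebra_closed_ops:
  assumes "star_subalgebra S"
  shows "0 \<in> S" "1 \<in> S" "a \<in> S \<Longrightarrow> b \<in> S \<Longrightarrow> a + b \<in> S" "a \<in> S \<Longrightarrow> b \<in> S \<Longrightarrow> a - b \<in> S"
    "a \<in> S \<Longrightarrow> b \<in> S \<Longrightarrow> a * b \<in> S" "a \<in> S \<Longrightarrow> c *\<^sub>C a \<in> S" "a \<in> S \<Longrightarrow> r *\<^sub>R a \<in> S"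
    "a \<in> S \<Longrightarrow> star a \<in> S" "(\<And>i. i \<in> I \<Longrightarrow> f i \<in> S) \<Longrightarrow> (\<Sum>i\<in>I. f i) \<in> S"
proof -
  have S: "is_unital_subalgebra S" "\<forall>a\<in>S. star a \<in> S" using assms by (auto simp: star_subalgebra_def)
  note u = unital_subalgebra_closed_ops[OF S(1)]
  show "0 \<in> S" "1 \<in> S" "a \<in> S \<Longrightarrow> b \<in> S \<Longrightarrow> a + b \<in> S" "a \<in> S \<Longrightarrow> b \<in> S \<Longrightarrow> a - b \<in> S"
    "a \<in> S \<Longrightarrow> b \<in> S \<Longrightarrow> a * b \<in> S" "a \<in> S \<Longrightarrow> c *\<^sub>C a \<in> S" "a \<in> S \<Longrightarrow> r *\<^sub>R a \<in> S"
    by (rule u; assumption)+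
  show "a \<in> S \<Longrightarrow> star a \<in> S" using S(2) by blast
  show "(\<And>i. i \<in> I \<Longrightarrow> f i \<in> S) \<Longrightarrow> (\<Sum>i\<in>I. f i) \<in> S" by (rule u(8))
qed

lemma star_subalgebra_UNIV: "star_subalgebra UNIV"
  by (simp add: star_subalgebra_def is_unital_subalgebra_def)

lemma csubspace_closure:
  fixes S :: "'a::complex_normed_vector set"
  assumes "csubspace S" shows "csubspace (closure S)"
proof (rule complex_vector.subspaceI)
  show "0 \<in> closure S" using complex_vector.subspace_0[OF assms] closure_subset by blast
next
  fix x y assume "x \<in> closure S" "y \<in> closure S"
  then obtain f g where "\<forall>n. f n \<in> S" "f \<longlonglongrightarrow> x" "\<forall>n. g n \<in> S" "g \<longlonglongrightarrow> y"
    by (meson closure_sequential)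
  then show "x + y \<in> closure S" unfolding closure_sequential
    by (intro exI[of _ "\<lambda>n. f n + g n"]) (auto intro: tendsto_intros complex_vector.subspace_add[OF assms])
next
  fix c x assume "x \<in> closure S"
  then obtain f where "\<forall>n. f n \<in> S" "f \<longlonglongrightarrow> x" by (meson closure_sequential)
  then show "c *\<^sub>C x \<in> closure S" unfolding closure_sequential
    by (intro exI[of _ "\<lambda>n. c *\<^sub>C f n"]) (auto intro: tendsto_intros complex_vector.subspace_scale[OF assms])
qed

lemma unital_subalgebra_closure:
  fixes S :: "'a::cstar_algebra set"
  assumes "is_unital_subalgebra S" shows "is_unital_subalgebra (closure S)"
  unfolding is_unital_subalgebra_def
proof (intro conjI ballI)
  show "csubspace (closure S)" using assms csubspace_closure by (auto simp: is_unital_subalgebra_def)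
  show "1 \<in> closure S" using assms closure_subset by (auto simp: is_unital_subalgebra_def)
  fix x y assume "x \<in> closure S" "y \<in> closure S"
  then obtain f g where "\<forall>n. f n \<in> S" "f \<longlonglongrightarrow> x" "\<forall>n. g n \<in> S" "g \<longlonglongrightarrow> y"
    by (meson closure_sequential)
  then show "x * y \<in> closure S" unfolding closure_sequential
    using assms unfolding is_unital_subalgebra_def
    by (intro exI[of _ "\<lambda>n. f n * g n"]) (auto intro: tendsto_intros)
qed

lemma star_subalgebra_closure:
  fixes S :: "'a::cstar_algebra set"
  assumes "star_subalgebra S" shows "star_subalgebra (closure S)"
  unfolding star_subalgebra_def
proof (intro conjI ballI)
  show "is_unital_subalgebra (closure S)"
    using assms unital_subalgebra_closure by (auto simp: star_subalgebra_def)
  fix x assume "x \<in> closure S"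
  then obtain f where "\<forall>n. f n \<in> S" "f \<longlonglongrightarrow> x" by (meson closure_sequential)
  then show "star x \<in> closure S" unfolding closure_sequential
    using assms unfolding star_subalgebra_def
    by (intro exI[of _ "\<lambda>n. star (f n)"]) (auto intro: tendsto_intros)
qed

section \<open>Square roots and the norm estimates drawn from them\<close>

text \<open>The root is \<open>1 - y\<close> for the limit \<open>y\<close> of the iteration. The
  bound on \<open>1 - s\<close> makes \<open>s\<close> itself eligible for a further square root,
  and commutation with everything that commutes with \<open>v\<close> stands in for functional
  calculus.\<close>

lemma cstar_sqrt:
  fixes v :: "'a::cstar_algebra"
  assumes "star_subalgebra S" "closed S" "v \<in> S" "star v = v" "norm v \<le> 1"
  obtains s where "s \<in> S" "star s = s" "s * s = 1 - v" "norm (1 - s) \<le> 1"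
    "\<And>c. c * v = v * c \<Longrightarrow> c * s = s * c"
proof -
  note ops = star_subalgebra_closed_ops[OF assms(1)]
  define Q where "Q = S \<inter> {y. star y = y} \<inter> (\<Inter>c\<in>{c. c * v = v * c}. {y. c * y = y * c})"
  have "closed Q" unfolding Q_def
    by (intro closed_Int closed_INT assms closed_Collect_eq continuous_intros ballI)
  moreover have "0 \<in> Q" by (simp add: Q_def ops)
  moreover have "(1/2) *\<^sub>R (v + y * y) \<in> Q" if "y \<in> Q" for y
  proof -
    have "c * (y * y) = y * y * c" if "c * v = v * c" for c
    proof -
      have "c * y = y * c" using \<open>y \<in> Q\<close> that by (auto simp: Q_def)
      then show ?thesis by (metis mult.assoc)
    qed
    moreover have y: "y \<in> S" "star y = y" using that by (simp_all add: Q_def)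
    moreover have "(1/2) *\<^sub>R (v + y * y) \<in> S" by (intro ops(7) ops(3) ops(5) assms(3) y)
    moreover have "star ((1/2) *\<^sub>R (v + y * y)) = (1/2) *\<^sub>R (v + y * y)"
      by (simp only: star_scaleR star_add star_mult assms y)
    moreover have "c * ((1/2) *\<^sub>R (v + y * y)) = (1/2) *\<^sub>R (v + y * y) * c" if "c * v = v * c" for c
      using calculation(1)[OF that] that by (simp add: distrib_left distrib_right)
    ultimately show ?thesis unfolding Q_def by blast
  qed
  ultimately obtain y where y: "y \<in> Q" "norm y \<le> 1" "y = (1/2) *\<^sub>R (v + y * y)"
    using sqrt_iteration_limit[OF assms(5), of Q] by blast
  have "y + y = 2 *\<^sub>R y" by (simp add: scaleR_2)
  also have "\<dots> = v + y * y" by (subst y(3)) simp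
  finally have "(1 - y) * (1 - y) = 1 - v" by (simp add: algebra_simps) 
  moreover have "1 - y \<in> S" using y(1) by (intro ops(4) ops(2)) (simp add: Q_def)
  moreover have "star (1 - y) = 1 - y" using y(1) by (simp add: star_diff Q_def)
  moreover have "c * (1 - y) = (1 - y) * c" if "c * v = v * c" for c
  proof -
    have "c * y = y * c" using y(1) that by (simp add: Q_def)
    then show ?thesis by (simp add: algebra_simps)
  qed
  moreover have "norm (1 - (1 - y)) \<le> 1" using y(2) by simp
  ultimately show thesis using that[of "1 - y"] by blast
qed

text \<open>\<open>V\<close> is \<open>M\<close> times an isometry by the hypothesis on the squares,
  and \<open>s\<close> is its real part.\<close>

lemma norm_le_of_squares_sum:
  fixes s u :: "'a::cstar_algebra"
  assumes "star s = s" "star u = u" "s * u = u * s" "s * s + u * u = (M\<^sup>2) *\<^sub>R 1" "0 \<le> M"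
  shows "norm s \<le> M"
proof -
  define V where "V = s + \<i> *\<^sub>C u"
  have sV: "star V = s - \<i> *\<^sub>C u" by (simp add: V_def star_add star_scaleC assms)
  have "star V * V = (s - \<i> *\<^sub>C u) * (s + \<i> *\<^sub>C u)" unfolding sV by (simp add: V_def)
  also have "\<dots> = s * s + u * u"
    by (simp add: algebra_simps scaleC_mult_left scaleC_mult_right scaleC_scaleC assms(3))
  finally have "(norm V)\<^sup>2 = M\<^sup>2" using assms(4) by (simp flip: cstar_identity)
  then have nV: "norm V = M" using assms(5) by simp
  have "s = (1/2) *\<^sub>R (V + star V)" unfolding sV by (simp add: V_def flip: scaleR_2)
  also have "norm \<dots> \<le> M" using norm_triangle_ineq[of V "star V"] nV by simp
  finally show ?thesis .
qed

text \<open>The root \<open>s\<close> of \<open>1 - u * u\<close> commutes with \<open>u\<close>,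
  and the two squares add up to 1, so \<open>s\<close> has norm at most 1. This allows a root of
  \<open>u * u\<close>, written as \<open>1 - (1 - u * u)\<close>, to be taken.\<close>

lemma norm_one_minus_square:
  fixes u :: "'a::cstar_algebra"
  assumes "star u = u" "norm u \<le> 1"
  shows "norm (1 - u * u) \<le> 1"
proof -
  have "norm (u * u) \<le> 1" using assms mult_le_one by (metis norm_ge_zero norm_mult_ineq order_trans)
  then obtain s where s: "star s = s" "s * s = 1 - u * u" "\<And>c. c * (u * u) = (u * u) * c \<Longrightarrow> c * s = s * c"
    using cstar_sqrt[OF star_subalgebra_UNIV closed_UNIV UNIV_I, of "u * u"] assms
    by (metis star_mult)
  have "norm s \<le> 1"
    using s assms by (intro norm_le_of_squares_sum[of s u 1]) (auto simp: mult.assoc)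
  then show ?thesis by (metis s(2) norm_ge_zero norm_mult_ineq order_trans mult_le_one)
qed

subsection \<open>Faithful states\<close>

lemma faithful_stateD:
  assumes "is_faithful_state \<phi>"
  shows "\<phi> (a + b) = \<phi> a + \<phi> b" "\<phi> (c *\<^sub>C a) = c * \<phi> a" "\<phi> 1 = 1" "\<phi> 0 = 0"
    "\<phi> (a - b) = \<phi> a - \<phi> b" "\<phi> (r *\<^sub>R a) = of_real r * \<phi> a"
    "\<phi> (star a * a) \<in> \<real>\<^sub>\<ge>\<^sub>0" "\<phi> (star a * a) = 0 \<Longrightarrow> a = 0"
proof -
  have *: "\<phi> (a + b) = \<phi> a + \<phi> b" "\<phi> (c *\<^sub>C a) = c * \<phi> a" for a b c
    using assms unfolding is_faithful_state_def Vector_Spaces.linear_def module_hom_def module_hom_axioms_def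
    by auto
  show "\<phi> (a + b) = \<phi> a + \<phi> b" "\<phi> (c *\<^sub>C a) = c * \<phi> a" by (rule *)+
  show "\<phi> 0 = 0" using *(2)[of 0 0] by simp
  have "\<phi> (a - b) + \<phi> b = \<phi> a" by (simp flip: *(1))
  then show "\<phi> (a - b) = \<phi> a - \<phi> b" by (simp add: eq_diff_eq)
  show "\<phi> (r *\<^sub>R a) = of_real r * \<phi> a" by (simp add: * scaleR_scaleC)
  show "\<phi> 1 = 1" "\<phi> (star a * a) \<in> \<real>\<^sub>\<ge>\<^sub>0" "\<phi> (star a * a) = 0 \<Longrightarrow> a = 0"
    using assms by (auto simp: is_faithful_state_def)
qed

lemma state_nonneg:
  assumes "is_faithful_state \<phi>"
  shows "0 \<le> Re (\<phi> (star a * a))" "Im (\<phi> (star a * a)) = 0"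
  using faithful_stateD(7)[OF assms, of a] by (auto simp: complex_nonneg_Reals_iff)

text \<open>Positivity is given only on elements \<open>star a * a\<close>. Up to the factor 4, a
  self-adjoint \<open>s\<close> is the difference of the squares of \<open>1 + s\<close> and
  \<open>1 - s\<close>, so the state is real on it; the real and imaginary parts of \<open>a\<close>
  then give the claim.\<close>

lemma state_star:
  fixes \<phi> :: "'a::cstar_algebra \<Rightarrow> complex"
  assumes "is_faithful_state \<phi>"
  shows "\<phi> (star a) = cnj (\<phi> a)"
proof -
  note st = faithful_stateD[OF assms]
  have sa: "Im (\<phi> s) = 0" if "star s = s" for s :: 'a
  proof -
    have "4 *\<^sub>R s = star (1 + s) * (1 + s) - star (1 - s) * (1 - s)"
      by (simp add: star_add star_diff that algebra_simps)
        (metis (no_types) add.assoc numeral_Bit0 one_add_one scaleR_add_left scaleR_one)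
    then have "of_real 4 * \<phi> s = \<phi> (star (1 + s) * (1 + s)) - \<phi> (star (1 - s) * (1 - s))"
      by (metis st(5) st(6))
    then have "Im (of_real 4 * \<phi> s) = 0" by (simp add: state_nonneg[OF assms])
    then show ?thesis by simp
  qed
  have "star (a + star a) = a + star a" by (simp add: star_add star_star add.commute)
  from sa[OF this] have 1: "Im (\<phi> (star a)) = - Im (\<phi> a)" by (simp add: st)
  have "star (\<i> *\<^sub>C (a - star a)) = \<i> *\<^sub>C (a - star a)"
    by (simp add: star_scaleC star_diff star_star complex_vector.scale_right_diff_distrib)
  from sa[OF this] have "Re (\<phi> (star a)) = Re (\<phi> a)" by (simp add: st)
  with 1 show ?thesis by (simp add: complex_eq_iff)
qed

text \<open>With \<open>v\<close> the normalisation of \<open>star a * a\<close> and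
  \<open>s\<close> a root of \<open>1 - v\<close>, the gap between the two sides is the state at
  \<open>star (s * d) * (s * d)\<close>, times the squared norm of \<open>a\<close>.\<close>

lemma state_mult_bound:
  fixes \<phi> :: "'a::cstar_algebra \<Rightarrow> complex"
  assumes "is_faithful_state \<phi>"
  shows "Re (\<phi> (star (a * d) * (a * d))) \<le> (norm a)\<^sup>2 * Re (\<phi> (star d * d))"
proof (cases "a = 0")
  case True then show ?thesis by (simp add: faithful_stateD[OF assms])
next
  case False
  define v where "v = (1 / (norm a)\<^sup>2) *\<^sub>R (star a * a)"
  have "star v = v" "norm v \<le> 1"
    using False by (auto simp: v_def star_scaleR star_mult star_star cstar_identity)
  then obtain s where s: "star s = s" "s * s = 1 - v"
    using cstar_sqrt[OF star_subalgebra_UNIV closed_UNIV UNIV_I] by metis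
  have "star (s * d) * (s * d) = star d * (s * s) * d" by (simp only: star_mult s(1) mult.assoc)
  also have "\<dots> = star d * d - (1 / (norm a)\<^sup>2) *\<^sub>R (star (a * d) * (a * d))"
    by (simp add: s v_def algebra_simps star_mult)
  finally have "0 \<le> Re (\<phi> (star d * d)) - (1 / (norm a)\<^sup>2) * Re (\<phi> (star (a * d) * (a * d)))"
    using state_nonneg(1)[OF assms, of "s * d"] by (simp add: faithful_stateD[OF assms])
  then show ?thesis using False by (simp add: field_simps)
qed

text \<open>Positivity at \<open>a - c\<close>, where \<open>c\<close> is the value of the state at
  \<open>a\<close>, is the Cauchy-Schwarz inequality against the unit.\<close>

lemma norm_state_le:
  assumes "is_faithful_state \<phi>"
  shows "norm (\<phi> a) \<le> norm a"
proof -
  note st = faithful_stateD[OF assms]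
  define c where "c = \<phi> a"
  have "star (a - c *\<^sub>C 1) * (a - c *\<^sub>C 1) =
      star a * a - c *\<^sub>C star a - cnj c *\<^sub>C a + (cnj c * c) *\<^sub>C 1"
    by (simp add: star_diff star_scaleC algebra_simps scaleC_mult_left scaleC_mult_right scaleC_scaleC
        mult.commute)
  then have "0 \<le> Re (\<phi> (star a * a - c *\<^sub>C star a - cnj c *\<^sub>C a + (cnj c * c) *\<^sub>C 1))"
    using state_nonneg(1)[OF assms] by metis
  also have "\<dots> = Re (\<phi> (star a * a)) - (cmod c)\<^sup>2"
    by (simp add: st state_star[OF assms] c_def[symmetric] cmod_power2) (simp add: power2_eq_square)
  also have "\<dots> \<le> (norm a)\<^sup>2 - (cmod c)\<^sup>2" using state_mult_bound[OF assms, of a 1] by (simp add: st)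
  finally show ?thesis using power2_le_imp_le[of "cmod c" "norm a"] by (simp add: c_def)
qed

lemma bounded_linear_state:
  assumes "is_faithful_state \<phi>"
  shows "bounded_linear \<phi>"
proof (rule bounded_linear_intro[where K = 1])
  show "\<phi> (r *\<^sub>R a) = r *\<^sub>R \<phi> a" for r a
    by (simp only: faithful_stateD(6)[OF assms] scaleR_conv_of_real[of r "\<phi> a"])
qed (simp_all add: faithful_stateD[OF assms] norm_state_le[OF assms])

text \<open>The element \<open>p\<close> below is twice the negative part of \<open>y\<close>; testing the hypothesis on it
  forces it to vanish, so that \<open>y\<close> equals its absolute value.\<close>

lemma faithful_state_positive_sqrt:
  fixes y :: "'a::cstar_algebra"
  assumes \<phi>: "is_faithful_state \<phi>" and S: "star_subalgebra S" "closed S"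
    and y: "y \<in> S" "star y = y" "norm y \<le> 1"
    and pos: "\<And>d. d \<in> S \<Longrightarrow> 0 \<le> Re (\<phi> (star d * (y * d)))"
  obtains t where "t \<in> S" "star t = t" "t * t = y" "\<And>c. c * y = y * c \<Longrightarrow> c * t = t * c"
proof -
  note st = faithful_stateD[OF \<phi>]
  note ops = star_subalgebra_closed_ops[OF S(1)]
  have v: "1 - y * y \<in> S" "star (1 - y * y) = 1 - y * y" "norm (1 - y * y) \<le> 1"
    using norm_one_minus_square[OF y(2,3)] by (auto intro!: ops y simp: star_diff star_mult y)
  \<comment> \<open>\<open>q\<close> is the absolute value of \<open>y\<close>, a root of
    \<open>y * y\<close>; its own root \<open>t\<close> is taken next, which is possible because
    \<open>1 - q\<close> has norm at most 1.\<close>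
  obtain q where q: "q \<in> S" "star q = q" "q * q = 1 - (1 - y * y)" "norm (1 - q) \<le> 1"
    "\<And>c. c * (1 - y * y) = (1 - y * y) * c \<Longrightarrow> c * q = q * c"
    by (rule cstar_sqrt[OF S v]) blast
  have qc: "c * q = q * c" if "c * y = y * c" for c
  proof (rule q(5))
    have "c * (y * y) = y * y * c" using that by (metis mult.assoc)
    then show "c * (1 - y * y) = (1 - y * y) * c" by (simp add: algebra_simps)
  qed
  have w: "1 - q \<in> S" "star (1 - q) = 1 - q" by (auto intro!: ops q simp: star_diff q)
  obtain t where t: "t \<in> S" "star t = t" "t * t = 1 - (1 - q)"
    "\<And>c. c * (1 - q) = (1 - q) * c \<Longrightarrow> c * t = t * c"
    by (rule cstar_sqrt[OF S w q(4)]) blast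
  have tt: "t * t = q" using t(3) by simp
  have tc: "c * t = t * c" if "c * y = y * c" for c
    using qc[OF that] by (intro t(4)) (simp add: algebra_simps)
  define p where "p = q - y"
  have qy: "q * y = y * q" using qc[of y] by simp
  have p: "p \<in> S" "star p = p" by (auto simp: p_def star_diff q y intro!: ops q y)
  have yp: "y * p = - (q * p)" by (simp add: p_def algebra_simps q(3) qy)
  \<comment> \<open>The state at the left side is nonnegative by \<open>pos\<close>, and at the
    right side nonpositive; faithfulness then gives \<open>t * p = 0\<close>, hence
    \<open>q * p = 0\<close> and \<open>star p * p = 0\<close>.\<close>
  have "star p * (y * p) = - (star (t * p) * (t * p))"
    by (simp add: yp star_mult t mult.assoc) (simp flip: mult.assoc tt)
  then have "\<phi> (star p * (y * p)) = - \<phi> (star (t * p) * (t * p))"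
    using st(5)[of 0 "star (t * p) * (t * p)"] by (simp add: st(4))
  with pos[OF p(1)] have "Re (\<phi> (star (t * p) * (t * p))) = 0"
    using state_nonneg(1)[OF \<phi>, of "t * p"] by simp
  then have "\<phi> (star (t * p) * (t * p)) = 0" using state_nonneg(2)[OF \<phi>] by (simp add: complex_eq_iff)
  then have "t * p = 0" by (rule st(8))
  then have "q * p = 0" by (simp flip: tt add: mult.assoc)
  then have "star p * p = 0" using yp by (subst (1) p(2)) (simp add: p_def left_diff_distrib)
  then have "q = y" by (simp add: star_mult_self_eq_0 p_def)
  then show thesis using that[OF t(1,2)] tt tc by blast
qed

text \<open>The hypothesis says that the state is nonnegative on \<open>star d * (z * d)\<close>
  with \<open>z\<close> the gap between \<open>M\<close> squared and \<open>b * b\<close>. Hence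
  \<open>z\<close> is a square of an element commuting with \<open>b\<close>, and the estimate for
  sums of squares applies. Testing only with \<open>d\<close> in \<open>S\<close> is what later
  makes the bound a statement about *-moments.\<close>

lemma norm_le_of_state_bound:
  fixes b :: "'a::cstar_algebra"
  assumes \<phi>: "is_faithful_state \<phi>" and S: "star_subalgebra S" "closed S"
    and b: "b \<in> S" "star b = b" and "0 \<le> M"
    and bd: "\<And>d. d \<in> S \<Longrightarrow> Re (\<phi> (star (b * d) * (b * d))) \<le> M\<^sup>2 * Re (\<phi> (star d * d))"
  shows "norm b \<le> M"
proof -
  note st = faithful_stateD[OF \<phi>]
  note ops = star_subalgebra_closed_ops[OF S(1)]
  define z where "z = M\<^sup>2 *\<^sub>R 1 - b * b"
  \<comment> \<open>Rescales \<open>z\<close> into the unit ball; the summand 1 keeps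
    \<open>R\<close> positive when \<open>z\<close> vanishes.\<close>
  define R where "R = norm z + 1"
  have R: "R > 0" by (simp add: R_def add_nonneg_pos)
  define y where "y = (1/R) *\<^sub>R z"
  have y: "y \<in> S" "star y = y" by (auto simp: y_def z_def star_scaleR star_diff star_mult b intro!: ops b)
  have ny: "norm y \<le> 1" using R by (simp add: y_def R_def)
  have pos: "0 \<le> Re (\<phi> (star d * (y * d)))" if "d \<in> S" for d
  proof -
    have "star d * (y * d) = (1/R) *\<^sub>R (M\<^sup>2 *\<^sub>R (star d * d) - star (b * d) * (b * d))"
      by (simp add: y_def z_def star_mult b algebra_simps)
    then show ?thesis using bd[OF that] R by (simp add: st)
  qed
  obtain t where t: "star t = t" "t * t = y" "\<And>c. c * y = y * c \<Longrightarrow> c * t = t * c"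
    using faithful_state_positive_sqrt[OF \<phi> S y ny pos] by metis
  have "b * y = y * b" by (simp add: y_def z_def algebra_simps)
  then have "b * t = t * b" by (rule t(3))
  moreover have "b * b + (sqrt R *\<^sub>R t) * (sqrt R *\<^sub>R t) = M\<^sup>2 *\<^sub>R 1"
    using R by (simp add: t y_def z_def)
  ultimately show ?thesis
    using \<open>0 \<le> M\<close> by (intro norm_le_of_squares_sum[of b "sqrt R *\<^sub>R t"]) (auto simp: star_scaleR t b)
qed

subsection \<open>Families with the same *-distribution\<close>

definition star_word :: "('i \<Rightarrow> 'a::cstar_algebra) \<Rightarrow> ('i \<times> bool) list \<Rightarrow> 'a"
  where "star_word x w = prod_list (map (\<lambda>(r, s). if s then star (x r) else x r) w)"

definition star_rev :: "('i \<times> bool) list \<Rightarrow> ('i \<times> bool) list"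
  where "star_rev w = rev (map (\<lambda>(r, s). (r, \<not> s)) w)"

lemma star_word_Nil [simp]: "star_word x [] = 1"
  by (simp add: star_word_def)

lemma star_word_append: "star_word x (v @ w) = star_word x v * star_word x w"
  by (simp add: star_word_def)

lemma star_word_star_rev: "star_word x (star_rev w) = star (star_word x w)"
  by (induction w) (auto simp: star_word_def star_rev_def star_mult star_star)

lemma star_rev_lists: "w \<in> lists (\<Lambda> \<times> UNIV) \<Longrightarrow> star_rev w \<in> lists (\<Lambda> \<times> UNIV)"
  by (fastforce simp: star_rev_def lists_eq_set)

lemma star_moment_star_word: "star_moment \<phi> x w = \<phi> (star_word x w)"
  by (simp add: star_moment_def star_word_def)

text \<open>The correspondence between *-polynomials in \<open>x\<close> and the same *-polynomials
  in \<open>y\<close>, kept as a relation: no free *-algebra has to be built, and single-valuedness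
  can wait until norms have been compared. Closure under products follows because words
  concatenate.\<close>

inductive_set star_graph ::
    "'i set \<Rightarrow> ('i \<Rightarrow> 'a::cstar_algebra) \<Rightarrow> ('i \<Rightarrow> 'b::cstar_algebra) \<Rightarrow> ('a \<times> 'b) set"
  for \<Lambda> x y where
    word: "w \<in> lists (\<Lambda> \<times> UNIV) \<Longrightarrow> (star_word x w, star_word y w) \<in> star_graph \<Lambda> x y"
  | add: "(a, b) \<in> star_graph \<Lambda> x y \<Longrightarrow> (c, d) \<in> star_graph \<Lambda> x y \<Longrightarrow> (a + c, b + d) \<in> star_graph \<Lambda> x y"
  | scale: "(a, b) \<in> star_graph \<Lambda> x y \<Longrightarrow> (k *\<^sub>C a, k *\<^sub>C b) \<in> star_graph \<Lambda> x y"

lemma star_graph_mult_word: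
  assumes "(a, b) \<in> star_graph \<Lambda> x y" "w \<in> lists (\<Lambda> \<times> UNIV)"
  shows "(star_word x w * a, star_word y w * b) \<in> star_graph \<Lambda> x y"
  using assms(1)
proof induction
  case (word v)
  then show ?case using assms(2) star_graph.word[of "w @ v" \<Lambda> x y] by (simp add: star_word_append)
next
  case (add a b c d)
  then show ?case using star_graph.add by (fastforce simp: distrib_left)
next
  case (scale a b k)
  then show ?case using star_graph.scale by (fastforce simp: scaleC_mult_right)
qed

lemma star_graph_mult:
  assumes "(a, b) \<in> star_graph \<Lambda> x y" "(c, d) \<in> star_graph \<Lambda> x y"
  shows "(a * c, b * d) \<in> star_graph \<Lambda> x y"
  using assms(1)
proof induction
  case (word v)
  then show ?case using assms(2) star_graph_mult_word by blast
next
  case (add a b a' b')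
  then show ?case using star_graph.add by (fastforce simp: distrib_right)
next
  case (scale a b k)
  then show ?case using star_graph.scale by (fastforce simp: scaleC_mult_left)
qed

lemma star_graph_star:
  assumes "(a, b) \<in> star_graph \<Lambda> x y"
  shows "(star a, star b) \<in> star_graph \<Lambda> x y"
  using assms
proof induction
  case (word v)
  then show ?case using star_graph.word[OF star_rev_lists[OF word]] by (simp add: star_word_star_rev)
next
  case (add a b a' b')
  then show ?case using star_graph.add by (fastforce simp: star_add)
next
  case (scale a b k)
  then show ?case using star_graph.scale by (fastforce simp: star_scaleC)
qed

lemma star_graph_diff:
  assumes "(a, b) \<in> star_graph \<Lambda> x y" "(c, d) \<in> star_graph \<Lambda> x y"
  shows "(a - c, b - d) \<in> star_graph \<Lambda> x y"
  using star_graph.add[OF assms(1) star_graph.scale[OF assms(2), of "-1"]]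
  by (simp add: complex_vector.scale_minus_left scaleC_one)

lemma star_graph_swap:
  "(a, b) \<in> star_graph \<Lambda> x y \<Longrightarrow> (b, a) \<in> star_graph \<Lambda> y x"
  by (induction rule: star_graph.induct) (auto intro: star_graph.intros)

lemma star_subalgebra_star_graph_Range: "star_subalgebra (snd ` star_graph \<Lambda> x y)"
  unfolding star_subalgebra_def is_unital_subalgebra_def
proof (intro conjI ballI complex_vector.subspaceI)
  have one: "(1, 1) \<in> star_graph \<Lambda> x y" using star_graph.word[of "[]" \<Lambda> x y] by simp
  then show "1 \<in> snd ` star_graph \<Lambda> x y" by force
  show "0 \<in> snd ` star_graph \<Lambda> x y" using star_graph.scale[OF one, of 0] by force
next
  fix a b assume "a \<in> snd ` star_graph \<Lambda> x y" "b \<in> snd ` star_graph \<Lambda> x y"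
  then obtain c d where "(c, a) \<in> star_graph \<Lambda> x y" "(d, b) \<in> star_graph \<Lambda> x y" by auto
  from star_graph.add[OF this] star_graph_mult[OF this]
  show "a + b \<in> snd ` star_graph \<Lambda> x y" "a * b \<in> snd ` star_graph \<Lambda> x y" by force+
next
  fix c a assume "a \<in> snd ` star_graph \<Lambda> x y"
  then show "c *\<^sub>C a \<in> snd ` star_graph \<Lambda> x y" using star_graph.scale by force
next
  fix a assume "a \<in> snd ` star_graph \<Lambda> x y"
  then show "star a \<in> snd ` star_graph \<Lambda> x y" using star_graph_star by force
qed

lemma star_subalgebra_star_graph_Domain: "star_subalgebra (fst ` star_graph \<Lambda> x y)"
proof -
  have "a \<in> fst ` star_graph \<Lambda> x y \<longleftrightarrow> a \<in> snd ` star_graph \<Lambda> y x" for a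
    using star_graph_swap[of a _ \<Lambda> x y] star_graph_swap[of _ a \<Lambda> y x]
    by (auto simp: image_def Bex_def split_paired_Ex)
  then have "fst ` star_graph \<Lambda> x y = snd ` star_graph \<Lambda> y x" by blast
  then show ?thesis by (simp add: star_subalgebra_star_graph_Range)
qed

context
  fixes \<phi> :: "'a::cstar_algebra \<Rightarrow> complex" and \<psi> :: "'b::cstar_algebra \<Rightarrow> complex"
    and \<Lambda> :: "'i set" and x :: "'i \<Rightarrow> 'a" and y :: "'i \<Rightarrow> 'b"
  assumes \<phi>: "is_faithful_state \<phi>" and \<psi>: "is_faithful_state \<psi>"
    and same: "same_star_distribution \<Lambda> \<phi> x \<psi> y"
begin

lemma star_graph_state: "(a, b) \<in> star_graph \<Lambda> x y \<Longrightarrow> \<phi> a = \<psi> b"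
proof (induction rule: star_graph.induct)
  case (word w)
  then show ?case using same by (auto simp: same_star_distribution_def star_moment_star_word)
qed (simp_all add: faithful_stateD[OF \<phi>] faithful_stateD[OF \<psi>])

text \<open>By the C*-identity it suffices to bound \<open>star b * b\<close>. For \<open>d\<close>
  in the range of the relation the required state inequality consists of *-moments, so it can be
  checked for the partner \<open>star a * a\<close>, where it is \<open>state_mult_bound\<close>;
  continuity extends it to the closure.\<close>

lemma star_graph_norm_le:
  assumes ab: "(a, b) \<in> star_graph \<Lambda> x y"
  shows "norm b \<le> norm a"
proof -
  let ?S = "closure (snd ` star_graph \<Lambda> x y)"
  have ab': "(star a * a, star b * b) \<in> star_graph \<Lambda> x y"
    by (intro star_graph_mult star_graph_star ab)
  note cont = bounded_linear.continuous_on[OF bounded_linear_state[OF \<psi>]]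
  have "norm (star b * b) \<le> (norm a)\<^sup>2"
  proof (rule norm_le_of_state_bound[OF \<psi> star_subalgebra_closure[OF star_subalgebra_star_graph_Range] closed_closure])
    show "star b * b \<in> ?S" using ab' closure_subset by force
    show "star (star b * b) = star b * b" by (simp add: star_mult star_star)
    show "Re (\<psi> (star (star b * b * d) * (star b * b * d))) \<le> ((norm a)\<^sup>2)\<^sup>2 * Re (\<psi> (star d * d))"
      if "d \<in> ?S" for d
    proof -
      let ?F = "{d. Re (\<psi> (star (star b * b * d) * (star b * b * d))) \<le> ((norm a)\<^sup>2)\<^sup>2 * Re (\<psi> (star d * d))}"
      have "closed ?F" by (intro closed_Collect_le continuous_intros cont)
      moreover have "d \<in> ?F" if d: "(c, d) \<in> star_graph \<Lambda> x y" for c d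
      proof -
        have "\<phi> (star c * c) = \<psi> (star d * d)"
          "\<phi> (star (star a * a * c) * (star a * a * c)) = \<psi> (star (star b * b * d) * (star b * b * d))"
          by (intro star_graph_state star_graph_mult star_graph_star ab d)+
        then show ?thesis using state_mult_bound[OF \<phi>, of "star a * a" c] by (simp add: cstar_identity)
      qed
      ultimately have "?S \<subseteq> ?F" by (intro closure_minimal) auto
      then show ?thesis using that by blast
    qed
  qed simp
  then show ?thesis by (simp add: cstar_identity)
qed

end

lemma same_star_distribution_sym:
  "same_star_distribution \<Lambda> \<phi> x \<psi> y \<Longrightarrow> same_star_distribution \<Lambda> \<psi> y \<phi> x"
  by (simp add: same_star_distribution_def)

definition isometric_star_hom_on :: "'a::cstar_algebra set \<Rightarrow> ('a \<Rightarrow> 'b::cstar_algebra) \<Rightarrow> bool"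
  where "isometric_star_hom_on C \<alpha> \<longleftrightarrow> clinear_on C \<alpha> \<and> \<alpha> 1 = 1 \<and>
    (\<forall>a\<in>C. \<forall>b\<in>C. \<alpha> (a * b) = \<alpha> a * \<alpha> b) \<and> (\<forall>a\<in>C. \<alpha> (star a) = star (\<alpha> a) \<and> norm (\<alpha> a) = norm a)"

text \<open>The closure of \<open>star_graph\<close> in the product space is the graph of \<alpha>.
  Related elements have equal norms in both directions; applied to differences this makes the
  closure single-valued, and it sends Cauchy sequences to Cauchy sequences, so every point of the
  closed domain has an image. All algebraic identities pass to limits.\<close>

theorem same_star_distribution_isometric_star_hom:
  fixes x :: "'i \<Rightarrow> 'a::cstar_algebra" and y :: "'i \<Rightarrow> 'b::cstar_algebra"
  assumes \<phi>: "is_faithful_state \<phi>" and \<psi>: "is_faithful_state \<psi>"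
    and same: "same_star_distribution \<Lambda> \<phi> x \<psi> y"
  obtains \<alpha> :: "'a \<Rightarrow> 'b" where
    "isometric_star_hom_on (closure (fst ` star_graph \<Lambda> x y)) \<alpha>"
    "\<And>w. w \<in> lists (\<Lambda> \<times> UNIV) \<Longrightarrow> \<alpha> (star_word x w) = star_word y w"
proof -
  let ?R = "star_graph \<Lambda> x y"
  let ?C = "closure (fst ` ?R)"
  have nrm: "norm b = norm a" if "(a, b) \<in> ?R" for a b
    using star_graph_norm_le[OF \<phi> \<psi> same that]
      star_graph_norm_le[OF \<psi> \<phi> same_star_distribution_sym[OF same] star_graph_swap[OF that]] by simp
  have seqE: "\<exists>f g. (\<forall>n. (f n, g n) \<in> ?R) \<and> f \<longlonglongrightarrow> a \<and> g \<longlonglongrightarrow> b" if "(a, b) \<in> closure ?R" for a b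
  proof -
    from that obtain h where h: "\<forall>n. h n \<in> ?R" "h \<longlonglongrightarrow> (a, b)" by (meson closure_sequential)
    from tendsto_fst[OF h(2)] tendsto_snd[OF h(2)] h(1) show ?thesis
      by (intro exI[of _ "\<lambda>n. fst (h n)"] exI[of _ "\<lambda>n. snd (h n)"]) simp
  qed
  have seqI: "(a, b) \<in> closure ?R" if "\<And>n::nat. (f n, g n) \<in> ?R" "f \<longlonglongrightarrow> a" "g \<longlonglongrightarrow> b" for f g a b
    unfolding closure_sequential using that tendsto_Pair[OF that(2,3)]
    by (intro exI[of _ "\<lambda>n. (f n, g n)"]) simp
  have nrm': "norm b = norm a" if ab: "(a, b) \<in> closure ?R" for a b
  proof -
    obtain f g where fg: "\<forall>n. (f n, g n) \<in> ?R" "f \<longlonglongrightarrow> a" "g \<longlonglongrightarrow> b" using seqE[OF ab] by blast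
    have "(\<lambda>n. norm (g n)) = (\<lambda>n. norm (f n))" using nrm fg(1) by blast
    then have "(\<lambda>n. norm (f n)) \<longlonglongrightarrow> norm a" "(\<lambda>n. norm (f n)) \<longlonglongrightarrow> norm b"
      using tendsto_norm[OF fg(2)] tendsto_norm[OF fg(3)] by simp_all
    then show ?thesis by (rule LIMSEQ_unique[rotated])
  qed
  have add: "(a + c, b + d) \<in> closure ?R" and diff: "(a - c, b - d) \<in> closure ?R"
    and mult: "(a * c, b * d) \<in> closure ?R" if ab: "(a, b) \<in> closure ?R" "(c, d) \<in> closure ?R" for a b c d
  proof -
    obtain f g where fg: "\<forall>n. (f n, g n) \<in> ?R" "f \<longlonglongrightarrow> a" "g \<longlonglongrightarrow> b" using seqE[OF ab(1)] by blast
    obtain h k where hk: "\<forall>n. (h n, k n) \<in> ?R" "h \<longlonglongrightarrow> c" "k \<longlonglongrightarrow> d" using seqE[OF ab(2)] by blast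
    show "(a + c, b + d) \<in> closure ?R"
      by (rule seqI[of "\<lambda>n. f n + h n" "\<lambda>n. g n + k n"]) (use fg hk in \<open>auto intro: star_graph.add tendsto_intros\<close>)
    show "(a - c, b - d) \<in> closure ?R"
      by (rule seqI[of "\<lambda>n. f n - h n" "\<lambda>n. g n - k n"]) (use fg hk in \<open>auto intro: star_graph_diff tendsto_intros\<close>)
    show "(a * c, b * d) \<in> closure ?R"
      by (rule seqI[of "\<lambda>n. f n * h n" "\<lambda>n. g n * k n"]) (use fg hk in \<open>auto intro: star_graph_mult tendsto_intros\<close>)
  qed
  have scale: "(l *\<^sub>C a, l *\<^sub>C b) \<in> closure ?R" and star: "(star a, star b) \<in> closure ?R"
    if ab: "(a, b) \<in> closure ?R" for a b l
  proof -
    obtain f g where fg: "\<forall>n. (f n, g n) \<in> ?R" "f \<longlonglongrightarrow> a" "g \<longlonglongrightarrow> b" using seqE[OF ab] by blast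
    show "(l *\<^sub>C a, l *\<^sub>C b) \<in> closure ?R"
      by (rule seqI[of "\<lambda>n. l *\<^sub>C f n" "\<lambda>n. l *\<^sub>C g n"]) (use fg in \<open>auto intro: star_graph.scale tendsto_intros\<close>)
    show "(star a, star b) \<in> closure ?R"
      by (rule seqI[of "\<lambda>n. star (f n)" "\<lambda>n. star (g n)"]) (use fg in \<open>auto intro: star_graph_star tendsto_intros\<close>)
  qed
  have ex: "\<exists>b. (a, b) \<in> closure ?R" if a: "a \<in> ?C" for a
  proof -
    obtain f where f: "\<forall>n. f n \<in> fst ` ?R" "f \<longlonglongrightarrow> a"
      using a unfolding closure_sequential by blast
    have "\<exists>b. (f n, b) \<in> ?R" for n
    proof -
      obtain p where p: "p \<in> ?R" "f n = fst p" using f(1) by (meson imageE)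
      then show ?thesis by (intro exI[of _ "snd p"]) simp
    qed
    then have "\<exists>g. \<forall>n. (f n, g n) \<in> ?R" by (intro choice allI)
    then obtain g where fg: "\<And>n. (f n, g n) \<in> ?R" by blast
    have "dist (g m) (g n) = dist (f m) (f n)" for m n
      unfolding dist_norm by (intro nrm star_graph_diff fg)
    then have "Cauchy g" using LIMSEQ_imp_Cauchy[OF f(2)] by (simp add: Cauchy_def)
    then obtain b where "g \<longlonglongrightarrow> b" using Cauchy_convergent convergentD by blast
    then show ?thesis using seqI[OF fg f(2)] by blast
  qed
  define \<alpha> where "\<alpha> a = (SOME b. (a, b) \<in> closure ?R)" for a
  have \<alpha>: "(a, \<alpha> a) \<in> closure ?R" if a: "a \<in> ?C" for a
    unfolding \<alpha>_def using ex[OF that] by (rule someI_ex)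
  have uniq: "\<alpha> a = b" if ab: "(a, b) \<in> closure ?R" for a b
  proof -
    obtain f g where fg: "\<forall>n. (f n, g n) \<in> ?R" "f \<longlonglongrightarrow> a" using seqE[OF ab] by blast
    have "f n \<in> fst ` ?R" for n using imageI[OF fg(1)[rule_format, of n], of fst] by simp
    then have "a \<in> ?C" using fg(2) unfolding closure_sequential by blast
    from nrm'[OF diff[OF \<alpha>[OF this] ab]] show ?thesis by simp
  qed
  have word: "\<alpha> (star_word x w) = star_word y w" if "w \<in> lists (\<Lambda> \<times> UNIV)" for w
    using star_graph.word[OF that] closure_subset by (intro uniq) blast
  have "isometric_star_hom_on ?C \<alpha>"
    unfolding isometric_star_hom_on_def clinear_on_def
    using word[of "[]"] by (auto intro!: uniq add scale mult star \<alpha> nrm')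
  with word that show thesis by blast
qed

subsection \<open>The GNS representation\<close>

lemma cinner_add_right: "cinner x (y + z) = cinner x y + cinner (x::'a::chilbert_space) z"
  by (metis cinner_add_left cinner_commute complex_cnj_add)

lemma cinner_scaleC_right: "cinner x (c *\<^sub>C y) = cnj c * cinner (x::'a::chilbert_space) y"
  by (metis cinner_commute cinner_scaleC_left complex_cnj_mult)

lemma cinner_scaleR_left: "cinner (r *\<^sub>R x) y = of_real r * cinner (x::'a::chilbert_space) y"
  by (simp add: scaleR_scaleC cinner_scaleC_left)

lemma cinner_scaleR_right: "cinner x (r *\<^sub>R y) = of_real r * cinner (x::'a::chilbert_space) y"
  by (simp add: scaleR_scaleC cinner_scaleC_right)

lemma cinner_zero_left [simp]: "cinner 0 (x::'a::chilbert_space) = 0"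
  using cinner_scaleR_left[of 0 0 x] by simp

lemma cinner_zero_right [simp]: "cinner (x::'a::chilbert_space) 0 = 0"
  using cinner_scaleR_right[of x 0 0] by simp

lemma cinner_diff_left: "cinner (x - y) z = cinner x z - cinner (y::'a::chilbert_space) z"
  using cinner_add_left[of "x - y" y z] by simp

lemma cinner_sum_left: "cinner (\<Sum>i\<in>I. f i) y = (\<Sum>i\<in>I. cinner (f i) (y::'a::chilbert_space))"
  by (induction I rule: infinite_finite_induct) (auto simp: cinner_add_left)

lemma cinner_sum_right: "cinner y (\<Sum>i\<in>I. f i) = (\<Sum>i\<in>I. cinner (y::'a::chilbert_space) (f i))"
  by (induction I rule: infinite_finite_induct) (auto simp: cinner_add_right)

lemma norm_eq_Re_cinner: "(norm x)\<^sup>2 = Re (cinner x (x::'a::chilbert_space))"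
  by (simp add: power2_norm_eq_inner inner_cinner)

lemma Re_cinner_le: "Re (cinner x y) \<le> norm x * norm (y::'a::chilbert_space)"
  using norm_cauchy_schwarz[of x y] by (simp add: inner_cinner)

lemma star_repD:
  assumes "is_star_rep \<pi>"
  shows "bounded_linear (\<pi> a)" "\<pi> a (c *\<^sub>C \<xi>) = c *\<^sub>C \<pi> a \<xi>"
    "\<pi> (a + b) \<xi> = \<pi> a \<xi> + \<pi> b \<xi>" "\<pi> (c *\<^sub>C a) \<xi> = c *\<^sub>C \<pi> a \<xi>" "\<pi> (a * b) \<xi> = \<pi> a (\<pi> b \<xi>)"
    "\<pi> 1 \<xi> = \<xi>" "cinner (\<pi> (star a) \<xi>) \<zeta> = cinner \<xi> (\<pi> a \<zeta>)"
    "\<pi> (r *\<^sub>R a) \<xi> = r *\<^sub>R \<pi> a \<xi>" "\<pi> 0 \<xi> = 0" "\<pi> (a - b) \<xi> = \<pi> a \<xi> - \<pi> b \<xi>"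
    "\<pi> a (\<xi> + \<zeta>) = \<pi> a \<xi> + \<pi> a \<zeta>" "\<pi> a (r *\<^sub>R \<xi>) = r *\<^sub>R \<pi> a \<xi>" "\<pi> a 0 = 0"
proof -
  note d = assms[unfolded is_star_rep_def]
  show bl: "bounded_linear (\<pi> a)" and "\<pi> (a + b) \<xi> = \<pi> a \<xi> + \<pi> b \<xi>" "\<pi> (c *\<^sub>C a) \<xi> = c *\<^sub>C \<pi> a \<xi>" "\<pi> (a * b) \<xi> = \<pi> a (\<pi> b \<xi>)"
    "\<pi> 1 \<xi> = \<xi>" "cinner (\<pi> (star a) \<xi>) \<zeta> = cinner \<xi> (\<pi> a \<zeta>)" using d by blast+
  show "\<pi> a (c *\<^sub>C \<xi>) = c *\<^sub>C \<pi> a \<xi>" 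
    using d unfolding Vector_Spaces.linear_def module_hom_def module_hom_axioms_def by blast
  show r: "\<pi> (r *\<^sub>R a) \<xi> = r *\<^sub>R \<pi> a \<xi>" for r a using d by (simp add: scaleR_scaleC)
  show "\<pi> 0 \<xi> = 0" using r[of 0 0] by simp
  have "\<pi> (a - b + b) \<xi> = \<pi> (a - b) \<xi> + \<pi> b \<xi>" using d by blast
  then show "\<pi> (a - b) \<xi> = \<pi> a \<xi> - \<pi> b \<xi>" by simp
  show "\<pi> a (\<xi> + \<zeta>) = \<pi> a \<xi> + \<pi> a \<zeta>" "\<pi> a (r *\<^sub>R \<xi>) = r *\<^sub>R \<pi> a \<xi>" "\<pi> a 0 = 0"
    using bl by (simp_all add: bounded_linear.linear linear_add linear_scale linear_0)
qed

lemma star_rep_sum: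
  assumes "is_star_rep \<pi>"
  shows "\<pi> (\<Sum>i\<in>I. f i) \<xi> = (\<Sum>i\<in>I. \<pi> (f i) \<xi>)" "\<pi> a (\<Sum>i\<in>I. g i) = (\<Sum>i\<in>I. \<pi> a (g i))"
  by (induction I rule: infinite_finite_induct; simp add: star_repD[OF assms])+

lemma gns_cinner:
  assumes "is_gns_triple \<phi> \<pi> \<Omega>"
  shows "cinner (\<pi> a \<Omega>) (\<pi> b \<Omega>) = \<phi> (star b * a)"
proof -
  have \<pi>: "is_star_rep \<pi>" and \<phi>: "\<phi> a = cinner (\<pi> a \<Omega>) \<Omega>" for a
    using assms by (auto simp: is_gns_triple_def)
  have "\<phi> (star b * a) = cinner (\<pi> (star b) (\<pi> a \<Omega>)) \<Omega>" by (simp add: \<phi> star_repD[OF \<pi>])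
  also have "\<dots> = cinner (\<pi> a \<Omega>) (\<pi> b \<Omega>)" by (rule star_repD(7)[OF \<pi>])
  finally show ?thesis by simp
qed

lemma gns_norm:
  assumes "is_gns_triple \<phi> \<pi> \<Omega>"
  shows "(norm (\<pi> a \<Omega>))\<^sup>2 = Re (\<phi> (star a * a))"
  by (simp add: norm_eq_Re_cinner gns_cinner[OF assms])

text \<open>On the dense vectors coming from the algebra this is
  \<open>state_mult_bound\<close>.\<close>

lemma gns_norm_le:
  assumes \<phi>: "is_faithful_state \<phi>" and gns: "is_gns_triple \<phi> \<pi> \<Omega>"
  shows "norm (\<pi> a \<xi>) \<le> norm a * norm \<xi>"
proof -
  have \<pi>: "is_star_rep \<pi>" and dense: "closure (range (\<lambda>a. \<pi> a \<Omega>)) = UNIV"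
    using gns by (auto simp: is_gns_triple_def)
  let ?F = "{\<xi>. norm (\<pi> a \<xi>) \<le> norm a * norm \<xi>}"
  have "closed ?F"
    by (intro closed_Collect_le continuous_intros bounded_linear.continuous_on[OF star_repD(1)[OF \<pi>]])
  moreover have "\<pi> d \<Omega> \<in> ?F" for d
  proof -
    have "(norm (\<pi> a (\<pi> d \<Omega>)))\<^sup>2 \<le> (norm a * norm (\<pi> d \<Omega>))\<^sup>2"
      using state_mult_bound[OF \<phi>, of a d]
      by (simp add: gns_norm[OF gns] power_mult_distrib flip: star_repD(5)[OF \<pi>])
    then show ?thesis using power2_le_imp_le by fastforce
  qed
  ultimately have "closure (range (\<lambda>a. \<pi> a \<Omega>)) \<subseteq> ?F" by (intro closure_minimal) auto
  then show ?thesis using dense by blast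
qed

text \<open>Together with the converse bound this makes the GNS representation isometric. The bound
  passes to \<open>star b\<close> by duality, hence to \<open>star b * b\<close>, where faithfulness
  recovers the algebra norm from the state.\<close>

lemma gns_norm_le_imp:
  assumes \<phi>: "is_faithful_state \<phi>" and gns: "is_gns_triple \<phi> \<pi> \<Omega>"
    and M: "0 \<le> M" "\<And>\<xi>. norm (\<pi> b \<xi>) \<le> M * norm \<xi>"
  shows "norm b \<le> M"
proof -
  have \<pi>: "is_star_rep \<pi>" using gns by (auto simp: is_gns_triple_def)
  have star: "norm (\<pi> (star b) \<xi>) \<le> M * norm \<xi>" for \<xi>
  proof (cases "\<pi> (star b) \<xi> = 0")
    case False
    have "(norm (\<pi> (star b) \<xi>))\<^sup>2 = Re (cinner \<xi> (\<pi> b (\<pi> (star b) \<xi>)))"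
      by (simp add: norm_eq_Re_cinner star_repD[OF \<pi>])
    also have "\<dots> \<le> norm \<xi> * (M * norm (\<pi> (star b) \<xi>))"
      by (rule order_trans[OF Re_cinner_le]) (intro mult_left_mono M norm_ge_zero)
    finally show ?thesis using False by (simp add: power2_eq_square algebra_simps)
  qed (simp add: M)
  have "norm (star b * b) \<le> M\<^sup>2"
  proof (rule norm_le_of_state_bound[OF \<phi> star_subalgebra_UNIV closed_UNIV UNIV_I])
    show "star (star b * b) = star b * b" by (simp add: star_mult star_star)
    fix d
    have "norm (\<pi> (star b * b * d) \<Omega>) \<le> M * (M * norm (\<pi> d \<Omega>))"
      unfolding star_repD(5)[OF \<pi>] by (rule order_trans[OF star]) (intro mult_left_mono M)
    then have "(norm (\<pi> (star b * b * d) \<Omega>))\<^sup>2 \<le> (M * (M * norm (\<pi> d \<Omega>)))\<^sup>2" by (intro power_mono) auto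
    then show "Re (\<phi> (star (star b * b * d) * (star b * b * d))) \<le> (M\<^sup>2)\<^sup>2 * Re (\<phi> (star d * d))"
      by (simp add: gns_norm[OF gns] power_mult_distrib mult.assoc flip: power_mult power_add)
  qed simp
  then show ?thesis using M(1) by (simp add: cstar_identity)
qed

subsection \<open>Matrices over a C*-algebra\<close>

text \<open>Matrices and vectors are functions on all naturals; indices from \<open>n\<close> on are
  ignored by \<open>vec_norm\<close> and by the sums, so identities between entries are asserted
  only below \<open>n\<close> where that matters.\<close>

definition mat_op :: "('a \<Rightarrow> 'h \<Rightarrow> 'h::chilbert_space) \<Rightarrow> nat \<Rightarrow> (nat \<Rightarrow> nat \<Rightarrow> 'a) \<Rightarrow> (nat \<Rightarrow> 'h) \<Rightarrow> nat \<Rightarrow> 'h"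
  where "mat_op \<pi> n a \<xi> i = (\<Sum>j<n. \<pi> (a i j) (\<xi> j))"

definition vec_norm :: "nat \<Rightarrow> (nat \<Rightarrow> 'h::chilbert_space) \<Rightarrow> real"
  where "vec_norm n \<xi> = sqrt (\<Sum>j<n. (norm (\<xi> j))\<^sup>2)"

definition mat_mult :: "nat \<Rightarrow> (nat \<Rightarrow> nat \<Rightarrow> 'a::cstar_algebra) \<Rightarrow> (nat \<Rightarrow> nat \<Rightarrow> 'a) \<Rightarrow> nat \<Rightarrow> nat \<Rightarrow> 'a"
  where "mat_mult n a b i j = (\<Sum>k<n. a i k * b k j)"

lemma vec_norm_sq: "(vec_norm n \<xi>)\<^sup>2 = (\<Sum>j<n. (norm (\<xi> j))\<^sup>2)"
  by (simp add: vec_norm_def sum_nonneg)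

lemma vec_norm_nonneg [simp]: "0 \<le> vec_norm n \<xi>"
  by (simp add: vec_norm_def sum_nonneg)

lemma vec_norm_component_le: "i < n \<Longrightarrow> norm (\<xi> i) \<le> vec_norm n \<xi>"
  unfolding vec_norm_def by (rule real_le_rsqrt) (auto intro: member_le_sum)

lemma vec_norm_triangle: "vec_norm n (\<lambda>i. \<xi> i + \<zeta> i) \<le> vec_norm n \<xi> + vec_norm n \<zeta>"
proof -
  have "vec_norm n (\<lambda>i. \<xi> i + \<zeta> i) \<le> L2_set (\<lambda>i. norm (\<xi> i) + norm (\<zeta> i)) {..<n}"
    unfolding vec_norm_def L2_set_def
    by (intro real_sqrt_le_mono sum_mono power_mono norm_triangle_ineq) auto
  also have "\<dots> \<le> vec_norm n \<xi> + vec_norm n \<zeta>"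
    unfolding vec_norm_def L2_set_def[symmetric] by (rule L2_set_triangle_ineq)
  finally show ?thesis .
qed

lemma vec_norm_scaleR: "vec_norm n (\<lambda>i. r *\<^sub>R \<xi> i) = \<bar>r\<bar> * vec_norm n \<xi>"
  by (simp add: vec_norm_def power_mult_distrib real_sqrt_mult flip: sum_distrib_left)

lemma vec_norm_le_sum: "vec_norm n \<xi> \<le> (\<Sum>i<n. norm (\<xi> i))"
  unfolding vec_norm_def L2_set_def[symmetric] by (rule L2_set_le_sum) auto

lemma matrix_norm_alt: "matrix_norm \<pi> n a = Sup {vec_norm n (mat_op \<pi> n a \<xi>) | \<xi>. vec_norm n \<xi> \<le> 1}"
  by (simp add: matrix_norm_def vec_norm_def mat_op_def)

context
  fixes \<phi> :: "'a::cstar_algebra \<Rightarrow> complex" and \<pi> :: "'a \<Rightarrow> 'h::chilbert_space \<Rightarrow> 'h" and \<Omega> :: 'h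
  assumes \<phi>: "is_faithful_state \<phi>" and gns: "is_gns_triple \<phi> \<pi> \<Omega>"
begin

lemma gns_star_rep: "is_star_rep \<pi>"
  using gns by (auto simp: is_gns_triple_def)

lemmas rep = star_repD[OF gns_star_rep] star_rep_sum[OF gns_star_rep]

lemma mat_op_scaleR: "mat_op \<pi> n a (\<lambda>j. r *\<^sub>R \<xi> j) = (\<lambda>i. r *\<^sub>R mat_op \<pi> n a \<xi> i)"
  by (rule ext) (simp add: mat_op_def rep scaleR_sum_right)

lemma mat_op_mult: "mat_op \<pi> n (mat_mult n a b) \<xi> = mat_op \<pi> n a (mat_op \<pi> n b \<xi>)"
  by (rule ext) (simp add: mat_op_def mat_mult_def rep, rule sum.swap)

lemma mat_op_norm_le_sum: "vec_norm n (mat_op \<pi> n a \<xi>) \<le> (\<Sum>i<n. \<Sum>j<n. norm (a i j)) * vec_norm n \<xi>"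
proof -
  have "norm (\<pi> (a i j) (\<xi> j)) \<le> norm (a i j) * vec_norm n \<xi>" if "j < n" for i j
    by (rule order_trans[OF gns_norm_le[OF \<phi> gns]]) (intro mult_left_mono vec_norm_component_le that norm_ge_zero)
  then have "(\<Sum>i<n. norm (mat_op \<pi> n a \<xi> i)) \<le> (\<Sum>i<n. \<Sum>j<n. norm (a i j) * vec_norm n \<xi>)"
    unfolding mat_op_def by (intro sum_mono order_trans[OF norm_sum]) auto
  then show ?thesis using vec_norm_le_sum[of n "mat_op \<pi> n a \<xi>"] by (simp add: sum_distrib_right)
qed

lemma matrix_norm_bdd: "bdd_above {vec_norm n (mat_op \<pi> n a \<xi>) | \<xi>. vec_norm n \<xi> \<le> 1}"
proof (rule bdd_aboveI, safe)
  fix \<xi> :: "nat \<Rightarrow> 'h" assume "vec_norm n \<xi> \<le> 1"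
  then have "(\<Sum>i<n. \<Sum>j<n. norm (a i j)) * vec_norm n \<xi> \<le> (\<Sum>i<n. \<Sum>j<n. norm (a i j)) * 1"
    by (intro mult_left_mono sum_nonneg) auto
  then show "vec_norm n (mat_op \<pi> n a \<xi>) \<le> (\<Sum>i<n. \<Sum>j<n. norm (a i j)) * 1"
    using mat_op_norm_le_sum[of n a \<xi>] by linarith
qed

lemma matrix_norm_nonneg: "0 \<le> matrix_norm \<pi> n a"
  unfolding matrix_norm_alt
  by (rule cSup_upper2[OF _ _ matrix_norm_bdd, of "vec_norm n (mat_op \<pi> n a (\<lambda>_. 0))"])
    (auto intro!: exI[of _ "\<lambda>_. 0"] sum_nonneg simp: vec_norm_def)

lemma matrix_norm_bound: "vec_norm n (mat_op \<pi> n a \<xi>) \<le> matrix_norm \<pi> n a * vec_norm n \<xi>"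
proof (cases "vec_norm n \<xi> = 0")
  case True
  then show ?thesis using mat_op_norm_le_sum[of n a \<xi>] by simp
next
  case False
  then have pos: "vec_norm n \<xi> > 0" using vec_norm_nonneg[of n \<xi>] by linarith
  define \<zeta> where "\<zeta> = (\<lambda>i. (1 / vec_norm n \<xi>) *\<^sub>R \<xi> i)"
  have "vec_norm n \<zeta> \<le> 1" unfolding \<zeta>_def vec_norm_scaleR using pos by simp
  then have "vec_norm n (mat_op \<pi> n a \<zeta>) \<le> matrix_norm \<pi> n a"
    unfolding matrix_norm_alt by (intro cSup_upper matrix_norm_bdd) blast
  then show ?thesis using pos unfolding \<zeta>_def mat_op_scaleR vec_norm_scaleR by (simp add: field_simps)
qed

lemma matrix_norm_le:
  assumes "0 \<le> M" "\<And>\<xi>. vec_norm n (mat_op \<pi> n a \<xi>) \<le> M * vec_norm n \<xi>"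
  shows "matrix_norm \<pi> n a \<le> M"
  unfolding matrix_norm_alt
proof (rule cSup_least)
  show "{vec_norm n (mat_op \<pi> n a \<xi>) | \<xi>. vec_norm n \<xi> \<le> 1} \<noteq> {}"
    by (auto intro!: exI[of _ "\<lambda>_. 0"] simp: vec_norm_def)
  fix u assume "u \<in> {vec_norm n (mat_op \<pi> n a \<xi>) | \<xi>. vec_norm n \<xi> \<le> 1}"
  then obtain \<xi> where "u = vec_norm n (mat_op \<pi> n a \<xi>)" "vec_norm n \<xi> \<le> 1" by blast
  then show "u \<le> M" using assms(2)[of \<xi>] mult_left_mono[OF _ assms(1), of "vec_norm n \<xi>" 1] by simp
qed

lemma matrix_norm_triangle:
  "matrix_norm \<pi> n (\<lambda>i j. a i j + b i j) \<le> matrix_norm \<pi> n a + matrix_norm \<pi> n b"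
proof (rule matrix_norm_le)
  fix \<xi>
  have "mat_op \<pi> n (\<lambda>i j. a i j + b i j) \<xi> = (\<lambda>i. mat_op \<pi> n a \<xi> i + mat_op \<pi> n b \<xi> i)"
    by (intro ext) (simp add: mat_op_def rep sum.distrib)
  then show "vec_norm n (mat_op \<pi> n (\<lambda>i j. a i j + b i j) \<xi>) \<le>
      (matrix_norm \<pi> n a + matrix_norm \<pi> n b) * vec_norm n \<xi>"
    using vec_norm_triangle[of n "mat_op \<pi> n a \<xi>" "mat_op \<pi> n b \<xi>"]
      matrix_norm_bound[of n a \<xi>] matrix_norm_bound[of n b \<xi>] by (simp add: distrib_right)
qed (simp add: matrix_norm_nonneg)

lemma matrix_norm_scaleR: "matrix_norm \<pi> n (\<lambda>i j. r *\<^sub>R a i j) \<le> \<bar>r\<bar> * matrix_norm \<pi> n a"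
proof (rule matrix_norm_le)
  fix \<xi>
  have "mat_op \<pi> n (\<lambda>i j. r *\<^sub>R a i j) \<xi> = (\<lambda>i. r *\<^sub>R mat_op \<pi> n a \<xi> i)"
    by (intro ext) (simp add: mat_op_def rep scaleR_sum_right)
  then show "vec_norm n (mat_op \<pi> n (\<lambda>i j. r *\<^sub>R a i j) \<xi>) \<le> \<bar>r\<bar> * matrix_norm \<pi> n a * vec_norm n \<xi>"
    using matrix_norm_bound[of n a \<xi>] by (simp add: vec_norm_scaleR mult.assoc mult_left_mono)
qed (simp add: matrix_norm_nonneg)

lemma matrix_norm_mult: "matrix_norm \<pi> n (mat_mult n a b) \<le> matrix_norm \<pi> n a * matrix_norm \<pi> n b"
proof (rule matrix_norm_le)
  fix \<xi>
  have "matrix_norm \<pi> n a * vec_norm n (mat_op \<pi> n b \<xi>) \<le> matrix_norm \<pi> n a * (matrix_norm \<pi> n b * vec_norm n \<xi>)"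
    by (intro mult_left_mono matrix_norm_bound matrix_norm_nonneg)
  then show "vec_norm n (mat_op \<pi> n (mat_mult n a b) \<xi>) \<le> matrix_norm \<pi> n a * matrix_norm \<pi> n b * vec_norm n \<xi>"
    using matrix_norm_bound[of n a "mat_op \<pi> n b \<xi>"] by (simp add: mat_op_mult mult.assoc)
qed (simp add: matrix_norm_nonneg)

text \<open>Tested on vectors supported at the single index \<open>j\<close>. It turns summability
  of matrix norms into convergence of each entry.\<close>

lemma norm_entry_le_matrix_norm:
  assumes "i < n" "j < n"
  shows "norm (a i j) \<le> matrix_norm \<pi> n a"
proof (rule gns_norm_le_imp[OF \<phi> gns matrix_norm_nonneg])
  fix \<xi> :: 'h
  let ?\<delta> = "\<lambda>k. if k = j then \<xi> else 0"
  have "vec_norm n ?\<delta> = norm \<xi>"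
    using assms by (simp add: vec_norm_def if_distrib[of "\<lambda>u. (norm u)\<^sup>2"] sum.delta cong: if_cong)
  moreover have "mat_op \<pi> n a ?\<delta> i = \<pi> (a i j) \<xi>"
    using assms by (simp add: mat_op_def if_distrib[of "\<pi> _"] rep sum.delta cong: if_cong)
  ultimately show "norm (\<pi> (a i j) \<xi>) \<le> matrix_norm \<pi> n a * norm \<xi>"
    using vec_norm_component_le[OF assms(1), of "mat_op \<pi> n a ?\<delta>"] matrix_norm_bound[of n a ?\<delta>] by simp
qed

lemma matrix_norm_cong:
  assumes "\<And>i j. i < n \<Longrightarrow> j < n \<Longrightarrow> a i j = b i j"
  shows "matrix_norm \<pi> n a = matrix_norm \<pi> n b"
proof -
  have "(\<Sum>i<n. (norm (\<Sum>j<n. \<pi> (a i j) (\<xi> j)))\<^sup>2) = (\<Sum>i<n. (norm (\<Sum>j<n. \<pi> (b i j) (\<xi> j)))\<^sup>2)" for \<xi>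
    using assms by (intro sum.cong refl arg_cong[where f = "\<lambda>u. (norm u)\<^sup>2"]) auto
  then show ?thesis unfolding matrix_norm_def by simp
qed

lemma vec_norm_mat_op_sq:
  "(vec_norm n (mat_op \<pi> n b \<xi>))\<^sup>2 =
    Re (\<Sum>i<n. cinner (mat_op \<pi> n (mat_mult n (\<lambda>i j. star (b j i)) b) \<xi> i) (\<xi> i))"
proof -
  have "(\<Sum>i<n. cinner (mat_op \<pi> n (mat_mult n (\<lambda>i j. star (b j i)) b) \<xi> i) (\<xi> i)) =
      (\<Sum>i<n. \<Sum>k<n. cinner (mat_op \<pi> n b \<xi> k) (\<pi> (b k i) (\<xi> i)))"
    unfolding mat_op_mult by (subst mat_op_def) (simp add: cinner_sum_left rep)
  also have "\<dots> = (\<Sum>k<n. cinner (mat_op \<pi> n b \<xi> k) (mat_op \<pi> n b \<xi> k))"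
    by (subst sum.swap) (simp add: cinner_sum_right mat_op_def[of \<pi> n b \<xi>])
  finally show ?thesis by (simp add: vec_norm_sq norm_eq_Re_cinner)
qed

section \<open>Square roots of matrices and complete contractivity of *-homomorphisms\<close>

text \<open>Matrices do not form a type of class \<open>cstar_algebra\<close> here, so the iteration
  of \<open>cstar_sqrt\<close> is run again with \<open>matrix_norm\<close> in place of the norm.
  The scalar comparison is reused, while limits, membership in \<open>C\<close> and adjoints are
  handled entry by entry.\<close>

lemma matrix_sqrt:
  fixes v :: "nat \<Rightarrow> nat \<Rightarrow> 'a"
  assumes C: "star_subalgebra C" "closed C"
    and v: "\<And>i j. i < n \<Longrightarrow> j < n \<Longrightarrow> v i j \<in> C" "\<And>i j. star (v i j) = v j i" "matrix_norm \<pi> n v \<le> 1"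
  obtains s where "\<And>i j. i < n \<Longrightarrow> j < n \<Longrightarrow> s i j \<in> C" "\<And>i j. i < n \<Longrightarrow> j < n \<Longrightarrow> star (s i j) = s j i"
    "\<And>i j. i < n \<Longrightarrow> j < n \<Longrightarrow> mat_mult n s s i j = (if i = j then 1 else 0) - v i j"
proof -
  note ops = star_subalgebra_closed_ops[OF C(1)]
  let ?N = "matrix_norm \<pi> n"
  define Y where "Y = rec_nat (\<lambda>i j. 0) (\<lambda>_ u i j. (1/2) *\<^sub>R (v i j + mat_mult n u u i j))"
  have Y0: "Y 0 = (\<lambda>i j. 0)"
    and YS: "\<And>k. Y (Suc k) = (\<lambda>i j. (1/2) *\<^sub>R (v i j + mat_mult n (Y k) (Y k) i j))"
    by (simp_all add: Y_def)
  define D where "D k = (\<lambda>i j. Y (Suc k) i j - Y k i j)" for k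
  have DS: "D (Suc k) = (\<lambda>i j. (1/2) *\<^sub>R (mat_mult n (Y (Suc k)) (D k) i j + mat_mult n (D k) (Y k) i j))" for k
  proof (intro ext)
    fix i j
    have "D (Suc k) i j = (1/2) *\<^sub>R (mat_mult n (Y (Suc k)) (Y (Suc k)) i j - mat_mult n (Y k) (Y k) i j)"
      by (simp only: D_def YS[of "Suc k"] YS[of k]) (simp add: scaleR_diff_right scaleR_add_right)
    also have "mat_mult n (Y (Suc k)) (Y (Suc k)) i j - mat_mult n (Y k) (Y k) i j =
        mat_mult n (Y (Suc k)) (D k) i j + mat_mult n (D k) (Y k) i j"
      by (simp add: mat_mult_def D_def right_diff_distrib left_diff_distrib flip: sum_subtractf sum.distrib)
    finally show "D (Suc k) i j = (1/2) *\<^sub>R (mat_mult n (Y (Suc k)) (D k) i j + mat_mult n (D k) (Y k) i j)" .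
  qed
  have N0: "?N (Y 0) = 0"
    using matrix_norm_scaleR[of n 0 v] matrix_norm_nonneg[of n "\<lambda>i j. 0"] by (simp add: Y0)
  have N1: "?N (Y (Suc k)) \<le> (1 + (?N (Y k))\<^sup>2) / 2" for k
  proof -
    have "?N (Y (Suc k)) \<le> \<bar>1/2\<bar> * ?N (\<lambda>i j. v i j + mat_mult n (Y k) (Y k) i j)"
      unfolding YS by (rule matrix_norm_scaleR)
    moreover have "?N (\<lambda>i j. v i j + mat_mult n (Y k) (Y k) i j) \<le> 1 + (?N (Y k))\<^sup>2"
      using matrix_norm_triangle[of n v "mat_mult n (Y k) (Y k)"] matrix_norm_mult[of n "Y k" "Y k"] v(3)
      by (simp add: power2_eq_square)
    ultimately show ?thesis by simp
  qed
  have N2: "?N (D 0) \<le> 1/2"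
  proof -
    have "D 0 = (\<lambda>i j. (1/2) *\<^sub>R v i j)" by (simp add: D_def YS Y0 mat_mult_def)
    then show ?thesis using matrix_norm_scaleR[of n "1/2" v] v(3) by simp
  qed
  have N3: "?N (D (Suc k)) \<le> (?N (Y (Suc k)) + ?N (Y k)) * ?N (D k) / 2" for k
  proof -
    have "?N (D (Suc k)) \<le> \<bar>1/2\<bar> * ?N (\<lambda>i j. mat_mult n (Y (Suc k)) (D k) i j + mat_mult n (D k) (Y k) i j)"
      unfolding DS by (rule matrix_norm_scaleR)
    moreover have "?N (\<lambda>i j. mat_mult n (Y (Suc k)) (D k) i j + mat_mult n (D k) (Y k) i j) \<le>
        ?N (Y (Suc k)) * ?N (D k) + ?N (D k) * ?N (Y k)"
      by (rule order_trans[OF matrix_norm_triangle]) (intro add_mono matrix_norm_mult)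
    ultimately show ?thesis by (simp add: algebra_simps)
  qed
  have sumN: "summable (\<lambda>k. ?N (D k))"
    using N0 N1 N2 N3 matrix_norm_nonneg by (intro sqrt_iteration_bounds(2)[of "\<lambda>k. ?N (Y k)"]) auto
  have conv: "convergent (\<lambda>k. Y k i j)" if "i < n" "j < n" for i j
  proof (rule summable_differences_convergent, rule summable_comparison_test'[OF sumN])
    show "norm (norm (Y (Suc k) i j - Y k i j)) \<le> ?N (D k)" for k
      using norm_entry_le_matrix_norm[OF that, of "D k"] by (simp add: D_def)
  qed
  define y where "y i j = lim (\<lambda>k. Y k i j)" for i j
  have y: "(\<lambda>k. Y k i j) \<longlonglongrightarrow> y i j" if "i < n" "j < n" for i j
    using conv[OF that] by (simp add: y_def convergent_LIMSEQ_iff)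
  have YC: "Y k i j \<in> C" if "i < n" "j < n" for k i j
    using that
  proof (induction k arbitrary: i j)
    case (Suc k)
    have "(\<Sum>l<n. Y k i l * Y k l j) \<in> C" using Suc by (intro ops(9) ops(5)) auto
    then show ?case unfolding YS mat_mult_def using Suc.prems by (intro ops(7) ops(3) v)
  qed (simp add: Y0 ops)
  have yC: "y i j \<in> C" if "i < n" "j < n" for i j
    by (rule closed_sequentially[OF C(2) _ y[OF that]]) (intro YC that)
  have Ystar: "star (Y k i j) = Y k j i" for k i j
    by (induction k arbitrary: i j) (simp_all add: Y0 YS mat_mult_def star_scaleR star_add star_sum star_mult v)
  have ystar: "star (y i j) = y j i" if "i < n" "j < n" for i j
    using LIMSEQ_unique[OF tendsto_star[OF y[OF that]]] y[OF that(2,1)] by (simp add: Ystar)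
  have yeq: "y i j = (1/2) *\<^sub>R (v i j + mat_mult n y y i j)" if "i < n" "j < n" for i j
  proof -
    have "(\<lambda>k. Y (Suc k) i j) \<longlonglongrightarrow> (1/2) *\<^sub>R (v i j + mat_mult n y y i j)"
      unfolding YS mat_mult_def using that by (intro tendsto_intros y) auto
    with LIMSEQ_Suc[OF y[OF that]] show ?thesis by (rule LIMSEQ_unique)
  qed
  define s where "s i j = (if i = j then 1 else 0) - y i j" for i j
  show thesis
  proof (rule that[of s])
    fix i j assume ij: "i < n" "j < n"
    show "s i j \<in> C" unfolding s_def using ij by (intro ops(4) yC) (auto simp: ops)
    show "star (s i j) = s j i" using ystar[OF ij] by (simp add: s_def star_diff)
    have "2 *\<^sub>R y i j = v i j + mat_mult n y y i j" by (subst yeq[OF ij]) simp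
    then have yy: "mat_mult n y y i j = y i j + y i j - v i j" by (simp add: scaleR_2)
    \<comment> \<open>The product of two factors of the form identity minus \<open>y\<close>, with
      its Kronecker terms arranged as conditions on \<open>k\<close> so that the sum over
      \<open>k\<close> collapses.\<close>
    have "s i k * s k j = (if k = i then (if i = j then 1 else 0) - y i j else 0)
        - (if k = j then y i j else 0) + y i k * y k j" for k
      by (auto simp: s_def algebra_simps)
    then have "mat_mult n s s i j = ((if i = j then 1 else 0) - y i j) - y i j + mat_mult n y y i j"
      using ij by (simp add: mat_mult_def sum.distrib sum_subtractf)
    then show "mat_mult n s s i j = (if i = j then 1 else 0) - v i j" by (simp add: yy)
  qed
qed

text \<open>A *-homomorphism maps the square root of \<open>1 - a\<^sup>*a\<close> to a square root of \<open>1 - \<alpha>(a)\<^sup>*\<alpha>(a)\<close>,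
  which is therefore positive.\<close>

lemma matrix_norm_star_hom_le_1:
  assumes C: "star_subalgebra C" "closed C" and \<alpha>: "isometric_star_hom_on C \<alpha>"
    and a: "\<And>i j. i < n \<Longrightarrow> j < n \<Longrightarrow> a i j \<in> C" "matrix_norm \<pi> n a \<le> 1"
  shows "matrix_norm \<pi> n (\<lambda>i j. \<alpha> (a i j)) \<le> 1"
proof (rule matrix_norm_le)
  note ops = star_subalgebra_closed_ops[OF C(1)]
  have hom: "\<And>x y. x \<in> C \<Longrightarrow> y \<in> C \<Longrightarrow> \<alpha> (x + y) = \<alpha> x + \<alpha> y" "\<And>c x. x \<in> C \<Longrightarrow> \<alpha> (c *\<^sub>C x) = c *\<^sub>C \<alpha> x"
    "\<alpha> 1 = 1" "\<And>x y. x \<in> C \<Longrightarrow> y \<in> C \<Longrightarrow> \<alpha> (x * y) = \<alpha> x * \<alpha> y" "\<And>x. x \<in> C \<Longrightarrow> \<alpha> (star x) = star (\<alpha> x)"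
    using \<alpha> by (auto simp: isometric_star_hom_on_def clinear_on_def)
  have \<alpha>0: "\<alpha> 0 = 0" using hom(2)[of 0 0] ops by simp
  have \<alpha>diff: "\<alpha> (x - y) = \<alpha> x - \<alpha> y" if "x \<in> C" "y \<in> C" for x y
    using hom(1)[OF ops(4)[OF that] that(2)] by simp
  have \<alpha>sum: "\<alpha> (\<Sum>i\<in>I. f i) = (\<Sum>i\<in>I. \<alpha> (f i))" if "\<And>i. i \<in> I \<Longrightarrow> f i \<in> C" for I :: "nat set" and f
    using that by (induction I rule: infinite_finite_induct) (auto simp: \<alpha>0 hom ops(9))
  have \<alpha>mult: "\<alpha> (mat_mult n p q i j) = mat_mult n (\<lambda>i j. \<alpha> (p i j)) (\<lambda>i j. \<alpha> (q i j)) i j"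
    if "\<And>i j. i < n \<Longrightarrow> j < n \<Longrightarrow> p i j \<in> C" "\<And>i j. i < n \<Longrightarrow> j < n \<Longrightarrow> q i j \<in> C" "i < n" "j < n" for p q i j
    unfolding mat_mult_def using that by (subst \<alpha>sum) (auto intro!: ops(5) sum.cong hom(4))
  define v where "v = mat_mult n (\<lambda>i j. star (a j i)) a"
  have "matrix_norm \<pi> n v \<le> 1"
  proof (rule matrix_norm_le)
    fix \<xi>
    \<comment> \<open>The adjoint of a contraction is a contraction, by Cauchy-Schwarz in the direct
      sum; composing it with \<open>a\<close> bounds \<open>v\<close>.\<close>
    have pos: "(vec_norm n (mat_op \<pi> n (\<lambda>i j. star (a j i)) \<zeta>)) \<le> vec_norm n \<zeta>" for \<zeta>
    proof -
      let ?b = "\<lambda>i j. star (a j i)"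
      let ?w = "mat_op \<pi> n ?b \<zeta>"
      have "(vec_norm n ?w)\<^sup>2 = Re (\<Sum>i<n. cinner (mat_op \<pi> n a ?w i) (\<zeta> i))"
        by (simp add: vec_norm_mat_op_sq star_star mat_op_mult)
      also have "\<dots> \<le> (\<Sum>i<n. norm (mat_op \<pi> n a ?w i) * norm (\<zeta> i))"
        by (auto intro!: sum_mono Re_cinner_le)
      also have "\<dots> \<le> vec_norm n (mat_op \<pi> n a ?w) * vec_norm n \<zeta>"
        using L2_set_mult_ineq[of "\<lambda>i. norm (mat_op \<pi> n a ?w i)" "\<lambda>i. norm (\<zeta> i)" "{..<n}"]
        by (simp add: L2_set_def vec_norm_def)
      also have "\<dots> \<le> vec_norm n ?w * vec_norm n \<zeta>"
        using matrix_norm_bound[of n a ?w] mult_right_mono[OF a(2), of "vec_norm n ?w"]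
        by (intro mult_right_mono) auto
      finally show ?thesis
        using vec_norm_nonneg[of n ?w] vec_norm_nonneg[of n \<zeta>]
        by (cases "vec_norm n ?w = 0") (auto simp: power2_eq_square)
    qed
    have "vec_norm n (mat_op \<pi> n v \<xi>) \<le> vec_norm n (mat_op \<pi> n a \<xi>)"
      unfolding v_def mat_op_mult by (rule pos)
    also have "\<dots> \<le> 1 * vec_norm n \<xi>"
      using matrix_norm_bound[of n a \<xi>] mult_right_mono[OF a(2), of "vec_norm n \<xi>"] by simp
    finally show "vec_norm n (mat_op \<pi> n v \<xi>) \<le> 1 * vec_norm n \<xi>" .
  qed simp
  moreover have vC: "v i j \<in> C" if "i < n" "j < n" for i j
    unfolding v_def mat_mult_def using that by (intro ops(9) ops(5) ops(8) a) auto
  moreover have "star (v i j) = v j i" for i j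
    by (simp add: v_def mat_mult_def star_sum star_mult star_star)
  ultimately obtain s where s: "\<And>i j. i < n \<Longrightarrow> j < n \<Longrightarrow> s i j \<in> C" "\<And>i j. i < n \<Longrightarrow> j < n \<Longrightarrow> star (s i j) = s j i"
    "\<And>i j. i < n \<Longrightarrow> j < n \<Longrightarrow> mat_mult n s s i j = (if i = j then 1 else 0) - v i j"
    using matrix_sqrt[OF C, of n v] by blast
  let ?a = "\<lambda>i j. \<alpha> (a i j)" and ?s = "\<lambda>i j. \<alpha> (s i j)"
  let ?v = "mat_mult n (\<lambda>i j. star (?a j i)) ?a"
  have key: "mat_mult n (\<lambda>i j. star (?s j i)) ?s i j = (if i = j then 1 else 0) - ?v i j" if ij: "i < n" "j < n" for i j
  proof -
    have "mat_mult n (\<lambda>i j. star (?s j i)) ?s i j = mat_mult n ?s ?s i j"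
      unfolding mat_mult_def using ij s by (intro sum.cong refl arg_cong2[where f = "(*)"]) (auto simp flip: hom(5))
    also have "\<dots> = \<alpha> (mat_mult n s s i j)" using ij s(1) by (simp add: \<alpha>mult)
    also have "\<dots> = (if i = j then 1 else 0) - \<alpha> (v i j)" using ij by (simp add: s(3) \<alpha>diff ops vC hom \<alpha>0)
    also have "\<alpha> (v i j) = mat_mult n (\<lambda>i j. \<alpha> (star (a j i))) ?a i j"
      unfolding v_def using ij a(1) by (intro \<alpha>mult) (auto intro: ops(8))
    also have "\<dots> = ?v i j"
      unfolding mat_mult_def using ij a(1) by (intro sum.cong refl) (auto simp: hom)
    finally show ?thesis .
  qed
  fix \<xi>
  have "mat_op \<pi> n (mat_mult n (\<lambda>i j. star (?s j i)) ?s) \<xi> i = \<xi> i - mat_op \<pi> n ?v \<xi> i" if "i < n" for i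
  proof -
    have "mat_op \<pi> n (mat_mult n (\<lambda>i j. star (?s j i)) ?s) \<xi> i =
        (\<Sum>j<n. (if j = i then \<xi> i else 0) - \<pi> (?v i j) (\<xi> j))"
      unfolding mat_op_def using that by (intro sum.cong refl) (auto simp: key rep)
    then show ?thesis using that by (simp add: sum_subtractf mat_op_def)
  qed
  then have "(\<Sum>i<n. cinner (mat_op \<pi> n (mat_mult n (\<lambda>i j. star (?s j i)) ?s) \<xi> i) (\<xi> i)) =
      (\<Sum>i<n. cinner (\<xi> i) (\<xi> i)) - (\<Sum>i<n. cinner (mat_op \<pi> n ?v \<xi> i) (\<xi> i))"
    by (simp add: cinner_diff_left sum_subtractf)
  \<comment> \<open>Pairing the images of \<xi> under both sides of \<open>key\<close> with \<xi>:
    the squared norms under \<open>?s\<close> and \<open>?a\<close> add up to that of \<xi>.\<close>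
  then have "(vec_norm n (mat_op \<pi> n ?s \<xi>))\<^sup>2 = (vec_norm n \<xi>)\<^sup>2 - (vec_norm n (mat_op \<pi> n ?a \<xi>))\<^sup>2"
    by (simp add: vec_norm_mat_op_sq) (simp add: vec_norm_sq norm_eq_Re_cinner)
  then have "(vec_norm n (mat_op \<pi> n ?a \<xi>))\<^sup>2 \<le> (vec_norm n \<xi>)\<^sup>2"
    using zero_le_power2[of "vec_norm n (mat_op \<pi> n ?s \<xi>)"] by linarith
  then show "vec_norm n (mat_op \<pi> n ?a \<xi>) \<le> 1 * vec_norm n \<xi>" using power2_le_imp_le by fastforce
qed simp

text \<open>Homogeneity reduces this to norm at most 1; dividing by the norm plus a positive
  \<open>e\<close> also covers norm zero.\<close>

theorem matrix_norm_star_hom_le: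
  assumes C: "star_subalgebra C" "closed C" and \<alpha>: "isometric_star_hom_on C \<alpha>"
    and a: "\<And>i j. i < n \<Longrightarrow> j < n \<Longrightarrow> a i j \<in> C"
  shows "matrix_norm \<pi> n (\<lambda>i j. \<alpha> (a i j)) \<le> matrix_norm \<pi> n a"
proof (rule field_le_epsilon)
  fix e :: real assume "0 < e"
  define M where "M = matrix_norm \<pi> n a + e"
  have M: "M > 0" using \<open>0 < e\<close> matrix_norm_nonneg[of n a] by (simp add: M_def)
  have scale: "\<alpha> (r *\<^sub>R x) = r *\<^sub>R \<alpha> x" if "x \<in> C" for r x
    using \<alpha> that by (simp add: isometric_star_hom_on_def clinear_on_def scaleR_scaleC)
  have "matrix_norm \<pi> n (\<lambda>i j. (1/M) *\<^sub>R a i j) \<le> 1"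
  proof -
    have "\<bar>1/M\<bar> * matrix_norm \<pi> n a \<le> 1" using M \<open>0 < e\<close> by (simp add: M_def divide_le_eq)
    then show ?thesis using matrix_norm_scaleR[of n "1/M" a] by linarith
  qed
  then have "matrix_norm \<pi> n (\<lambda>i j. \<alpha> ((1/M) *\<^sub>R a i j)) \<le> 1"
    by (intro matrix_norm_star_hom_le_1[OF C \<alpha>] star_subalgebra_closed_ops(7)[OF C(1)] a)
  also have "matrix_norm \<pi> n (\<lambda>i j. \<alpha> ((1/M) *\<^sub>R a i j)) = matrix_norm \<pi> n (\<lambda>i j. (1/M) *\<^sub>R \<alpha> (a i j))"
    by (intro matrix_norm_cong scale a)
  finally have le: "matrix_norm \<pi> n (\<lambda>i j. (1/M) *\<^sub>R \<alpha> (a i j)) \<le> 1" .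
  have "(\<lambda>i j. \<alpha> (a i j)) = (\<lambda>i j. M *\<^sub>R ((1/M) *\<^sub>R \<alpha> (a i j)))" using M by simp
  then have "matrix_norm \<pi> n (\<lambda>i j. \<alpha> (a i j)) \<le> \<bar>M\<bar> * matrix_norm \<pi> n (\<lambda>i j. (1/M) *\<^sub>R \<alpha> (a i j))"
    by (metis (no_types) matrix_norm_scaleR)
  also have "\<dots> \<le> M * 1" using M le by (simp add: mult_left_le)
  finally show "matrix_norm \<pi> n (\<lambda>i j. \<alpha> (a i j)) \<le> matrix_norm \<pi> n a + e" by (simp add: M_def)
qed

end

subsection \<open>Diagonal semigroups on orthogonal sums\<close>

text \<open>A common Lipschitz constant lets pointwise convergence spread from \<open>S\<close> to
  the points of its closure. It is applied to the partial sums of the series on the Hilbert space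
  and to the averaged rotations on the operator algebra.\<close>

lemma convergent_closure_lipschitz:
  fixes f :: "nat \<Rightarrow> 'a::metric_space \<Rightarrow> 'b::complete_space"
  assumes lip: "\<And>n x y. x \<in> D \<Longrightarrow> y \<in> D \<Longrightarrow> dist (f n x) (f n y) \<le> L * dist x y"
    and S: "S \<subseteq> D" "\<And>x. x \<in> S \<Longrightarrow> convergent (\<lambda>n. f n x)" and x: "x \<in> D" "x \<in> closure S"
  shows "convergent (\<lambda>n. f n x)"
proof (rule Cauchy_convergent, rule metric_CauchyI)
  fix e :: real assume e: "0 < e"
  \<comment> \<open>\<open>L\<close> may be zero or negative, hence the denominator with
    \<open>\<bar>L\<bar> + 1\<close>. Three errors of size \<open>e / 4\<close> stay below
    \<open>e\<close>.\<close>
  define \<delta> where "\<delta> = e / (4 * (\<bar>L\<bar> + 1))"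
  have \<delta>: "\<delta> > 0" "\<bar>L\<bar> * \<delta> \<le> e / 4"
    using e by (auto simp: \<delta>_def field_simps add_pos_nonneg intro!: divide_pos_pos)
  obtain y where y: "y \<in> S" "dist y x < \<delta>" using x(2) \<delta>(1) by (auto simp: closure_approachable)
  have "Cauchy (\<lambda>n. f n y)" using S(2)[OF y(1)] by (rule convergent_Cauchy)
  then obtain N where N: "\<And>m n. m \<ge> N \<Longrightarrow> n \<ge> N \<Longrightarrow> dist (f m y) (f n y) < e / 4"
    using e unfolding Cauchy_def by (meson zero_less_divide_iff zero_less_numeral)
  have close: "dist (f n x) (f n y) \<le> e / 4" for n
  proof -
    have "dist (f n x) (f n y) \<le> L * dist x y" using x y S by (intro lip) auto
    also have "\<dots> \<le> \<bar>L\<bar> * \<delta>" using y(2) by (intro mult_mono) (auto simp: dist_commute)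
    finally show ?thesis using \<delta> by simp
  qed
  show "\<exists>N. \<forall>m\<ge>N. \<forall>n\<ge>N. dist (f m x) (f n x) < e"
  proof (intro exI[of _ N] allI impI)
    fix m n assume "m \<ge> N" "n \<ge> N"
    have "dist (f m x) (f n x) \<le> dist (f m x) (f m y) + dist (f m y) (f n x)" by (rule dist_triangle)
    also have "dist (f m y) (f n x) \<le> dist (f m y) (f n y) + dist (f n y) (f n x)" by (rule dist_triangle)
    finally show "dist (f m x) (f n x) < e"
      using close[of m] close[of n] N[OF \<open>m \<ge> N\<close> \<open>n \<ge> N\<close>] e by (simp add: dist_commute)
  qed
qed

text \<open>The real inner product yields the bound for real parts; the phase \<open>c\<close> makes
  the inner product real and nonnegative.\<close>

lemma norm_cinner_le: "cmod (cinner x y) \<le> norm x * norm (y::'h::chilbert_space)"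
proof -
  define c where "c = cnj (sgn (cinner x y))"
  have "cnj (cinner x y) * cinner x y = of_real (cmod (cinner x y)) * of_real (cmod (cinner x y))"
    by (metis complex_norm_square mult.commute of_real_mult power2_eq_square)
  then have "c * cinner x y = of_real (cmod (cinner x y))"
    by (cases "cinner x y = 0") (auto simp: c_def sgn_eq)
  then have "cmod (cinner x y) = Re (cinner (c *\<^sub>C x) y)" by (simp add: cinner_scaleC_left)
  also have "\<dots> \<le> norm (c *\<^sub>C x) * norm y" by (rule Re_cinner_le)
  also have "\<dots> \<le> norm x * norm y"
    by (intro mult_right_mono) (auto simp: norm_scaleC c_def norm_sgn)
  finally show ?thesis .
qed

lemma bounded_linear_cinner_left: "bounded_linear (\<lambda>x. cinner x (y::'h::chilbert_space))"
proof (rule bounded_linear_intro[where K = "norm y"])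
  show "cinner (r *\<^sub>R x) y = r *\<^sub>R cinner x y" for r x
    by (simp only: cinner_scaleR_left scaleR_conv_of_real[of r "cinner x y"])
qed (simp_all add: cinner_add_left norm_cinner_le)

lemma ortho_proj_eq:
  assumes "csubspace M" "\<eta> \<in> M" "\<And>\<zeta>. \<zeta> \<in> M \<Longrightarrow> cinner (\<xi> - \<eta>) \<zeta> = 0"
  shows "ortho_proj M \<xi> = \<eta>"
  unfolding ortho_proj_def
proof (rule the_equality)
  show "\<eta> \<in> M \<and> (\<forall>\<zeta>\<in>M. cinner (\<xi> - \<eta>) \<zeta> = 0)" using assms by blast
  fix \<eta>' assume *: "\<eta>' \<in> M \<and> (\<forall>\<zeta>\<in>M. cinner (\<xi> - \<eta>') \<zeta> = 0)"
  then have "\<eta> - \<eta>' \<in> M" using assms by (simp add: complex_vector.subspace_diff)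
  then have "cinner (\<xi> - \<eta>') (\<eta> - \<eta>') - cinner (\<xi> - \<eta>) (\<eta> - \<eta>') = 0" using assms * by simp
  then have "cinner (\<eta> - \<eta>') (\<eta> - \<eta>') = 0" by (simp flip: cinner_diff_left)
  then show "\<eta>' = \<eta>" using norm_eq_Re_cinner[of "\<eta> - \<eta>'"] by simp
qed

locale orthogonal_sum =
  fixes M :: "nat \<Rightarrow> 'h::chilbert_space set"
  assumes sub: "\<And>d. csubspace (M d)" and complete: "\<And>d. complete (M d)"
    and orth: "\<And>d e \<xi> \<zeta>. d \<noteq> e \<Longrightarrow> \<xi> \<in> M d \<Longrightarrow> \<zeta> \<in> M e \<Longrightarrow> cinner \<xi> \<zeta> = 0"
begin

abbreviation P :: "nat \<Rightarrow> 'h \<Rightarrow> 'h" where "P d \<equiv> ortho_proj (M d)"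

text \<open>The vectors at which the projection onto \<open>M d\<close> exists. They form a closed
  subspace, which contains every \<open>M e\<close> by orthogonality and therefore all of
  \<open>K\<close>; this settles existence without a minimisation argument.\<close>

definition projectable :: "nat \<Rightarrow> 'h set"
  where "projectable d = {\<xi>. \<exists>\<eta>\<in>M d. \<forall>\<zeta>\<in>M d. cinner (\<xi> - \<eta>) \<zeta> = 0}"

lemma P_props:
  assumes "\<xi> \<in> projectable d"
  shows "P d \<xi> \<in> M d" "\<zeta> \<in> M d \<Longrightarrow> cinner (\<xi> - P d \<xi>) \<zeta> = 0"
proof -
  obtain \<eta> where \<eta>: "\<eta> \<in> M d" "\<forall>\<zeta>\<in>M d. cinner (\<xi> - \<eta>) \<zeta> = 0" using assms by (auto simp: projectable_def)
  then have "P d \<xi> = \<eta>" by (intro ortho_proj_eq sub) auto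
  with \<eta> show "P d \<xi> \<in> M d" "\<zeta> \<in> M d \<Longrightarrow> cinner (\<xi> - P d \<xi>) \<zeta> = 0" by auto
qed

lemma P_eqI: "\<eta> \<in> M d \<Longrightarrow> (\<And>\<zeta>. \<zeta> \<in> M d \<Longrightarrow> cinner (\<xi> - \<eta>) \<zeta> = 0) \<Longrightarrow> \<xi> \<in> projectable d \<and> P d \<xi> = \<eta>"
  using ortho_proj_eq[OF sub] by (auto simp: projectable_def)

lemma P_add:
  assumes "\<xi> \<in> projectable d" "\<zeta> \<in> projectable d"
  shows "\<xi> + \<zeta> \<in> projectable d \<and> P d (\<xi> + \<zeta>) = P d \<xi> + P d \<zeta>"
proof (rule P_eqI)
  show "P d \<xi> + P d \<zeta> \<in> M d" using P_props[OF assms(1)] P_props[OF assms(2)] sub by (simp add: complex_vector.subspace_add)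
  fix \<eta> assume "\<eta> \<in> M d"
  then have "cinner (\<xi> - P d \<xi>) \<eta> + cinner (\<zeta> - P d \<zeta>) \<eta> = 0" using assms P_props by simp
  then show "cinner (\<xi> + \<zeta> - (P d \<xi> + P d \<zeta>)) \<eta> = 0" by (simp add: algebra_simps flip: cinner_add_left)
qed

lemma P_scaleC:
  assumes "\<xi> \<in> projectable d"
  shows "c *\<^sub>C \<xi> \<in> projectable d \<and> P d (c *\<^sub>C \<xi>) = c *\<^sub>C P d \<xi>"
proof (rule P_eqI)
  show "c *\<^sub>C P d \<xi> \<in> M d" using P_props[OF assms(1)] sub by (simp add: complex_vector.subspace_scale)
  fix \<eta> assume "\<eta> \<in> M d"
  then have "c * cinner (\<xi> - P d \<xi>) \<eta> = 0" using assms P_props by simp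
  then show "cinner (c *\<^sub>C \<xi> - c *\<^sub>C P d \<xi>) \<eta> = 0"
    by (simp add: cinner_diff_left cinner_scaleC_left right_diff_distrib)
qed

lemma P_diff:
  assumes "\<xi> \<in> projectable d" "\<zeta> \<in> projectable d"
  shows "\<xi> - \<zeta> \<in> projectable d \<and> P d (\<xi> - \<zeta>) = P d \<xi> - P d \<zeta>"
proof -
  note m = P_scaleC[OF assms(2), of "-1"]
  show ?thesis using P_add[OF assms(1), of "(-1) *\<^sub>C \<zeta>"] m
    by (simp add: complex_vector.scale_minus_left scaleC_one)
qed

lemma P_self: "\<xi> \<in> M d \<Longrightarrow> \<xi> \<in> projectable d \<and> P d \<xi> = \<xi>"
  by (rule P_eqI) simp_all

lemma P_other: "d \<noteq> e \<Longrightarrow> \<xi> \<in> M e \<Longrightarrow> \<xi> \<in> projectable d \<and> P d \<xi> = 0"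
  by (rule P_eqI) (auto simp: complex_vector.subspace_0[OF sub] intro: orth[of e d])

lemma P_contract:
  assumes "\<xi> \<in> projectable d"
  shows "norm (P d \<xi>) \<le> norm \<xi>"
proof -
  have "(norm (P d \<xi>))\<^sup>2 = Re (cinner \<xi> (P d \<xi>))"
    using P_props(2)[OF assms P_props(1)[OF assms]] by (simp add: norm_eq_Re_cinner cinner_diff_left)
  also have "\<dots> \<le> norm \<xi> * norm (P d \<xi>)" by (rule Re_cinner_le)
  finally show ?thesis by (cases "norm (P d \<xi>) = 0") (auto simp: power2_eq_square)
qed

lemma csubspace_projectable: "csubspace (projectable d)"
proof (rule complex_vector.subspaceI)
  show "0 \<in> projectable d" using P_self[of 0 d] complex_vector.subspace_0[OF sub] by blast
  show "\<xi> + \<zeta> \<in> projectable d" if "\<xi> \<in> projectable d" "\<zeta> \<in> projectable d" for \<xi> \<zeta>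
    using P_add[OF that] by blast
  show "c *\<^sub>C \<xi> \<in> projectable d" if "\<xi> \<in> projectable d" for c \<xi>
    using P_scaleC[OF that] by blast
qed

text \<open>Projections of a convergent sequence are Cauchy because projecting is contractive;
  completeness of \<open>M d\<close> supplies their limit, and orthogonality survives by
  continuity.\<close>

lemma closed_projectable: "closed (projectable d)"
  unfolding closed_sequential_limits
proof (intro allI impI, elim conjE)
  fix f \<xi> assume f: "\<forall>n. f n \<in> projectable d" "f \<longlonglongrightarrow> \<xi>"
  have "dist (P d (f m)) (P d (f n)) \<le> dist (f m) (f n)" for m n
    using P_diff[of "f m" d "f n"] P_contract[of "f m - f n" d] f(1) by (simp add: dist_norm)
  then have "Cauchy (\<lambda>n. P d (f n))"
    using LIMSEQ_imp_Cauchy[OF f(2)] unfolding Cauchy_def by (meson le_less_trans)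
  moreover have "\<forall>n. P d (f n) \<in> M d" using f(1) P_props(1) by blast
  ultimately obtain \<eta> where \<eta>: "\<eta> \<in> M d" "(\<lambda>n. P d (f n)) \<longlonglongrightarrow> \<eta>"
    using complete[of d, unfolded complete_def, rule_format, of "\<lambda>n. P d (f n)"] by blast
  have "cinner (\<xi> - \<eta>) \<zeta> = 0" if "\<zeta> \<in> M d" for \<zeta>
  proof -
    have "(\<lambda>n. cinner (f n - P d (f n)) \<zeta>) \<longlonglongrightarrow> cinner (\<xi> - \<eta>) \<zeta>"
      by (intro bounded_linear.tendsto[OF bounded_linear_cinner_left] tendsto_intros f \<eta>)
    moreover have "(\<lambda>n. cinner (f n - P d (f n)) \<zeta>) = (\<lambda>n. 0)" using f(1) P_props(2)[OF _ that] by simp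
    ultimately show ?thesis by (simp add: LIMSEQ_const_iff)
  qed
  then show "\<xi> \<in> projectable d" using P_eqI[OF \<eta>(1)] by blast
qed

definition D :: "'h set" where "D = cspan (\<Union>d. M d)"

definition K :: "'h set" where "K = closure D"

lemma csubspace_D: "csubspace D" and csubspace_K: "csubspace K"
proof -
  show "csubspace D" unfolding D_def by (rule complex_vector.subspace_span)
  then show "csubspace K" unfolding K_def by (rule csubspace_closure)
qed

lemma M_subset_K: "M d \<subseteq> K"
proof
  fix \<xi> assume "\<xi> \<in> M d"
  then have "\<xi> \<in> D" unfolding D_def by (intro complex_vector.span_base) blast
  then show "\<xi> \<in> K" unfolding K_def using closure_subset by (rule rev_subsetD)
qed

lemma K_projectable: "\<xi> \<in> K \<Longrightarrow> \<xi> \<in> projectable d"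
proof -
  have "M e \<subseteq> projectable d" for e using P_self P_other by (cases "d = e") auto
  then have "D \<subseteq> projectable d" unfolding D_def
    by (intro complex_vector.span_minimal csubspace_projectable) auto
  then show "\<xi> \<in> K \<Longrightarrow> \<xi> \<in> projectable d" unfolding K_def using closure_minimal closed_projectable by blast
qed

lemma D_finite:
  assumes "\<xi> \<in> D"
  shows "\<exists>N. (\<forall>d\<ge>N. P d \<xi> = 0) \<and> \<xi> = (\<Sum>d<N. P d \<xi>)"
proof -
  have DK: "D \<subseteq> K" by (simp add: K_def closure_subset)
  have ext: "\<xi> = (\<Sum>d<N'. P d \<xi>)" if "\<forall>d\<ge>N. P d \<xi> = 0" "\<xi> = (\<Sum>d<N. P d \<xi>)" "N \<le> N'" for \<xi> N N'
  proof -
    have "(\<Sum>d<N'. P d \<xi>) = (\<Sum>d<N. P d \<xi>)" using that by (intro sum.mono_neutral_right) auto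
    then show ?thesis using that(2) by simp
  qed
  let ?Q = "\<lambda>\<xi>. \<xi> \<in> D \<and> (\<exists>N. (\<forall>d\<ge>N. P d \<xi> = 0) \<and> \<xi> = (\<Sum>d<N. P d \<xi>))"
  have homogeneous: "?Q \<xi>" if "\<xi> \<in> M e" for \<xi> e
  proof (intro conjI exI[of _ "Suc e"] allI impI)
    show "\<xi> \<in> D" using that unfolding D_def by (auto intro: complex_vector.span_base)
    show "P d \<xi> = 0" if "Suc e \<le> d" for d using that P_other[OF _ \<open>\<xi> \<in> M e\<close>] by auto
    have "(\<Sum>d<Suc e. P d \<xi>) = (\<Sum>d<Suc e. if d = e then \<xi> else 0)"
      using P_other[OF _ that] P_self[OF that] by (intro sum.cong) auto
    then show "\<xi> = (\<Sum>d<Suc e. P d \<xi>)" by simp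
  qed
  have "?Q \<xi>" using assms unfolding D_def
  proof (induction rule: complex_vector.span_induct_alt)
    case base
    show ?case using homogeneous[of 0 0] complex_vector.subspace_0[OF sub] unfolding D_def by blast
  next
    case (step c \<zeta> \<eta>)
    then obtain e where \<zeta>: "\<zeta> \<in> M e" by blast
    obtain N1 where N1: "\<forall>d\<ge>N1. P d \<zeta> = 0" "\<zeta> = (\<Sum>d<N1. P d \<zeta>)" and \<zeta>D: "\<zeta> \<in> D"
      using homogeneous[OF \<zeta>] by blast
    obtain N2 where N2: "\<forall>d\<ge>N2. P d \<eta> = 0" "\<eta> = (\<Sum>d<N2. P d \<eta>)" and \<eta>D: "\<eta> \<in> D"
      using step unfolding D_def by blast
    have P: "P d (c *\<^sub>C \<zeta> + \<eta>) = c *\<^sub>C P d \<zeta> + P d \<eta>" for d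
      using P_add P_scaleC K_projectable \<zeta>D \<eta>D DK by (metis subsetD)
    let ?N = "max N1 N2"
    have "c *\<^sub>C \<zeta> + \<eta> = c *\<^sub>C (\<Sum>d<?N. P d \<zeta>) + (\<Sum>d<?N. P d \<eta>)"
      using ext[OF N1, of ?N] ext[OF N2, of ?N] by simp
    also have "\<dots> = (\<Sum>d<?N. P d (c *\<^sub>C \<zeta> + \<eta>))"
      by (simp add: P sum.distrib complex_vector.scale_sum_right)
    finally have "c *\<^sub>C \<zeta> + \<eta> = (\<Sum>d<?N. P d (c *\<^sub>C \<zeta> + \<eta>))" .
    moreover have "\<forall>d\<ge>?N. P d (c *\<^sub>C \<zeta> + \<eta>) = 0" using N1 N2 by (simp add: P)
    moreover have "c *\<^sub>C \<zeta> + \<eta> \<in> D"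
      using \<zeta>D \<eta>D csubspace_D by (simp add: complex_vector.subspace_add complex_vector.subspace_scale)
    ultimately show ?case unfolding D_def by blast
  qed
  then show ?thesis by blast
qed

section \<open>The damped series and its semigroup properties\<close>

text \<open>\<open>Tt\<close> and \<open>T\<close> below are \<open>Gamma_term\<close> and
  \<open>Gamma_op\<close> with the degree subspaces abstracted to \<open>M\<close>.\<close>

definition Tt :: "real \<Rightarrow> 'h \<Rightarrow> nat \<Rightarrow> 'h" where "Tt t \<xi> d = exp (- (real d * t)) *\<^sub>R P d \<xi>"

definition T :: "real \<Rightarrow> 'h \<Rightarrow> 'h" where "T t \<xi> = (\<Sum>d. Tt t \<xi> d)"

lemma Tt_linear:
  assumes "\<xi> \<in> K" "\<zeta> \<in> K"
  shows "Tt t (\<xi> + \<zeta>) = (\<lambda>d. Tt t \<xi> d + Tt t \<zeta> d)" "Tt t (c *\<^sub>C \<xi>) = (\<lambda>d. c *\<^sub>C Tt t \<xi> d)"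
    "Tt t (\<xi> - \<zeta>) = (\<lambda>d. Tt t \<xi> d - Tt t \<zeta> d)"
proof -
  have pr: "P d (\<xi> + \<zeta>) = P d \<xi> + P d \<zeta>" "P d (c *\<^sub>C \<xi>) = c *\<^sub>C P d \<xi>" "P d (\<xi> - \<zeta>) = P d \<xi> - P d \<zeta>" for d
    using P_add[of \<xi> d \<zeta>] P_scaleC[of \<xi> d c] P_diff[of \<xi> d \<zeta>] K_projectable assms by simp_all
  show "Tt t (\<xi> + \<zeta>) = (\<lambda>d. Tt t \<xi> d + Tt t \<zeta> d)" "Tt t (\<xi> - \<zeta>) = (\<lambda>d. Tt t \<xi> d - Tt t \<zeta> d)"
    by (simp_all add: fun_eq_iff Tt_def pr scaleR_add_right scaleR_diff_right)
  show "Tt t (c *\<^sub>C \<xi>) = (\<lambda>d. c *\<^sub>C Tt t \<xi> d)"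
    by (simp add: fun_eq_iff Tt_def pr scaleR_scaleC scaleC_scaleC mult.commute)
qed

lemma norm_sum_P_sq:
  assumes "\<xi> \<in> K"
  shows "(norm (\<Sum>d<m. c d *\<^sub>R P d \<xi>))\<^sup>2 = (\<Sum>d<m. (c d)\<^sup>2 * (norm (P d \<xi>))\<^sup>2)"
proof -
  have "pairwise (\<lambda>i j. orthogonal (c i *\<^sub>R P i \<xi>) (c j *\<^sub>R P j \<xi>)) {..<m}"
    using orth[OF _ P_props(1)[OF K_projectable[OF assms]] P_props(1)[OF K_projectable[OF assms]]]
    by (auto simp: pairwise_def orthogonal_def inner_cinner cinner_scaleR_left cinner_scaleR_right)
  from norm_sum_Pythagorean[OF finite_lessThan this] show ?thesis by (simp add: power_mult_distrib)
qed

lemma Bessel: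
  assumes "\<xi> \<in> K"
  shows "(\<Sum>d<m. (norm (P d \<xi>))\<^sup>2) \<le> (norm \<xi>)\<^sup>2"
proof -
  define Q where "Q = (\<Sum>d<m. P d \<xi>)"
  have Q: "(norm Q)\<^sup>2 = (\<Sum>d<m. (norm (P d \<xi>))\<^sup>2)"
    using norm_sum_P_sq[OF assms, of "\<lambda>_. 1" m] by (simp add: Q_def)
  have "Re (cinner \<xi> (P d \<xi>)) = (norm (P d \<xi>))\<^sup>2" for d
    using P_props(2)[OF K_projectable[OF assms] P_props(1)[OF K_projectable[OF assms]], of d]
    by (simp add: norm_eq_Re_cinner cinner_diff_left)
  then have "Re (cinner \<xi> Q) = (norm Q)\<^sup>2" unfolding Q by (simp add: Q_def cinner_sum_right)
  then have "(norm Q)\<^sup>2 = Re (cinner \<xi> Q)" by simp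
  also have "\<dots> \<le> norm \<xi> * norm Q" by (rule Re_cinner_le)
  finally have "norm Q \<le> norm \<xi>" by (cases "norm Q = 0") (auto simp: power2_eq_square)
  then show ?thesis by (simp flip: Q)
qed

lemma norm_partial_sum_le:
  assumes "\<xi> \<in> K" "t \<ge> 0"
  shows "norm (\<Sum>d<m. Tt t \<xi> d) \<le> norm \<xi>"
proof -
  have "(norm (\<Sum>d<m. Tt t \<xi> d))\<^sup>2 = (\<Sum>d<m. (exp (- (real d * t)))\<^sup>2 * (norm (P d \<xi>))\<^sup>2)"
    unfolding Tt_def by (rule norm_sum_P_sq[OF assms(1)])
  also have "\<dots> \<le> (\<Sum>d<m. 1 * (norm (P d \<xi>))\<^sup>2)"
    using assms(2) by (intro sum_mono mult_right_mono power_le_one) auto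
  also have "\<dots> \<le> (norm \<xi>)\<^sup>2" using Bessel[OF assms(1)] by simp
  finally show ?thesis using power2_le_imp_le by fastforce
qed

lemma D_T:
  assumes "\<xi> \<in> D"
  obtains N where "\<And>t. Tt t \<xi> sums (\<Sum>d<N. Tt t \<xi> d)" "\<xi> = (\<Sum>d<N. P d \<xi>)"
proof -
  obtain N where N: "\<forall>d\<ge>N. P d \<xi> = 0" "\<xi> = (\<Sum>d<N. P d \<xi>)" using D_finite[OF assms] by blast
  have "Tt t \<xi> sums (\<Sum>d<N. Tt t \<xi> d)" for t
    using N(1) by (intro sums_finite) (auto simp: Tt_def)
  with N(2) that show thesis by blast
qed

text \<open>On \<open>D\<close> the partial sums are eventually constant, and by Bessel's inequality
  they all have Lipschitz constant 1.\<close>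

lemma summable_T:
  assumes "\<xi> \<in> K" "t \<ge> 0"
  shows "summable (Tt t \<xi>)"
proof -
  have "convergent (\<lambda>m. \<Sum>d<m. Tt t \<xi> d)"
  proof (rule convergent_closure_lipschitz[where D = K and L = 1 and S = D])
    fix n \<xi> \<zeta> assume *: "\<xi> \<in> K" "\<zeta> \<in> K"
    then have "(\<Sum>d<n. Tt t \<xi> d) - (\<Sum>d<n. Tt t \<zeta> d) = (\<Sum>d<n. Tt t (\<xi> - \<zeta>) d)"
      by (simp add: Tt_linear sum_subtractf)
    moreover have "\<xi> - \<zeta> \<in> K" using * csubspace_K by (simp add: complex_vector.subspace_diff)
    ultimately show "dist (\<Sum>d<n. Tt t \<xi> d) (\<Sum>d<n. Tt t \<zeta> d) \<le> 1 * dist \<xi> \<zeta>"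
      using norm_partial_sum_le[OF _ assms(2)] by (simp add: dist_norm)
  next
    show "D \<subseteq> K" by (simp add: K_def closure_subset)
    fix \<xi> assume "\<xi> \<in> D"
    then obtain N where "Tt t \<xi> sums (\<Sum>d<N. Tt t \<xi> d)" using D_T by metis
    then show "convergent (\<lambda>m. \<Sum>d<m. Tt t \<xi> d)" by (auto simp: sums_def convergent_def)
  qed (use assms in \<open>auto simp: K_def\<close>)
  then show ?thesis by (simp add: summable_iff_convergent)
qed

lemma T_limit: "\<xi> \<in> K \<Longrightarrow> t \<ge> 0 \<Longrightarrow> (\<lambda>m. \<Sum>d<m. Tt t \<xi> d) \<longlonglongrightarrow> T t \<xi>"
  unfolding T_def using summable_T summable_LIMSEQ by blast

lemma T_add: "\<xi> \<in> K \<Longrightarrow> \<zeta> \<in> K \<Longrightarrow> t \<ge> 0 \<Longrightarrow> T t (\<xi> + \<zeta>) = T t \<xi> + T t \<zeta>"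
  unfolding T_def by (simp add: Tt_linear suminf_add[symmetric] summable_T)

lemma T_diff: "\<xi> \<in> K \<Longrightarrow> \<zeta> \<in> K \<Longrightarrow> t \<ge> 0 \<Longrightarrow> T t (\<xi> - \<zeta>) = T t \<xi> - T t \<zeta>"
  unfolding T_def by (simp add: Tt_linear suminf_diff[symmetric] summable_T)

lemma T_scaleC: "\<xi> \<in> K \<Longrightarrow> t \<ge> 0 \<Longrightarrow> T t (c *\<^sub>C \<xi>) = c *\<^sub>C T t \<xi>"
  unfolding T_def by (simp add: Tt_linear(2) bounded_linear.suminf[OF bounded_linear_scaleC, symmetric] summable_T)

lemma T_contract:
  assumes "\<xi> \<in> K" "t \<ge> 0"
  shows "norm (T t \<xi>) \<le> norm \<xi>"
  using norm_partial_sum_le[OF assms]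
  by (intro Lim_bounded[OF tendsto_norm[OF T_limit[OF assms]], of 0]) auto

lemma T_in_K:
  assumes "\<xi> \<in> K" "t \<ge> 0"
  shows "T t \<xi> \<in> K"
proof (rule closed_sequentially[OF _ _ T_limit[OF assms]])
  show "closed K" by (simp add: K_def)
  have "Tt t \<xi> d \<in> K" for d
    using P_props(1)[OF K_projectable[OF assms(1)], of d] M_subset_K[of d] csubspace_K
    by (auto simp: Tt_def scaleR_scaleC complex_vector.subspace_scale)
  then show "(\<Sum>d<m. Tt t \<xi> d) \<in> K" for m by (simp add: complex_vector.subspace_sum csubspace_K)
qed

lemma T_M: "\<xi> \<in> M d \<Longrightarrow> T t \<xi> = exp (- (real d * t)) *\<^sub>R \<xi>"
  unfolding T_def using P_self[of \<xi> d] P_other[of _ d \<xi>]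
  by (subst suminf_finite[of "{d}"]) (auto simp: Tt_def)

text \<open>This is where density of \<open>D\<close> in \<open>K\<close> gives the completeness of
  the decomposition: a vector of \<open>D\<close> is the finite sum of its projections, and
  contractivity carries the identity to the closure.\<close>

lemma T_0:
  assumes "\<xi> \<in> K"
  shows "T 0 \<xi> = \<xi>"
proof -
  have "norm (T 0 \<xi> - \<xi>) \<le> 0 + e" if "e > 0" for e
  proof -
    obtain \<zeta> where \<zeta>: "\<zeta> \<in> D" "dist \<zeta> \<xi> < e / 2"
      using assms \<open>e > 0\<close> unfolding K_def closure_approachable by (meson half_gt_zero)
    have \<zeta>K: "\<zeta> \<in> K" using \<zeta>(1) closure_subset by (auto simp: K_def)
    obtain N where "Tt 0 \<zeta> sums (\<Sum>d<N. Tt 0 \<zeta> d)" "\<zeta> = (\<Sum>d<N. P d \<zeta>)" using D_T[OF \<zeta>(1)] by metis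
    then have "T 0 \<zeta> = \<zeta>" unfolding T_def by (simp add: sums_iff) (simp add: Tt_def)
    then have "norm (T 0 \<xi> - \<xi>) = norm (T 0 (\<xi> - \<zeta>) + (\<zeta> - \<xi>))" using assms \<zeta>K by (simp add: T_diff)
    also have "\<dots> \<le> norm (\<xi> - \<zeta>) + norm (\<zeta> - \<xi>)"
      using assms \<zeta>K csubspace_K
      by (intro order_trans[OF norm_triangle_ineq] add_mono T_contract) (auto simp: complex_vector.subspace_diff)
    finally show ?thesis using \<zeta>(2) by (simp add: dist_norm norm_minus_commute)
  qed
  then have "norm (T 0 \<xi> - \<xi>) \<le> 0" by (rule field_le_epsilon)
  then show ?thesis by simp
qed

text \<open>Pairing with a vector of \<open>M d\<close> is continuous and annihilates every other
  term of the series. The semigroup law then reduces to adding exponents.\<close>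

lemma P_T:
  assumes "\<xi> \<in> K" "t \<ge> 0"
  shows "P d (T t \<xi>) = exp (- (real d * t)) *\<^sub>R P d \<xi>"
proof -
  note pr = P_props[OF K_projectable[OF assms(1)]]
  have "Tt t \<xi> d \<in> M d" using pr(1)[of d] sub by (simp add: Tt_def scaleR_scaleC complex_vector.subspace_scale)
  then have "P d (T t \<xi>) = Tt t \<xi> d"
  proof (rule conjunct2[OF P_eqI])
    fix \<zeta> assume \<zeta>: "\<zeta> \<in> M d"
    have "cinner (T t \<xi>) \<zeta> = (\<Sum>e. cinner (Tt t \<xi> e) \<zeta>)"
      unfolding T_def by (rule bounded_linear.suminf[OF bounded_linear_cinner_left summable_T[OF assms]])
    also have "\<dots> = cinner (Tt t \<xi> d) \<zeta>"
      using orth[OF _ pr(1) \<zeta>] by (subst suminf_finite[of "{d}"]) (auto simp: Tt_def cinner_scaleR_left)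
    finally show "cinner (T t \<xi> - Tt t \<xi> d) \<zeta> = 0" by (simp add: cinner_diff_left)
  qed
  then show ?thesis by (simp add: Tt_def)
qed

lemma T_semigroup:
  assumes "\<xi> \<in> K" "s \<ge> 0" "t \<ge> 0"
  shows "T (s + t) \<xi> = T s (T t \<xi>)"
proof -
  have "Tt s (T t \<xi>) d = Tt (s + t) \<xi> d" for d
    by (simp add: Tt_def P_T assms ring_distribs flip: exp_add)
  then show ?thesis by (simp add: T_def[of s] T_def[of "s + t"])
qed

text \<open>Approximating \<xi> from \<open>D\<close> gives finite sums of exponentials in t, and
  contractivity makes the approximation uniform in t.\<close>

lemma T_continuous:
  assumes "\<xi> \<in> K"
  shows "continuous_on {0..} (\<lambda>t. T t \<xi>)"
proof -
  obtain f where f: "\<And>n::nat. f n \<in> D" "f \<longlonglongrightarrow> \<xi>" using assms unfolding K_def closure_sequential by blast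
  have fK: "f n \<in> K" for n using f(1)[of n] closure_subset by (auto simp: K_def)
  show ?thesis
  proof (rule uniform_limit_theorem)
    show "\<forall>\<^sub>F n in sequentially. continuous_on {0..} (\<lambda>t. T t (f n))"
    proof (intro always_eventually allI)
      fix n
      obtain N where "\<And>t. Tt t (f n) sums (\<Sum>d<N. Tt t (f n) d)" using D_T[OF f(1)] by metis
      then have "(\<lambda>t. T t (f n)) = (\<lambda>t. \<Sum>d<N. Tt t (f n) d)" unfolding T_def by (simp add: sums_iff)
      moreover have "continuous_on {0..} (\<lambda>t. \<Sum>d<N. Tt t (f n) d)"
        unfolding Tt_def by (intro continuous_intros)
      ultimately show "continuous_on {0..} (\<lambda>t. T t (f n))" by (simp only:)
    qed
    show "uniform_limit {0..} (\<lambda>n t. T t (f n)) (\<lambda>t. T t \<xi>) sequentially"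
    proof (rule uniform_limitI)
      fix e :: real assume "e > 0"
      then have "\<forall>\<^sub>F n in sequentially. dist (f n) \<xi> < e" by (rule tendstoD[OF f(2)])
      then show "\<forall>\<^sub>F n in sequentially. \<forall>t\<in>{0..}. dist (T t (f n)) (T t \<xi>) < e"
      proof eventually_elim
        case (elim n)
        have "f n - \<xi> \<in> K" using fK assms csubspace_K by (simp add: complex_vector.subspace_diff)
        then show ?case using elim T_contract T_diff[OF fK assms] by (fastforce simp: dist_norm)
      qed
    qed
  qed simp
qed

theorem contraction_semigroup_T: "is_contraction_semigroup_on K T"
  unfolding is_contraction_semigroup_on_def clinear_on_def
  using csubspace_K T_add T_scaleC T_in_K T_contract T_0 T_semigroup T_continuous by (auto simp: K_def)

end

subsection \<open>Free complexification forces balanced moments\<close>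

text \<open>The integer power in the form used by \<open>is_haar_unitary\<close>, with
  \<open>star z\<close> as the inverse.\<close>

definition unitary_power :: "'a::cstar_algebra \<Rightarrow> int \<Rightarrow> 'a"
  where "unitary_power z n = (if 0 \<le> n then z ^ nat n else star z ^ nat (- n))"

context
  fixes z :: "'a::cstar_algebra"
  assumes unitary: "star z * z = 1" "z * star z = 1"
begin

lemma unitary_power_Suc: "unitary_power z (n + 1) = z * unitary_power z n"
proof -
  consider "0 \<le> n" | m where "n = - int (Suc m)"
    by (metis int_cases not_le negative_zle of_nat_0_le_iff)
  then show ?thesis
  proof cases
    case 1 then show ?thesis by (simp add: unitary_power_def nat_add_distrib)
  next
    case 2
    have "z * star z ^ Suc m = star z ^ m" by (simp flip: mult.assoc add: unitary)
    then show ?thesis using 2 by (cases m) (auto simp: unitary_power_def nat_add_distrib)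
  qed
qed

lemma unitary_power_pred: "unitary_power z (n - 1) = star z * unitary_power z n"
  using unitary_power_Suc[of "n - 1"] by (simp flip: mult.assoc add: unitary)

lemma unitary_power_add: "unitary_power z (m + n) = unitary_power z m * unitary_power z n"
proof (induction m rule: int_induct[where k = 0])
  case base show ?case by (simp add: unitary_power_def)
next
  case (step1 i)
  then show ?case using unitary_power_Suc[of "i + n"] by (simp add: unitary_power_Suc algebra_simps unitary_power_Suc[unfolded add.commute[of _ 1]])
next
  case (step2 i)
  then show ?case using unitary_power_pred[of "i + n"] by (simp add: unitary_power_pred algebra_simps)
qed

end

lemma star_subalgebra_star_algebra_gen: "star_subalgebra (star_algebra_gen X)"
proof -
  have "(\<lambda>S. is_unital_subalgebra S \<and> (\<forall>a\<in>S. star a \<in> S)) ((\<lambda>S. is_unital_subalgebra S \<and> (\<forall>a\<in>S. star a \<in> S)) hull X)"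
    by (rule hull_in) (auto simp: is_unital_subalgebra_def intro!: complex_vector.subspace_Inter)
  then show ?thesis by (simp add: star_subalgebra_def star_algebra_gen_def)
qed

lemma star_algebra_gen_superset: "X \<subseteq> star_algebra_gen X"
  unfolding star_algebra_gen_def by (rule hull_subset)

lemma power_in_star_subalgebra: "star_subalgebra S \<Longrightarrow> a \<in> S \<Longrightarrow> a ^ n \<in> S"
  by (induction n) (auto simp: star_subalgebra_closed_ops)

lemma unitary_power_in_star_subalgebra: "star_subalgebra S \<Longrightarrow> z \<in> S \<Longrightarrow> unitary_power z n \<in> S"
  by (auto simp: unitary_power_def power_in_star_subalgebra star_subalgebra_closed_ops(8))

text \<open>A letter of a mixed word is a power of the Haar unitary or an element of the algebra that is
  free from it.\<close>

definition letter_val :: "'b::cstar_algebra \<Rightarrow> int + 'b \<Rightarrow> 'b"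
  where "letter_val z l = (case l of Inl n \<Rightarrow> unitary_power z n | Inr b \<Rightarrow> b)"

definition letter_deg :: "int + 'b \<Rightarrow> int"
  where "letter_deg l = (case l of Inl n \<Rightarrow> n | Inr b \<Rightarrow> 0)"

lemma exists_adjacent_equal_kind:
  assumes "\<not> (\<forall>j. Suc j < length L \<longrightarrow> isl (L ! j) \<noteq> isl (L ! Suc j))"
  obtains L1 u v L2 where "L = L1 @ u # v # L2" "isl u = isl v"
proof -
  obtain j where j: "Suc j < length L" "isl (L ! j) = isl (L ! Suc j)" using assms by blast
  have "L = take j L @ L ! j # L ! Suc j # drop (Suc (Suc j)) L"
    using j(1) by (metis Cons_nth_drop_Suc Suc_lessD append_take_drop_id)
  with j(2) that show thesis by blast
qed

lemma alternating_kind: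
  assumes "\<forall>j. Suc j < length L \<longrightarrow> isl (L ! j) \<noteq> isl (L ! Suc j)" "j < length L"
  shows "isl (L ! j) \<longleftrightarrow> (if even j then isl (L ! 0) else \<not> isl (L ! 0))"
  using assms(2)
proof (induction j)
  case (Suc j)
  then show ?case using assms(1) by (auto dest: Suc_lessD)
qed simp

text \<open>Merge neighbours of the same kind, drop trivial powers, and centre the remaining letters
  one at a time: each step lowers the measure of the induction, and a centred alternating word has
  vanishing expectation by freeness.\<close>

lemma unbalanced_moment_zero:
  fixes \<psi> :: "'b::cstar_algebra \<Rightarrow> complex"
  assumes \<psi>: "is_faithful_state \<psi>" and z: "is_haar_unitary \<psi> z" and free: "star_free \<psi> {z} Y"
    and "\<And>b. Inr b \<in> set L \<Longrightarrow> b \<in> star_algebra_gen Y"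
    and "sum_list (map letter_deg L) \<noteq> 0"
  shows "\<psi> (prod_list (map (letter_val z) L)) = 0"
  using assms(4,5)
\<comment> \<open>Length counts twice because merging two centred letters can create one that is not
  centred; the measure still drops by at least 1. Centring keeps the length and lowers the second
  summand.\<close>
proof (induction "2 * length L + length (filter (\<lambda>l. \<psi> (letter_val z l) \<noteq> 0) L)" arbitrary: L rule: less_induct)
  case less
  note st = faithful_stateD[OF \<psi>]
  have uz: "star z * z = 1" "z * star z = 1" using z by (auto simp: is_haar_unitary_def)
  have zp: "\<psi> (unitary_power z n) = (if n = 0 then 1 else 0)" for n
    using z by (simp add: is_haar_unitary_def unitary_power_def)
  note Y = star_subalgebra_closed_ops[OF star_subalgebra_star_algebra_gen[of Y]]
  let ?nc = "\<lambda>L. length (filter (\<lambda>l. \<psi> (letter_val z l) \<noteq> 0) L)"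
  let ?p = "\<lambda>L. prod_list (map (letter_val z) L)"
  show ?case
  proof (cases "\<forall>j. Suc j < length L \<longrightarrow> isl (L ! j) \<noteq> isl (L ! Suc j)")
    case False
    then obtain L1 u v L2 where L: "L = L1 @ u # v # L2" and uv: "isl u = isl v"
      by (rule exists_adjacent_equal_kind)
    \<comment> \<open>The default case never occurs, since \<open>u\<close> and \<open>v\<close> are
      of the same kind.\<close>
    define w where "w = (case (u, v) of (Inl m, Inl n) \<Rightarrow> Inl (m + n) | (Inr a, Inr b) \<Rightarrow> Inr (a * b) | _ \<Rightarrow> u)"
    have w: "letter_val z w = letter_val z u * letter_val z v" "letter_deg w = letter_deg u + letter_deg v"
      using uv by (auto simp: w_def letter_val_def letter_deg_def unitary_power_add[OF uz] split: sum.splits)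
    have wY: "b \<in> star_algebra_gen Y" if "w = Inr b" for b
      using that uv less(2) L by (auto simp: w_def intro: Y split: sum.splits)
    have "\<psi> (?p (L1 @ w # L2)) = 0"
      by (rule less(1)) (use less(2,3) L w wY in \<open>auto simp: less_Suc_eq\<close>)
    then show ?thesis by (simp add: L w mult.assoc)
  next
    case alt: True
    show ?thesis
    proof (cases "\<exists>l\<in>set L. \<psi> (letter_val z l) \<noteq> 0")
      case True
      then obtain l L1 L2 where L: "L = L1 @ l # L2" and l: "\<psi> (letter_val z l) \<noteq> 0" by (metis split_list)
      show ?thesis
      proof (cases l)
        case (Inl n)
        then have "n = 0" using l zp[of n] by (auto simp: letter_val_def split: if_splits)
        then have "letter_val z l = 1" "letter_deg l = 0"
          using Inl by (simp_all add: letter_val_def letter_deg_def unitary_power_def)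
        moreover have "\<psi> (?p (L1 @ L2)) = 0"
          by (rule less(1)) (use less(2,3) L calculation in auto)
        ultimately show ?thesis by (simp add: L)
      next
        case (Inr b)
        \<comment> \<open>Splits the letter into its centred part and a scalar. Letters of this kind
          have degree 0, so both resulting words keep the nonzero degree; one has fewer uncentred
          letters and the other is shorter.\<close>
        define b' where "b' = b - \<psi> b *\<^sub>C 1"
        have b: "letter_val z l = b" "letter_deg l = 0" using Inr by (simp_all add: letter_val_def letter_deg_def)
        have b'Y: "b' \<in> star_algebra_gen Y" using less(2)[of b] L Inr unfolding b'_def by (intro Y(4) Y(6) Y(2)) auto
        have b'0: "\<psi> b' = 0" by (simp add: b'_def st)
        have "\<psi> (?p (L1 @ Inr b' # L2)) = 0"
          by (rule less(1)) (use less(2,3) L b b'Y b'0 l in \<open>auto simp: letter_val_def letter_deg_def\<close>)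
        moreover have "\<psi> (?p (L1 @ L2)) = 0"
          by (rule less(1)) (use less(2,3) L b in auto)
        moreover have "?p L = ?p (L1 @ Inr b' # L2) + \<psi> b *\<^sub>C ?p (L1 @ L2)"
          by (simp add: L b) (simp add: letter_val_def b'_def algebra_simps scaleC_mult_left scaleC_mult_right)
        ultimately show ?thesis by (simp add: st)
      qed
    next
      case False
      let ?as = "map (letter_val z) L"
      \<comment> \<open>The reductions preserve the degree, so they cannot end in the empty word,
        whose expectation is 1.\<close>
      have "L \<noteq> []" using less(3) by auto
      have mem: "?as ! j \<in> (if isl (L ! j) then star_algebra_gen {z} else star_algebra_gen Y)" if "j < length L" for j
      proof (cases "L ! j")
        case (Inl n)
        have "z \<in> star_algebra_gen {z}" using star_algebra_gen_superset by blast
        then show ?thesis using Inl that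
          by (simp add: letter_val_def unitary_power_in_star_subalgebra star_subalgebra_star_algebra_gen)
      next
        case (Inr b)
        then have "b \<in> star_algebra_gen Y" using less(2) that by (metis nth_mem)
        then show ?thesis using Inr that by (simp add: letter_val_def)
      qed
      have "(\<forall>j<length ?as. ?as ! j \<in> (if even j then star_algebra_gen {z} else star_algebra_gen Y)) \<or>
          (\<forall>j<length ?as. ?as ! j \<in> (if even j then star_algebra_gen Y else star_algebra_gen {z}))"
      proof (cases "isl (L ! 0)")
        case True
        have "?as ! j \<in> (if even j then star_algebra_gen {z} else star_algebra_gen Y)" if "j < length L" for j
          using mem[OF that] alternating_kind[OF alt that] True by (cases "even j") auto
        then show ?thesis by simp
      next
        case F: False
        have "?as ! j \<in> (if even j then star_algebra_gen Y else star_algebra_gen {z})" if "j < length L" for j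
          using mem[OF that] alternating_kind[OF alt that] F by (cases "even j") auto
        then show ?thesis by simp
      qed
      moreover have "\<forall>a\<in>set ?as. \<psi> a = 0" using False by auto
      moreover have "?as \<noteq> []" using \<open>L \<noteq> []\<close> by simp
      ultimately show ?thesis using free unfolding star_free_def free_pair_def by blast
    qed
  qed
qed

definition word_deg :: "('i \<times> bool) list \<Rightarrow> int"
  where "word_deg w = sum_list (map (\<lambda>(r, s). if s then - 1 else 1) w)"

text \<open>Each letter of the complexified family expands into a power of \<open>z\<close> and a
  letter free from it, so \<open>word_deg\<close> is the total exponent of \<open>z\<close>. A
  nonzero exponent kills the moment of the complexified family, which by invariance is the moment of
  the family itself.\<close>

lemma free_complexification_balanced:
  assumes inv: "invariant_under_free_complexification \<phi> \<Lambda> x \<psi> \<iota>"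
    and w: "w \<in> lists (\<Lambda> \<times> UNIV)" and deg: "word_deg w \<noteq> 0"
  shows "\<phi> (star_word x w) = 0"
proof -
  obtain z where \<psi>: "is_faithful_state \<psi>" and z: "is_haar_unitary \<psi> z" and free: "star_free \<psi> {z} (\<iota> ` x ` \<Lambda>)"
    and same: "same_star_distribution \<Lambda> \<psi> (\<lambda>r. z * \<iota> (x r)) \<phi> x"
    using inv by (auto simp: invariant_under_free_complexification_def is_enlargement_def)
  define expand where "expand = (\<lambda>(r, s). if s then [Inr (star (\<iota> (x r))), Inl (- 1 :: int)] else [Inl 1, Inr (\<iota> (x r))])"
  define L where "L = concat (map expand w)"
  note Y = star_subalgebra_closed_ops[OF star_subalgebra_star_algebra_gen[of "\<iota> ` x ` \<Lambda>"]]
  have "prod_list (map (letter_val z) L) = star_word (\<lambda>r. z * \<iota> (x r)) w"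
    unfolding L_def by (induction w)
      (auto simp: star_word_def expand_def letter_val_def unitary_power_def star_mult mult.assoc)
  moreover have "sum_list (map letter_deg L) = word_deg w"
    unfolding L_def by (induction w) (auto simp: word_deg_def expand_def letter_deg_def)
  moreover have "b \<in> star_algebra_gen (\<iota> ` x ` \<Lambda>)" if bL: "Inr b \<in> set L" for b
  proof -
    obtain r s where rs: "(r, s) \<in> set w" "Inr b \<in> set (expand (r, s))"
      using bL by (auto simp: L_def)
    then have "\<iota> (x r) \<in> star_algebra_gen (\<iota> ` x ` \<Lambda>)" using w by (intro set_mp[OF star_algebra_gen_superset]) auto
    then show ?thesis using rs(2) by (auto simp: expand_def Y(8) split: if_splits)
  qed
  ultimately have "\<psi> (star_word (\<lambda>r. z * \<iota> (x r)) w) = 0"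
    using unbalanced_moment_zero[OF \<psi> z free, of L] deg by simp
  then show ?thesis using same w by (simp add: same_star_distribution_def star_moment_star_word)
qed

text \<open>For \<open>c\<close> of modulus 1 conjugation is inversion, so rotating multiplies a
  *-word by \<open>c\<close> to the power \<open>word_deg\<close>. This factor is 1 on balanced
  words, and the other words have moment zero.\<close>

lemma same_star_distribution_rotate:
  assumes \<phi>: "is_faithful_state \<phi>" and inv: "invariant_under_free_complexification \<phi> \<Lambda> x \<psi> \<iota>"
    and c: "cmod c = 1"
  shows "same_star_distribution (\<Lambda> :: 'i set) \<phi> x \<phi> (\<lambda>r. c *\<^sub>C x r)"
  unfolding same_star_distribution_def star_moment_star_word
proof
  fix w :: "('i \<times> bool) list" assume w: "w \<in> lists (\<Lambda> \<times> UNIV)"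
  have c0: "c \<noteq> 0" and cc: "cnj c = inverse c"
    using c by (auto simp: divide_conv_cnj inverse_eq_divide)
  have "star_word (\<lambda>r. c *\<^sub>C x r) w = (c powi word_deg w) *\<^sub>C star_word x w" for w
  proof (induction w)
    case Nil then show ?case by (simp add: word_deg_def scaleC_one)
  next
    case (Cons l w)
    obtain r s where l: "l = (r, s)" by (cases l)
    have "star_word (\<lambda>r. c *\<^sub>C x r) (l # w) =
        ((if s then cnj c else c) *\<^sub>C (if s then star (x r) else x r)) * ((c powi word_deg w) *\<^sub>C star_word x w)"
      using Cons by (auto simp: star_word_def l star_scaleC)
    also have "\<dots> = ((if s then cnj c else c) * c powi word_deg w) *\<^sub>C star_word x (l # w)"
      by (simp add: scaleC_mult_left scaleC_mult_right scaleC_scaleC) (simp add: star_word_def l)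
    also have "(if s then cnj c else c) * c powi word_deg w = c powi word_deg (l # w)"
      using c0 by (auto simp: word_deg_def l cc power_int_add power_int_diff power_int_minus field_simps)
    finally show ?case .
  qed
  then show "\<phi> (star_word x w) = \<phi> (star_word (\<lambda>r. c *\<^sub>C x r) w)"
    using free_complexification_balanced[OF inv w] by (cases "word_deg w = 0") (simp_all add: faithful_stateD[OF \<phi>])
qed

subsection \<open>Discrete averages over rotations\<close>

text \<open>Orthogonality of the characters of the cyclic group of order \<open>L\<close>. Both
  exponents lie below \<open>L\<close>, so different ones stay different modulo
  \<open>L\<close>.\<close>

lemma roots_of_unity_sum:
  fixes L a b :: nat
  assumes "a < L" "b < L"
  defines "\<zeta> \<equiv> \<lambda>k. cis (2 * pi * real k / real L)"
  shows "(\<Sum>k<L. \<zeta> k ^ a * cnj (\<zeta> k) ^ b) = (if a = b then of_nat L else 0)"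
proof -
  have L: "L > 0" using assms by simp
  define q where "q = \<zeta> a * cnj (\<zeta> b)"
  \<comment> \<open>Exchanging exponent and index, \<open>\<zeta> k ^ a = \<zeta> a ^ k\<close>,
    produces a geometric series in \<open>k\<close> with ratio \<open>q\<close>.\<close>
  have "\<zeta> k ^ a * cnj (\<zeta> k) ^ b = q ^ k" for k
    by (simp add: q_def \<zeta>_def cis_cnj Complex.DeMoivre power_mult_distrib cis_mult mult_ac)
      (simp add: right_diff_distrib mult_ac)
  then have sum: "(\<Sum>k<L. \<zeta> k ^ a * cnj (\<zeta> k) ^ b) = (\<Sum>k<L. q ^ k)" by simp
  have qL: "q ^ L = 1"
  proof -
    have "\<zeta> j ^ L = 1" for j
    proof -
      have "\<zeta> j ^ L = cis (2 * pi * real j)" using L by (simp add: \<zeta>_def Complex.DeMoivre)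
      then show ?thesis by simp
    qed
    then show ?thesis by (simp add: q_def power_mult_distrib flip: complex_cnj_power)
  qed
  have inj: "inj_on \<zeta> {..<L}"
    using bij_betw_imp_inj_on[OF Complex.bij_betw_roots_unity[OF L]] by (simp add: \<zeta>_def)
  have bb: "cnj (\<zeta> b) * \<zeta> b = 1" by (simp add: \<zeta>_def cis_cnj cis_mult)
  show ?thesis
  proof (cases "a = b")
    case True
    then have "q = 1" using bb by (simp add: q_def mult.commute)
    then show ?thesis unfolding sum using True by simp
  next
    case False
    have "q \<noteq> 1"
    proof
      assume "q = 1"
      then have "q * \<zeta> b = \<zeta> b" by simp
      then have "\<zeta> a = \<zeta> b" using bb by (simp add: q_def mult.assoc)
      then show False using inj assms False by (auto dest: inj_onD)
    qed
    then show ?thesis using False qL by (simp add: sum geometric_sum)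
  qed
qed

section \<open>The truncated Poisson kernel on roots of unity\<close>

text \<open>The order is \<open>2 * N\<close> because the moment computation compares exponents
  \<open>n + d\<close> and \<open>m\<close> with \<open>n\<close>, \<open>d\<close>,
  \<open>m\<close> below \<open>N\<close>; all stay below \<open>2 * N\<close>, so no aliasing
  occurs.\<close>

definition rotation :: "nat \<Rightarrow> nat \<Rightarrow> complex"
  where "rotation N k = cis (2 * pi * real k / real (2 * N))"

text \<open>A Poisson kernel cut off at degree \<open>N\<close>: being the squared modulus of a partial sum of the
  geometric series, it is nonnegative.\<close>

definition kernel_weight :: "real \<Rightarrow> nat \<Rightarrow> nat \<Rightarrow> real"
  where "kernel_weight r N k =
    (1 - r\<^sup>2) / real (2 * N) * (cmod (\<Sum>n<N. of_real (r ^ n) * rotation N k ^ n))\<^sup>2"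

lemma kernel_weight_nonneg: "0 \<le> r \<Longrightarrow> r < 1 \<Longrightarrow> 0 \<le> kernel_weight r N k"
  by (simp add: kernel_weight_def power_le_one)

text \<open>Expanding the squared modulus gives a double sum in \<open>n\<close> and
  \<open>m\<close>, of which the sum over the roots retains only \<open>m = n + d\<close>. What is
  left is a finite geometric series in the square of \<open>r\<close>; the prefactor in
  \<open>kernel_weight\<close> cancels its denominator and the number of roots.\<close>

lemma kernel_weight_moment:
  assumes r: "0 \<le> r" "r < 1" and d: "d < N"
  shows "(\<Sum>k<2*N. of_real (kernel_weight r N k) * rotation N k ^ d) =
    of_real (r ^ d * (1 - (r\<^sup>2) ^ (N - d)))"
proof -
  have N: "N > 0" using d by simp
  define c where "c = complex_of_real ((1 - r\<^sup>2) / real (2 * N))"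
  have "of_real (kernel_weight r N k) * rotation N k ^ d =
      (\<Sum>n<N. \<Sum>m<N. c * of_real (r ^ (n + m)) * (rotation N k ^ (n + d) * cnj (rotation N k) ^ m))" for k
  proof -
    let ?\<zeta> = "rotation N k"
    have "of_real ((cmod (\<Sum>n<N. of_real (r ^ n) * ?\<zeta> ^ n))\<^sup>2) =
        (\<Sum>n<N. of_real (r ^ n) * ?\<zeta> ^ n) * (\<Sum>m<N. of_real (r ^ m) * cnj ?\<zeta> ^ m)"
      unfolding complex_norm_square by (simp add: cnj_sum)
    then have "of_real (kernel_weight r N k) * ?\<zeta> ^ d =
        c * (\<Sum>n<N. \<Sum>m<N. (of_real (r ^ n) * ?\<zeta> ^ n) * (of_real (r ^ m) * cnj ?\<zeta> ^ m)) * ?\<zeta> ^ d"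
      by (simp only: kernel_weight_def of_real_mult c_def sum_product)
    also have "\<dots> = (\<Sum>n<N. \<Sum>m<N. c * ((of_real (r ^ n) * ?\<zeta> ^ n) * (of_real (r ^ m) * cnj ?\<zeta> ^ m)) * ?\<zeta> ^ d)"
      by (simp only: sum_distrib_left sum_distrib_right)
    finally show ?thesis by (simp add: power_add mult_ac)
  qed
  then have "(\<Sum>k<2*N. of_real (kernel_weight r N k) * rotation N k ^ d) =
      (\<Sum>k<2*N. \<Sum>n<N. \<Sum>m<N. c * of_real (r ^ (n + m)) * (rotation N k ^ (n + d) * cnj (rotation N k) ^ m))"
    by simp
  also have "\<dots> = (\<Sum>n<N. \<Sum>m<N. \<Sum>k<2*N. c * of_real (r ^ (n + m)) * (rotation N k ^ (n + d) * cnj (rotation N k) ^ m))"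
    by (rule trans[OF sum.swap], rule sum.cong[OF refl], rule sum.swap)
  also have "\<dots> = (\<Sum>n<N. \<Sum>m<N. if m = n + d then c * of_real (r ^ (n + m)) * of_nat (2 * N) else 0)"
  proof (intro sum.cong refl)
    fix n m assume "n \<in> {..<N}" "m \<in> {..<N}"
    then show "(\<Sum>k<2*N. c * of_real (r ^ (n + m)) * (rotation N k ^ (n + d) * cnj (rotation N k) ^ m)) =
        (if m = n + d then c * of_real (r ^ (n + m)) * of_nat (2 * N) else 0)"
      using roots_of_unity_sum[of "n + d" "2 * N" m] d unfolding rotation_def
      by (auto simp flip: sum_distrib_left)
  qed
  \<comment> \<open>The surviving index \<open>m = n + d\<close> must itself lie below
    \<open>N\<close>; this is the sole effect of the cut-off.\<close>
  also have "\<dots> = (\<Sum>n<N. if n < N - d then of_real ((1 - r\<^sup>2) * r ^ d * (r\<^sup>2) ^ n) else 0)"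
    using N by (intro sum.cong refl) (auto simp: c_def sum.delta power_add power_mult power2_eq_square power_mult_distrib)
  also have "\<dots> = (\<Sum>n<N - d. of_real ((1 - r\<^sup>2) * r ^ d * (r\<^sup>2) ^ n))"
    by (intro sum.mono_neutral_cong_right) auto
  also have "\<dots> = of_real (r ^ d * ((1 - r\<^sup>2) * (\<Sum>n<N - d. (r\<^sup>2) ^ n)))"
    by (simp add: sum_distrib_left mult_ac)
  also have "(1 - r\<^sup>2) * (\<Sum>n<N - d. (r\<^sup>2) ^ n) = 1 - (r\<^sup>2) ^ (N - d)"
    by (rule one_diff_power_eq[symmetric])
  finally show ?thesis .
qed

lemma sum_kernel_weight_le_1:
  assumes "0 \<le> r" "r < 1"
  shows "(\<Sum>k<2*N. kernel_weight r N k) \<le> 1"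
proof (cases "N = 0")
  case False
  then have "complex_of_real (\<Sum>k<2*N. kernel_weight r N k) = of_real (1 - (r\<^sup>2) ^ N)"
    using kernel_weight_moment[OF assms, of 0 N] by simp
  then have "(\<Sum>k<2*N. kernel_weight r N k) = 1 - (r\<^sup>2) ^ N" by (simp only: of_real_eq_iff)
  then show ?thesis by simp
qed simp

lemma kernel_weight_moment_tendsto:
  assumes "0 \<le> r" "r < 1"
  shows "(\<lambda>N. \<Sum>k<2*N. of_real (kernel_weight r N k) * rotation N k ^ d) \<longlonglongrightarrow> of_real (r ^ d)"
proof -
  have "(\<lambda>n. (r\<^sup>2) ^ n) \<longlonglongrightarrow> 0"
    using assms by (intro LIMSEQ_realpow_zero) (auto simp: power_less_one_iff abs_square_less_1)
  then have "(\<lambda>N. (r\<^sup>2) ^ (N - d)) \<longlonglongrightarrow> 0" by (rule seq_offset_neg)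
  then have "(\<lambda>N. complex_of_real (r ^ d * (1 - (r\<^sup>2) ^ (N - d)))) \<longlonglongrightarrow> of_real (r ^ d * (1 - 0))"
    by (intro tendsto_intros)
  moreover have "\<forall>\<^sub>F N in sequentially. complex_of_real (r ^ d * (1 - (r\<^sup>2) ^ (N - d))) =
      (\<Sum>k<2*N. of_real (kernel_weight r N k) * rotation N k ^ d)"
    using eventually_gt_at_top[of d] by eventually_elim (simp only: kernel_weight_moment[OF assms])
  ultimately show ?thesis using Lim_transform_eventually by fastforce
qed

subsection \<open>The operator algebra of the family\<close>

lemma word_star_word: "prod_list (map x us) = star_word x (map (\<lambda>r. (r, False)) us)"
  by (simp add: star_word_def comp_def)

lemma words_mult: "a \<in> words \<Lambda> x d \<Longrightarrow> b \<in> words \<Lambda> x e \<Longrightarrow> a * b \<in> words \<Lambda> x (d + e)"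
proof -
  assume "a \<in> words \<Lambda> x d" "b \<in> words \<Lambda> x e"
  then obtain us vs where "a = prod_list (map x us)" "us \<in> lists \<Lambda>" "length us = d"
    "b = prod_list (map x vs)" "vs \<in> lists \<Lambda>" "length vs = e" by (auto simp: words_def)
  then show "a * b \<in> words \<Lambda> x (d + e)"
    unfolding words_def by (intro CollectI exI[of _ "us @ vs"]) auto
qed

lemma words_0: "words \<Lambda> x 0 = {1}"
  by (auto simp: words_def)

definition polys :: "'i set \<Rightarrow> ('i \<Rightarrow> 'a::cstar_algebra) \<Rightarrow> 'a set"
  where "polys \<Lambda> x = cspan (\<Union>d. words \<Lambda> x d)"

lemma unital_subalgebra_polys: "is_unital_subalgebra (polys \<Lambda> x)"
  unfolding is_unital_subalgebra_def
proof (intro conjI ballI)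
  let ?W = "\<Union>d. words \<Lambda> x d"
  show sub: "csubspace (polys \<Lambda> x)" unfolding polys_def by (rule complex_vector.subspace_span)
  show "1 \<in> polys \<Lambda> x" unfolding polys_def using words_0[of \<Lambda> x] by (intro complex_vector.span_base) blast
  have left: "a * b \<in> polys \<Lambda> x" if a: "a \<in> ?W" and b: "b \<in> polys \<Lambda> x" for a b
    using b unfolding polys_def
  proof (induction rule: complex_vector.span_induct_alt)
    case base show ?case by (simp add: complex_vector.span_zero)
  next
    case (step c u v)
    obtain d e where "a \<in> words \<Lambda> x d" "u \<in> words \<Lambda> x e" using a step(1) by blast
    from words_mult[OF this] have "a * u \<in> cspan ?W" by (intro complex_vector.span_base) blast
    then have "c *\<^sub>C (a * u) + a * v \<in> cspan ?W"
      using step by (intro complex_vector.span_add complex_vector.span_scale)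
    then show ?case by (simp add: distrib_left scaleC_mult_right)
  qed
  fix a b assume a: "a \<in> polys \<Lambda> x" and b: "b \<in> polys \<Lambda> x"
  from a show "a * b \<in> polys \<Lambda> x" unfolding polys_def
  proof (induction rule: complex_vector.span_induct_alt)
    case base show ?case by (simp add: complex_vector.span_zero)
  next
    case (step c u v)
    have "u * b \<in> polys \<Lambda> x" using left[OF step(1) b] .
    then have "c *\<^sub>C (u * b) + v * b \<in> cspan ?W"
      using step unfolding polys_def by (intro complex_vector.span_add complex_vector.span_scale)
    then show ?case by (simp add: distrib_right scaleC_mult_left)
  qed
qed

text \<open>Gives the operator algebra a dense subset spanned by words, on which the maps of
  interest are explicit.\<close>

lemma operator_algebra_gen_eq: "operator_algebra_gen (x ` \<Lambda>) = closure (polys \<Lambda> x)"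
proof
  show "operator_algebra_gen (x ` \<Lambda>) \<subseteq> closure (polys \<Lambda> x)"
    unfolding operator_algebra_gen_def
  proof (rule hull_minimal)
    have "x r \<in> words \<Lambda> x 1" if "r \<in> \<Lambda>" for r
      unfolding words_def using that by (intro CollectI exI[of _ "[r]"]) auto
    then have "x ` \<Lambda> \<subseteq> polys \<Lambda> x" unfolding polys_def by (auto intro!: complex_vector.span_base)
    then show "x ` \<Lambda> \<subseteq> closure (polys \<Lambda> x)" using closure_subset by blast
  qed (simp add: unital_subalgebra_closure unital_subalgebra_polys)
  let ?B = "operator_algebra_gen (x ` \<Lambda>)"
  have B: "is_unital_subalgebra ?B \<and> closed ?B"
    unfolding operator_algebra_gen_def
    by (rule hull_in) (auto simp: is_unital_subalgebra_def intro!: complex_vector.subspace_Inter)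
  have xB: "x r \<in> ?B" if "r \<in> \<Lambda>" for r
    unfolding operator_algebra_gen_def using that by (intro hull_inc) auto
  have "prod_list (map x us) \<in> ?B" if "us \<in> lists \<Lambda>" for us
    using that by (induction us) (use B xB in \<open>auto simp: is_unital_subalgebra_def\<close>)
  then have "polys \<Lambda> x \<subseteq> ?B"
    unfolding polys_def using B by (intro complex_vector.span_minimal) (auto simp: words_def is_unital_subalgebra_def)
  then show "closure (polys \<Lambda> x) \<subseteq> ?B" using B by (intro closure_minimal) auto
qed

section \<open>Rotation automorphisms and their averages\<close>

text \<open>The domain consists of the *-polynomials in \<open>x\<close>, whatever the second
  family. Hence all rotations live on one common C*-algebra and can be averaged.\<close>

lemma star_graph_Domain_cong: "fst ` star_graph \<Lambda> x y = fst ` star_graph \<Lambda> x y'"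
proof -
  have sub: "\<exists>b'. (a, b') \<in> star_graph \<Lambda> x v'" if "(a, b) \<in> star_graph \<Lambda> x v" for a b v v'
    using that by induction (blast intro: star_graph.intros)+
  show ?thesis
  proof (intro equalityI subsetI)
    fix a assume "a \<in> fst ` star_graph \<Lambda> x y"
    then obtain b where "(a, b) \<in> star_graph \<Lambda> x y" by auto
    then show "a \<in> fst ` star_graph \<Lambda> x y'" using sub[of a b y y'] by force
  next
    fix a assume "a \<in> fst ` star_graph \<Lambda> x y'"
    then obtain b where "(a, b) \<in> star_graph \<Lambda> x y'" by auto
    then show "a \<in> fst ` star_graph \<Lambda> x y" using sub[of a b y' y] by force
  qed
qed

lemma isometric_star_homD:
  assumes "star_subalgebra C" "isometric_star_hom_on C \<alpha>"
  shows "a \<in> C \<Longrightarrow> b \<in> C \<Longrightarrow> \<alpha> (a + b) = \<alpha> a + \<alpha> b" "a \<in> C \<Longrightarrow> \<alpha> (c *\<^sub>C a) = c *\<^sub>C \<alpha> a"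
    "a \<in> C \<Longrightarrow> norm (\<alpha> a) = norm a" "\<alpha> 0 = 0" "\<alpha> 1 = 1"
    "a \<in> C \<Longrightarrow> b \<in> C \<Longrightarrow> \<alpha> (a - b) = \<alpha> a - \<alpha> b"
proof -
  note ops = star_subalgebra_closed_ops[OF assms(1)]
  show add: "\<alpha> (a + b) = \<alpha> a + \<alpha> b" if "a \<in> C" "b \<in> C" for a b
    using assms(2) that by (auto simp: isometric_star_hom_on_def clinear_on_def)
  show scale: "\<alpha> (c *\<^sub>C a) = c *\<^sub>C \<alpha> a" if "a \<in> C" for a c
    using assms(2) that by (auto simp: isometric_star_hom_on_def clinear_on_def)
  show "\<alpha> 0 = 0" using scale[of 0 0] ops by simp
  show "a \<in> C \<Longrightarrow> norm (\<alpha> a) = norm a" "\<alpha> 1 = 1" using assms(2) by (auto simp: isometric_star_hom_on_def)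
  show "\<alpha> (a - b) = \<alpha> a - \<alpha> b" if "a \<in> C" "b \<in> C"
    using add[of "a - b" b] that ops by simp
qed

text \<open>The homomorphisms are chosen separately for each \<open>c\<close>; the averages formed
  from them are finite sums, for which this suffices.\<close>

lemma rotation_automorphisms:
  fixes x :: "'i \<Rightarrow> 'a::cstar_algebra"
  assumes \<phi>: "is_faithful_state \<phi>" and inv: "invariant_under_free_complexification \<phi> \<Lambda> x \<psi> \<iota>"
  obtains C and \<alpha> :: "complex \<Rightarrow> 'a \<Rightarrow> 'a" where "star_subalgebra C" "closed C" "polys \<Lambda> x \<subseteq> C"
    "\<And>c. cmod c = 1 \<Longrightarrow> isometric_star_hom_on C (\<alpha> c)"
    "\<And>c d a. cmod c = 1 \<Longrightarrow> a \<in> words \<Lambda> x d \<Longrightarrow> \<alpha> c a = (c ^ d) *\<^sub>C a"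
proof -
  define C where "C = closure (fst ` star_graph \<Lambda> x x)"
  have "\<exists>\<alpha>. isometric_star_hom_on C \<alpha> \<and> (\<forall>w\<in>lists (\<Lambda> \<times> UNIV). \<alpha> (star_word x w) = star_word (\<lambda>r. c *\<^sub>C x r) w)"
    if "cmod c = 1" for c
    unfolding C_def star_graph_Domain_cong[of \<Lambda> x x "\<lambda>r. c *\<^sub>C x r"]
    by (rule same_star_distribution_isometric_star_hom[OF \<phi> \<phi> same_star_distribution_rotate[OF \<phi> inv that]]) blast
  then have "\<exists>\<alpha>. \<forall>c. cmod c = 1 \<longrightarrow> isometric_star_hom_on C (\<alpha> c) \<and>
      (\<forall>w\<in>lists (\<Lambda> \<times> UNIV). \<alpha> c (star_word x w) = star_word (\<lambda>r. c *\<^sub>C x r) w)"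
    by (intro choice) blast
  then obtain \<alpha> where \<alpha>: "\<And>c. cmod c = 1 \<Longrightarrow> isometric_star_hom_on C (\<alpha> c)"
    "\<And>c w. cmod c = 1 \<Longrightarrow> w \<in> lists (\<Lambda> \<times> UNIV) \<Longrightarrow> \<alpha> c (star_word x w) = star_word (\<lambda>r. c *\<^sub>C x r) w"
    by blast
  have C: "star_subalgebra C" unfolding C_def by (intro star_subalgebra_closure star_subalgebra_star_graph_Domain)
  have flags: "map (\<lambda>r. (r, False)) us \<in> lists (\<Lambda> \<times> UNIV)" if "us \<in> lists \<Lambda>" for us
    using that by (induction us) auto
  have "words \<Lambda> x d \<subseteq> C" for d
  proof
    fix a assume "a \<in> words \<Lambda> x d"
    then obtain us where "a = star_word x (map (\<lambda>r. (r, False)) us)" "us \<in> lists \<Lambda>"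
      by (auto simp: words_def word_star_word)
    then have "(a, a) \<in> star_graph \<Lambda> x x" using star_graph.word[OF flags, of us x x] by simp
    from imageI[OF this, of fst] have "a \<in> fst ` star_graph \<Lambda> x x" by simp
    then show "a \<in> C" unfolding C_def by (rule subsetD[OF closure_subset])
  qed
  then have "polys \<Lambda> x \<subseteq> C" unfolding polys_def
    using C by (intro complex_vector.span_minimal UN_least) (simp_all add: star_subalgebra_def is_unital_subalgebra_def)
  moreover have "\<alpha> c a = (c ^ d) *\<^sub>C a" if c: "cmod c = 1" and a: "a \<in> words \<Lambda> x d" for c d a
  proof -
    obtain us where us': "a = prod_list (map x us)" "us \<in> lists \<Lambda>" "length us = d" using a by (auto simp: words_def)
    have "prod_list (map (\<lambda>r. c *\<^sub>C x r) us) = (c ^ length us) *\<^sub>C prod_list (map x us)" for us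
      by (induction us) (auto simp: scaleC_one scaleC_mult_left scaleC_mult_right scaleC_scaleC mult.commute)
    then show ?thesis using us' \<alpha>(2)[OF c flags[OF us'(2)]] by (simp add: word_star_word[symmetric])
  qed
  ultimately show thesis using that[of C \<alpha>] C \<alpha>(1) by (simp add: C_def)
qed

lemma matrix_norm_weighted_sum:
  fixes \<phi> :: "'a::cstar_algebra \<Rightarrow> complex" and \<pi> :: "'a \<Rightarrow> 'h::chilbert_space \<Rightarrow> 'h"
  assumes \<phi>: "is_faithful_state \<phi>" and gns: "is_gns_triple \<phi> \<pi> \<Omega>"
    and w: "\<And>k. k < m \<Longrightarrow> 0 \<le> w k" and a: "\<And>k. k < m \<Longrightarrow> matrix_norm \<pi> n (a k) \<le> M"
  shows "matrix_norm \<pi> n (\<lambda>i j. \<Sum>k<m. w k *\<^sub>R a k i j) \<le> (\<Sum>k<(m::nat). w k) * M"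
  using w a
proof (induction m)
  case 0
  then show ?case using matrix_norm_scaleR[OF \<phi> gns, of n 0 "\<lambda>_ _. 0"] by simp
next
  case (Suc m)
  have "matrix_norm \<pi> n (\<lambda>i j. \<Sum>k<Suc m. w k *\<^sub>R a k i j) \<le>
      matrix_norm \<pi> n (\<lambda>i j. \<Sum>k<m. w k *\<^sub>R a k i j) + matrix_norm \<pi> n (\<lambda>i j. w m *\<^sub>R a m i j)"
    using matrix_norm_triangle[OF \<phi> gns, of n "\<lambda>i j. \<Sum>k<m. w k *\<^sub>R a k i j" "\<lambda>i j. w m *\<^sub>R a m i j"] by simp
  moreover have "matrix_norm \<pi> n (\<lambda>i j. w m *\<^sub>R a m i j) \<le> w m * M"
    using matrix_norm_scaleR[OF \<phi> gns, of n "w m" "a m"] mult_left_mono[OF Suc.prems(2)[of m] Suc.prems(1)[of m]]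
      Suc.prems(1)[of m] by simp
  moreover have "matrix_norm \<pi> n (\<lambda>i j. \<Sum>k<m. w k *\<^sub>R a k i j) \<le> (\<Sum>k<m. w k) * M"
    using Suc by simp
  ultimately show ?case by (simp add: distrib_right)
qed

lemma matrix_norm_limit_le:
  fixes \<phi> :: "'a::cstar_algebra \<Rightarrow> complex" and \<pi> :: "'a \<Rightarrow> 'h::chilbert_space \<Rightarrow> 'h"
  assumes \<phi>: "is_faithful_state \<phi>" and gns: "is_gns_triple \<phi> \<pi> \<Omega>"
    and lim: "\<And>i j. i < n \<Longrightarrow> j < n \<Longrightarrow> (\<lambda>N. a N i j) \<longlonglongrightarrow> b i j" and M: "0 \<le> M" "\<And>N. matrix_norm \<pi> n (a N) \<le> M"
  shows "matrix_norm \<pi> n b \<le> M"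
proof (rule matrix_norm_le[OF \<phi> gns M(1)])
  fix \<xi>
  note rep = star_repD[OF gns_star_rep[OF \<phi> gns]]
  have bl: "bounded_linear (\<lambda>a. \<pi> a \<zeta>)" for \<zeta>
    using gns_norm_le[OF \<phi> gns] by (intro bounded_linear_intro[where K = "norm \<zeta>"]) (auto simp: rep)
  have "(\<lambda>N. vec_norm n (mat_op \<pi> n (a N) \<xi>)) \<longlonglongrightarrow> vec_norm n (mat_op \<pi> n b \<xi>)"
    unfolding vec_norm_def mat_op_def
    by (intro tendsto_intros bounded_linear.tendsto[OF bl] lim) auto
  moreover have "vec_norm n (mat_op \<pi> n (a N) \<xi>) \<le> M * vec_norm n \<xi>" for N
    by (rule order_trans[OF matrix_norm_bound[OF \<phi> gns]]) (intro mult_right_mono M vec_norm_nonneg)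
  ultimately show "vec_norm n (mat_op \<pi> n b \<xi>) \<le> M * vec_norm n \<xi>"
    by (intro Lim_bounded[of _ _ 0]) auto
qed

text \<open>For \<open>r < 1\<close> the map multiplying words of length \<open>d\<close> by \<open>r ^ d\<close> is a limit of averages of
  rotation automorphisms with nonnegative weights of total mass at most one.\<close>

lemma dilation_complete_contraction:
  fixes \<phi> :: "'a::cstar_algebra \<Rightarrow> complex" and \<pi> :: "'a \<Rightarrow> 'h::chilbert_space \<Rightarrow> 'h"
  assumes \<phi>: "is_faithful_state \<phi>" and gns: "is_gns_triple \<phi> \<pi> \<Omega>"
    and inv: "invariant_under_free_complexification \<phi> \<Lambda> x \<psi> \<iota>" and r: "0 \<le> r" "r < 1"
  defines "B \<equiv> closure (polys \<Lambda> x)"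
  obtains G where "\<And>b. b \<in> B \<Longrightarrow> G b \<in> B" "\<And>b. b \<in> B \<Longrightarrow> norm (G b) \<le> norm b"
    "is_complete_contraction_on \<pi> B G" "\<And>d a. a \<in> words \<Lambda> x d \<Longrightarrow> G a = (r ^ d) *\<^sub>R a"
proof -
  obtain C and \<alpha> :: "complex \<Rightarrow> 'a \<Rightarrow> 'a" where C: "star_subalgebra C" "closed C" "polys \<Lambda> x \<subseteq> C"
    and hom: "\<And>c. cmod c = 1 \<Longrightarrow> isometric_star_hom_on C (\<alpha> c)"
    and \<alpha>_word: "\<And>c d a. cmod c = 1 \<Longrightarrow> a \<in> words \<Lambda> x d \<Longrightarrow> \<alpha> c a = (c ^ d) *\<^sub>C a"
    by (rule rotation_automorphisms[OF \<phi> inv]) blast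
  have rot: "cmod (rotation N k) = 1" for N k by (simp add: rotation_def)
  note \<alpha> = isometric_star_homD[OF C(1) hom[OF rot]]
  note ops = star_subalgebra_closed_ops[OF C(1)]
  have BC: "B \<subseteq> C" unfolding B_def using C by (intro closure_minimal)
  have polysB: "polys \<Lambda> x \<subseteq> B" by (simp add: B_def closure_subset)
  have B: "is_unital_subalgebra B" "closed B"
    by (simp_all add: B_def unital_subalgebra_closure unital_subalgebra_polys)
  note Bops = unital_subalgebra_closed_ops[OF B(1)]
  define A where "A N b = (\<Sum>k<2*N. kernel_weight r N k *\<^sub>R \<alpha> (rotation N k) b)" for N b
  have A_add: "A N (a + b) = A N a + A N b" and A_scale: "A N (c *\<^sub>C a) = c *\<^sub>C A N a"
    and A_diff: "A N (a - b) = A N a - A N b" if "a \<in> C" "b \<in> C" for N a b c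
    using that by (simp_all add: A_def \<alpha> scaleR_add_right sum.distrib scaleR_diff_right sum_subtractf
        complex_vector.scale_sum_right scaleR_scaleC scaleC_scaleC mult.commute
        complex_vector.scale_right_distrib complex_vector.scale_right_diff_distrib)
  have A_norm: "norm (A N a) \<le> norm a" if "a \<in> C" for N a
  proof -
    have "norm (A N a) \<le> (\<Sum>k<2*N. kernel_weight r N k * norm a)"
      unfolding A_def using that by (intro sum_norm_le) (simp add: \<alpha> kernel_weight_nonneg[OF r])
    also have "\<dots> \<le> 1 * norm a"
      unfolding sum_distrib_right[symmetric] by (intro mult_right_mono sum_kernel_weight_le_1 r norm_ge_zero)
    finally show ?thesis by simp
  qed
  \<comment> \<open>Words are eigenvectors of the averages, with the moments of the kernel as
    eigenvalues.\<close>
  have A_word: "A N a = (\<Sum>k<2*N. of_real (kernel_weight r N k) * rotation N k ^ d) *\<^sub>C a"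
    if "a \<in> words \<Lambda> x d" for N a d
    using \<alpha>_word[OF rot that] by (simp add: A_def scaleR_scaleC scaleC_scaleC complex_vector.scale_sum_left)
  have wordsB: "a \<in> B" if "a \<in> words \<Lambda> x d" for a d
  proof -
    have "a \<in> polys \<Lambda> x" unfolding polys_def using that by (intro complex_vector.span_base) blast
    then show ?thesis using polysB by blast
  qed
  have scaleC_tendsto: "(\<lambda>N. f N *\<^sub>C a) \<longlonglongrightarrow> l *\<^sub>C a" if "f \<longlonglongrightarrow> l" for f l and a :: 'a
  proof -
    have "bounded_linear (\<lambda>c. c *\<^sub>C a)"
      by (rule bounded_linear_intro[where K = "norm a"])
        (auto simp: scaleC_add_left norm_scaleC scaleR_scaleC scaleC_scaleC scaleR_conv_of_real)
    from bounded_linear.tendsto[OF this that] show ?thesis .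
  qed
  have A_word_lim: "(\<lambda>N. A N a) \<longlonglongrightarrow> (r ^ d) *\<^sub>R a" if "a \<in> words \<Lambda> x d" for a d
    unfolding A_word[OF that] scaleR_scaleC by (intro scaleC_tendsto kernel_weight_moment_tendsto r)
  have A_polys: "A N b \<in> polys \<Lambda> x \<and> convergent (\<lambda>N. A N b)" if "b \<in> polys \<Lambda> x" for b N
  proof -
    have "b \<in> polys \<Lambda> x \<and> (\<forall>N. A N b \<in> polys \<Lambda> x) \<and> convergent (\<lambda>N. A N b)"
      using that unfolding polys_def
    proof (induction rule: complex_vector.span_induct_alt)
      case base
      have "A N 0 = 0" for N by (simp add: A_def \<alpha>)
      then show ?case by (simp add: complex_vector.span_zero convergent_const)
    next
      case (step c u v)
      then obtain d where u: "u \<in> words \<Lambda> x d" by blast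
      have uC: "u \<in> C" "v \<in> C" using wordsB[OF u] BC C(3) step by (auto simp: polys_def)
      have eq: "A N (c *\<^sub>C u + v) = c *\<^sub>C A N u + A N v" for N
        using uC by (simp add: A_add A_scale ops)
      have "A N u \<in> cspan (\<Union>d. words \<Lambda> x d)" for N
        unfolding A_word[OF u] using step(1) by (intro complex_vector.span_scale complex_vector.span_base)
      moreover have "convergent (\<lambda>N. c *\<^sub>C A N u + A N v)"
        using A_word_lim[OF u] step convergentD unfolding convergent_def by (metis tendsto_add tendsto_scaleC)
      moreover have "u \<in> cspan (\<Union>d. words \<Lambda> x d)" using step(1) by (rule complex_vector.span_base)
      ultimately show ?case using step unfolding eq
        by (simp add: complex_vector.span_add complex_vector.span_scale)
    qed
    then show ?thesis by blast
  qed
  have A_conv: "convergent (\<lambda>N. A N b)" if "b \<in> B" for b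
  proof (rule convergent_closure_lipschitz[where D = B and L = 1 and S = "polys \<Lambda> x"])
    show "dist (A N a) (A N b) \<le> 1 * dist a b" if "a \<in> B" "b \<in> B" for N a b
    proof -
      have "a \<in> C" "b \<in> C" using that BC by auto
      then show ?thesis using A_norm[of "a - b" N] by (simp add: dist_norm ops flip: A_diff)
    qed
  qed (use that polysB A_polys in \<open>auto simp: B_def\<close>)
  define G where "G b = lim (\<lambda>N. A N b)" for b
  have G: "(\<lambda>N. A N b) \<longlonglongrightarrow> G b" if "b \<in> B" for b
    using A_conv[OF that] by (simp add: G_def convergent_LIMSEQ_iff)
  \<comment> \<open>The homomorphisms are only known to be defined on \<open>C\<close>. That the
    average stays in \<open>B\<close> follows because it preserves polynomials and is
    contractive.\<close>
  have A_B: "A N b \<in> B" if "b \<in> B" for N b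
  proof -
    obtain f where f: "\<And>n::nat. f n \<in> polys \<Lambda> x" "f \<longlonglongrightarrow> b"
      using \<open>b \<in> B\<close> unfolding B_def closure_sequential by blast
    have lim: "(\<lambda>n. A N (f n)) \<longlonglongrightarrow> A N b"
    proof (rule metric_LIMSEQ_I)
      fix e :: real assume "e > 0"
      then obtain no where no: "\<forall>n\<ge>no. dist (f n) b < e" using metric_LIMSEQ_D[OF f(2)] by blast
      have bC: "b \<in> C" "f n \<in> C" for n using \<open>b \<in> B\<close> BC f(1) C(3) by auto
      have "dist (A N (f n)) (A N b) \<le> dist (f n) b" for n
        using A_norm[OF ops(4)[OF bC(2,1)], of N n] by (simp add: dist_norm A_diff bC)
      then show "\<exists>no. \<forall>n\<ge>no. dist (A N (f n)) (A N b) < e" using no by (meson le_less_trans)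
    qed
    have "A N (f n) \<in> B" for n using A_polys[OF f(1)] polysB by blast
    then show ?thesis by (rule closed_sequentially[OF B(2) _ lim])
  qed
  have GB: "G b \<in> B" if "b \<in> B" for b
    by (rule closed_sequentially[OF B(2) _ G[OF that]]) (rule A_B[OF that])
  have Gnorm: "norm (G b) \<le> norm b" if "b \<in> B" for b
    using A_norm that BC by (intro Lim_bounded[OF tendsto_norm[OF G[OF that]], of 0]) auto
  have "clinear_on B G"
    unfolding clinear_on_def
  proof (intro conjI ballI allI)
    fix a b assume ab: "a \<in> B" "b \<in> B"
    have "(\<lambda>N. A N (a + b)) \<longlonglongrightarrow> G a + G b"
      using tendsto_add[OF G[OF ab(1)] G[OF ab(2)]] ab BC by (simp add: A_add subset_iff)
    with G[OF Bops(3)[OF ab]] show "G (a + b) = G a + G b" by (rule LIMSEQ_unique)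
  next
    fix c a assume a: "a \<in> B"
    have "(\<lambda>N. A N (c *\<^sub>C a)) \<longlonglongrightarrow> c *\<^sub>C G a"
      using tendsto_scaleC[OF G[OF a], of c] A_scale[OF subsetD[OF BC a] ops(1)] by simp
    with G[OF Bops(6)[OF a]] show "G (c *\<^sub>C a) = c *\<^sub>C G a" by (rule LIMSEQ_unique)
  qed
  moreover have "matrix_norm \<pi> n (\<lambda>i j. G (a i j)) \<le> matrix_norm \<pi> n a"
    if a: "\<forall>i<n. \<forall>j<n. a i j \<in> B" for n a
  proof (rule matrix_norm_limit_le[OF \<phi> gns, where a = "\<lambda>N i j. A N (a i j)"])
    show "(\<lambda>N. A N (a i j)) \<longlonglongrightarrow> G (a i j)" if "i < n" "j < n" for i j
      using a that by (intro G) auto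
    fix N
    have "matrix_norm \<pi> n (\<lambda>i j. \<alpha> (rotation N k) (a i j)) \<le> matrix_norm \<pi> n a" for k
      using a BC by (intro matrix_norm_star_hom_le[OF \<phi> gns C(1,2) hom[OF rot]]) auto
    then have "matrix_norm \<pi> n (\<lambda>i j. A N (a i j)) \<le> (\<Sum>k<2*N. kernel_weight r N k) * matrix_norm \<pi> n a"
      unfolding A_def by (intro matrix_norm_weighted_sum[OF \<phi> gns] kernel_weight_nonneg r)
    also have "\<dots> \<le> 1 * matrix_norm \<pi> n a"
      by (intro mult_right_mono sum_kernel_weight_le_1 r matrix_norm_nonneg[OF \<phi> gns])
    finally show "matrix_norm \<pi> n (\<lambda>i j. A N (a i j)) \<le> matrix_norm \<pi> n a" by simp
  qed (rule matrix_norm_nonneg[OF \<phi> gns])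
  ultimately have "is_complete_contraction_on \<pi> B G" unfolding is_complete_contraction_on_def by blast
  moreover have "G a = (r ^ d) *\<^sub>R a" if "a \<in> words \<Lambda> x d" for a d
    using G[OF wordsB[OF that]] A_word_lim[OF that] by (rule LIMSEQ_unique)
  ultimately show thesis using that[of G] GB Gnorm by blast
qed

subsection \<open>The grading of the GNS space\<close>

lemma gns_emb_bounded_linear:
  assumes "is_faithful_state \<phi>" "is_gns_triple \<phi> \<pi> \<Omega>"
  shows "bounded_linear (gns_emb \<pi> \<Omega>)" "gns_emb \<pi> \<Omega> (c *\<^sub>C a) = c *\<^sub>C gns_emb \<pi> \<Omega> a"
  using gns_norm_le[OF assms] unfolding gns_emb_def
  by (auto intro!: bounded_linear_intro[where K = "norm \<Omega>"] simp: star_repD[OF gns_star_rep[OF assms]])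

lemma csubspace_gns_image:
  assumes "is_faithful_state \<phi>" "is_gns_triple \<phi> \<pi> \<Omega>" and S: "csubspace S"
  shows "csubspace (gns_emb \<pi> \<Omega> ` S)"
proof (rule complex_vector.subspaceI)
  note bl = gns_emb_bounded_linear[OF assms(1,2)]
  have add: "gns_emb \<pi> \<Omega> (a + b) = gns_emb \<pi> \<Omega> a + gns_emb \<pi> \<Omega> b" for a b
    using bl(1) by (simp add: bounded_linear.linear linear_add)
  have "gns_emb \<pi> \<Omega> 0 = 0" using bl(1) by (simp add: bounded_linear.linear linear_0)
  then show "0 \<in> gns_emb \<pi> \<Omega> ` S" using complex_vector.subspace_0[OF S] by force
  show "\<xi> + \<zeta> \<in> gns_emb \<pi> \<Omega> ` S" if "\<xi> \<in> gns_emb \<pi> \<Omega> ` S" "\<zeta> \<in> gns_emb \<pi> \<Omega> ` S" for \<xi> \<zeta>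
    using that complex_vector.subspace_add[OF S] by (auto simp flip: add)
  show "c *\<^sub>C \<xi> \<in> gns_emb \<pi> \<Omega> ` S" if "\<xi> \<in> gns_emb \<pi> \<Omega> ` S" for c \<xi>
    using that complex_vector.subspace_scale[OF S] by (auto simp flip: bl(2))
qed

text \<open>Brings degree 0, defined without a closure, under the formula of the other degrees: the
  line spanned by the unit is an isometric image of the complex plane, hence closed.\<close>

lemma L2_deg_closure:
  assumes \<phi>: "is_faithful_state \<phi>" and gns: "is_gns_triple \<phi> \<pi> \<Omega>"
  shows "L2_deg \<pi> \<Omega> \<Lambda> x d = closure (gns_emb \<pi> \<Omega> ` cspan (words \<Lambda> x d))"
proof (cases "d = 0")
  case True
  have norm: "norm (gns_emb \<pi> \<Omega> (c *\<^sub>C 1)) = cmod c" for c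
  proof -
    have "(norm \<Omega>)\<^sup>2 = 1"
      using gns_norm[OF gns, of 1] by (simp add: star_repD[OF gns_star_rep[OF \<phi> gns]] faithful_stateD[OF \<phi>])
    then have "norm \<Omega> = 1" by (simp add: power2_eq_1_iff) (metis norm_ge_zero not_one_le_zero neg_0_le_iff_le)
    then show ?thesis by (simp add: gns_emb_def star_repD[OF gns_star_rep[OF \<phi> gns]] norm_scaleC)
  qed
  have bl: "bounded_linear (\<lambda>c. gns_emb \<pi> \<Omega> (c *\<^sub>C 1))"
  proof (rule bounded_linear_intro[where K = 1])
    note g = gns_emb_bounded_linear[OF \<phi> gns]
    show "gns_emb \<pi> \<Omega> ((b + c) *\<^sub>C 1) = gns_emb \<pi> \<Omega> (b *\<^sub>C 1) + gns_emb \<pi> \<Omega> (c *\<^sub>C 1)" for b c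
      using g(1) by (simp add: scaleC_add_left bounded_linear.linear linear_add)
    show "gns_emb \<pi> \<Omega> ((r *\<^sub>R c) *\<^sub>C 1) = r *\<^sub>R gns_emb \<pi> \<Omega> (c *\<^sub>C 1)" for r c
      by (simp only: g(2) scaleR_scaleC[of r "_ :: 'b"] scaleC_scaleC scaleR_conv_of_real[of r c])
  qed (simp add: norm)
  have "complete (range (\<lambda>c. gns_emb \<pi> \<Omega> (c *\<^sub>C 1)))"
    by (rule complete_isometric_image[where e = 1 and f = "\<lambda>c. gns_emb \<pi> \<Omega> (c *\<^sub>C 1)" and s = UNIV])
      (auto simp: bl norm complete_UNIV)
  then have "closed (gns_emb \<pi> \<Omega> ` {c *\<^sub>C 1 |c. True})"
    by (auto simp: complete_eq_closed image_image full_SetCompr_eq)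
  moreover have "cspan {1::'a} = {c *\<^sub>C 1 |c. True}" by (auto simp: complex_vector.span_singleton)
  ultimately show ?thesis using True by (simp add: L2_deg_def words_0)
qed (simp add: L2_deg_def)

lemma word_in_L2_deg:
  assumes "is_faithful_state \<phi>" "is_gns_triple \<phi> \<pi> \<Omega>" "a \<in> words \<Lambda> x d"
  shows "gns_emb \<pi> \<Omega> a \<in> L2_deg \<pi> \<Omega> \<Lambda> x d"
  unfolding L2_deg_closure[OF assms(1,2)]
  by (intro subsetD[OF closure_subset] imageI complex_vector.span_base assms)

text \<open>For words of lengths \<open>d\<close> and \<open>e\<close> the product
  \<open>star b * a\<close> is a *-word of degree \<open>d - e\<close>, so it is unbalanced. Spans
  follow by linearity in \<open>a\<close> and conjugate linearity in \<open>b\<close>.\<close>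

lemma state_words_orthogonal:
  assumes \<phi>: "is_faithful_state \<phi>" and inv: "invariant_under_free_complexification \<phi> \<Lambda> x \<psi> \<iota>"
    and de: "d \<noteq> e" and a: "a \<in> cspan (words \<Lambda> x d)" and b: "b \<in> cspan (words \<Lambda> x e)"
  shows "\<phi> (star b * a) = 0"
proof -
  note st = faithful_stateD[OF \<phi>]
  have words: "\<phi> (star b * a) = 0" if "a \<in> words \<Lambda> x d" "b \<in> words \<Lambda> x e" for a b
  proof -
    obtain us vs where us': "a = star_word x (map (\<lambda>r. (r, False)) us)" "us \<in> lists \<Lambda>" "length us = d"
      and vs: "b = star_word x (map (\<lambda>r. (r, False)) vs)" "vs \<in> lists \<Lambda>" "length vs = e"
      using \<open>a \<in> words \<Lambda> x d\<close> \<open>b \<in> words \<Lambda> x e\<close> by (auto simp: words_def word_star_word)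
    let ?w = "star_rev (map (\<lambda>r. (r, False)) vs) @ map (\<lambda>r. (r, False)) us"
    have "word_deg ?w = int d - int e"
      using us'(3) vs(3) by (simp add: word_deg_def star_rev_def comp_def sum_list_triv flip: rev_map)
    moreover have "?w \<in> lists (\<Lambda> \<times> UNIV)"
      using us'(2) vs(2) by (auto simp: star_rev_def)
    ultimately have "\<phi> (star_word x ?w) = 0" using free_complexification_balanced[OF inv, of ?w] de by simp
    then show ?thesis by (simp add: star_word_append star_word_star_rev us' vs)
  qed
  have "csubspace {a. \<phi> (star b * a) = 0}" for b
    by (rule complex_vector.subspaceI) (auto simp: st distrib_left scaleC_mult_right)
  then have left: "\<phi> (star b * a) = 0" if "b \<in> words \<Lambda> x e" for b
    using complex_vector.span_minimal[of "words \<Lambda> x d" "{a. \<phi> (star b * a) = 0}"] words[OF _ that] a by blast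
  have "csubspace {b. \<phi> (star b * a) = 0}"
    by (rule complex_vector.subspaceI) (auto simp: st distrib_right scaleC_mult_left star_add star_scaleC)
  then show ?thesis
    using complex_vector.span_minimal[of "words \<Lambda> x e" "{b. \<phi> (star b * a) = 0}"] left b by blast
qed

lemma orthogonal_sum_L2_deg:
  assumes \<phi>: "is_faithful_state \<phi>" and gns: "is_gns_triple \<phi> \<pi> \<Omega>"
    and inv: "invariant_under_free_complexification \<phi> \<Lambda> x \<psi> \<iota>"
  shows "orthogonal_sum (L2_deg \<pi> \<Omega> \<Lambda> x)"
proof
  let ?g = "gns_emb \<pi> \<Omega>"
  show "csubspace (L2_deg \<pi> \<Omega> \<Lambda> x d)" for d
    unfolding L2_deg_closure[OF \<phi> gns]
    by (intro csubspace_closure csubspace_gns_image[OF \<phi> gns] complex_vector.subspace_span)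
  show "complete (L2_deg \<pi> \<Omega> \<Lambda> x d)" for d
    unfolding L2_deg_closure[OF \<phi> gns] by (simp add: complete_eq_closed)
  fix d e \<xi> \<zeta> assume de: "d \<noteq> e" and \<xi>: "\<xi> \<in> L2_deg \<pi> \<Omega> \<Lambda> x d" and \<zeta>: "\<zeta> \<in> L2_deg \<pi> \<Omega> \<Lambda> x e"
  have closed: "closed {\<xi>. cinner \<xi> \<eta> = 0}" for \<eta> :: 'b
    by (intro closed_Collect_eq continuous_intros bounded_linear.continuous_on[OF bounded_linear_cinner_left])
  have 1: "cinner \<xi> (?g b) = 0" if b: "b \<in> cspan (words \<Lambda> x e)" for b
  proof -
    have "?g ` cspan (words \<Lambda> x d) \<subseteq> {\<xi>. cinner \<xi> (?g b) = 0}"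
      using state_words_orthogonal[OF \<phi> inv de _ b] by (auto simp: gns_emb_def gns_cinner[OF gns])
    from closure_minimal[OF this closed] show ?thesis using \<xi> L2_deg_closure[OF \<phi> gns, of \<Lambda> x d] by blast
  qed
  \<comment> \<open>Continuity is at hand for the first argument of the inner product, so the second
    closure is taken after exchanging the arguments.\<close>
  have "?g ` cspan (words \<Lambda> x e) \<subseteq> {\<zeta>. cinner \<zeta> \<xi> = 0}"
    using 1 by (auto simp: cinner_commute[of _ \<xi>])
  from closure_minimal[OF this closed] have "cinner \<zeta> \<xi> = 0" using \<zeta> L2_deg_closure[OF \<phi> gns, of \<Lambda> x e] by blast
  then show "cinner \<xi> \<zeta> = 0" by (simp add: cinner_commute[of \<xi>])
qed

text \<open>The embedding into the GNS space is continuous for the algebra norm, so the norm closure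
  of the polynomials already lands in the Hilbert sum; conversely each degree subspace is a closure
  of images of polynomials.\<close>

lemma L2_eq_orthogonal_sum:
  assumes \<phi>: "is_faithful_state \<phi>" and gns: "is_gns_triple \<phi> \<pi> \<Omega>"
    and inv: "invariant_under_free_complexification \<phi> \<Lambda> x \<psi> \<iota>"
  shows "L2 \<pi> \<Omega> (closure (polys \<Lambda> x)) = orthogonal_sum.K (L2_deg \<pi> \<Omega> \<Lambda> x)"
proof -
  interpret os: orthogonal_sum "L2_deg \<pi> \<Omega> \<Lambda> x" by (rule orthogonal_sum_L2_deg[OF assms])
  let ?g = "gns_emb \<pi> \<Omega>"
  note bl = gns_emb_bounded_linear[OF \<phi> gns]
  have cont: "continuous_on UNIV ?g" by (rule bounded_linear.continuous_on[OF bl(1) continuous_on_id])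
  show ?thesis
  proof
    have "csubspace {a. ?g a \<in> os.K}"
      using os.csubspace_K bl
      by (intro complex_vector.subspaceI)
        (auto simp: bounded_linear.linear linear_0 linear_add complex_vector.subspace_0
          complex_vector.subspace_add complex_vector.subspace_scale)
    moreover have "words \<Lambda> x d \<subseteq> {a. ?g a \<in> os.K}" for d
      using word_in_L2_deg[OF \<phi> gns] os.M_subset_K by (intro subsetI CollectI) (rule subsetD)
    ultimately have "polys \<Lambda> x \<subseteq> {a. ?g a \<in> os.K}"
      unfolding polys_def by (intro complex_vector.span_minimal) auto
    moreover have "closed {a. ?g a \<in> os.K}"
      using cont by (intro closed_vimage[of os.K ?g, unfolded vimage_def]) (auto simp: os.K_def)
    ultimately have "?g ` closure (polys \<Lambda> x) \<subseteq> os.K" using closure_minimal by blast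
    then show "L2 \<pi> \<Omega> (closure (polys \<Lambda> x)) \<subseteq> os.K"
      unfolding L2_def by (intro closure_minimal) (auto simp: os.K_def)
    have "cspan (words \<Lambda> x d) \<subseteq> closure (polys \<Lambda> x)" for d
      unfolding polys_def
      by (rule order_trans[OF complex_vector.span_mono closure_subset]) blast
    then have "L2_deg \<pi> \<Omega> \<Lambda> x d \<subseteq> L2 \<pi> \<Omega> (closure (polys \<Lambda> x))" for d
      unfolding L2_deg_closure[OF \<phi> gns] L2_def by (intro closure_mono image_mono)
    moreover have "csubspace (L2 \<pi> \<Omega> (closure (polys \<Lambda> x)))"
      unfolding L2_def polys_def
      by (intro csubspace_closure csubspace_gns_image[OF \<phi> gns] complex_vector.subspace_span)
    ultimately have "os.D \<subseteq> L2 \<pi> \<Omega> (closure (polys \<Lambda> x))"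
      unfolding os.D_def by (intro complex_vector.span_minimal) auto
    then show "os.K \<subseteq> L2 \<pi> \<Omega> (closure (polys \<Lambda> x))"
      unfolding os.K_def by (intro closure_minimal) (auto simp: L2_def)
  qed
qed

theorem proposition5p3:
  fixes \<phi> :: "'a::cstar_algebra \<Rightarrow> complex"
    and \<pi> :: "'a \<Rightarrow> 'h::chilbert_space \<Rightarrow> 'h" and \<Omega> :: 'h
    and \<Lambda> :: "'i set" and x :: "'i \<Rightarrow> 'a"
    and \<psi> :: "'b::cstar_algebra \<Rightarrow> complex" and \<iota> :: "'a \<Rightarrow> 'b"
    and B :: "'a set"
  assumes "is_faithful_state \<phi>"
    and "is_gns_triple \<phi> \<pi> \<Omega>"
    and "invariant_under_free_complexification \<phi> \<Lambda> x \<psi> \<iota>"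
    and "B = operator_algebra_gen (x ` \<Lambda>)"
  shows "(\<forall>t\<ge>0. \<forall>\<xi>\<in>L2 \<pi> \<Omega> B. summable (Gamma_term \<pi> \<Omega> \<Lambda> x t \<xi>))
    \<and> is_contraction_semigroup_on (L2 \<pi> \<Omega> B) (Gamma_op \<pi> \<Omega> \<Lambda> x)
    \<and> (\<forall>t\<ge>0. \<exists>G. (\<forall>b\<in>B. G b \<in> B \<and> gns_emb \<pi> \<Omega> (G b) = Gamma_op \<pi> \<Omega> \<Lambda> x t (gns_emb \<pi> \<Omega> b))
          \<and> G 1 = 1 \<and> is_complete_contraction_on \<pi> B G)"
proof -
  note \<phi> = assms(1) and gns = assms(2) and inv = assms(3)
  interpret os: orthogonal_sum "L2_deg \<pi> \<Omega> \<Lambda> x" by (rule orthogonal_sum_L2_deg[OF \<phi> gns inv])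
  let ?g = "gns_emb \<pi> \<Omega>"
  have B: "B = closure (polys \<Lambda> x)" using assms(4) by (simp add: operator_algebra_gen_eq)
  have K: "L2 \<pi> \<Omega> B = os.K" unfolding B by (rule L2_eq_orthogonal_sum[OF \<phi> gns inv])
  have term_eq: "Gamma_term \<pi> \<Omega> \<Lambda> x t \<xi> = os.Tt t \<xi>" for t \<xi>
    by (simp add: fun_eq_iff Gamma_term_def os.Tt_def)
  then have op_eq: "Gamma_op \<pi> \<Omega> \<Lambda> x = os.T" by (simp add: fun_eq_iff Gamma_op_def os.T_def)
  note bl = gns_emb_bounded_linear[OF \<phi> gns]
  have gB: "?g b \<in> os.K" if "b \<in> B" for b
    unfolding K[symmetric] L2_def using that by (intro subsetD[OF closure_subset] imageI)
  have sub: "is_unital_subalgebra B" by (simp add: B unital_subalgebra_closure unital_subalgebra_polys)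
  have "\<exists>G. (\<forall>b\<in>B. G b \<in> B \<and> ?g (G b) = os.T t (?g b)) \<and> G 1 = 1 \<and> is_complete_contraction_on \<pi> B G"
    if t: "t \<ge> 0" for t
  \<comment> \<open>At t = 0 the parameter \<open>exp (- t)\<close> equals 1, outside the range of
    the kernel construction; the identity map serves instead.\<close>
  proof (cases "t = 0")
    case True
    then show ?thesis using gB os.T_0
      by (intro exI[of _ "\<lambda>b. b"]) (auto simp: is_complete_contraction_on_def clinear_on_def)
  next
    case False
    obtain G where G: "\<And>b. b \<in> B \<Longrightarrow> G b \<in> B" "\<And>b. b \<in> B \<Longrightarrow> norm (G b) \<le> norm b"
      "is_complete_contraction_on \<pi> B G" "\<And>d a. a \<in> words \<Lambda> x d \<Longrightarrow> G a = (exp (- t) ^ d) *\<^sub>R a"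
      using dilation_complete_contraction[OF \<phi> gns inv, of "exp (- t)"] False t unfolding B by auto
    have lin: "\<And>a b. a \<in> B \<Longrightarrow> b \<in> B \<Longrightarrow> G (a + b) = G a + G b" "\<And>c a. a \<in> B \<Longrightarrow> G (c *\<^sub>C a) = c *\<^sub>C G a"
      using G(3) by (auto simp: is_complete_contraction_on_def clinear_on_def)
    have G_diff: "G (a - b) = G a - G b" if "a \<in> B" "b \<in> B" for a b
      using lin(1)[of "a - b" b] that unital_subalgebra_closed_ops(4)[OF sub that] by simp
    have g_add: "?g (a + b) = ?g a + ?g b" and g_diff: "?g (a - b) = ?g a - ?g b" for a b
      using bl(1) by (simp_all add: bounded_linear.linear linear_add linear_diff)
    \<comment> \<open>On a word of length \<open>d\<close> both sides multiply by
      \<open>exp (- t)\<close> to the power \<open>d\<close>; linearity gives polynomials.\<close>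
    have polys: "b \<in> B \<and> ?g (G b) = os.T t (?g b)" if "b \<in> polys \<Lambda> x" for b
      using that unfolding polys_def
    proof (induction rule: complex_vector.span_induct_alt)
      case base
      have "?g 0 = 0" "G 0 = 0" using lin(2)[of 0 0] unital_subalgebra_closed_ops(1)[OF sub] bl(2)[of 0 0] by simp_all
      moreover have "os.T t 0 = 0" using os.T_scaleC[OF complex_vector.subspace_0[OF os.csubspace_K] t, of 0] by simp
      ultimately show ?case using unital_subalgebra_closed_ops(1)[OF sub] by simp
    next
      case (step c u v)
      then obtain d where u: "u \<in> words \<Lambda> x d" by blast
      have "u \<in> polys \<Lambda> x" unfolding polys_def using step(1) by (rule complex_vector.span_base)
      then have uB: "u \<in> B" unfolding B by (rule subsetD[OF closure_subset])
      from os.T_M[OF word_in_L2_deg[OF \<phi> gns u], of t] have Tu: "?g (G u) = os.T t (?g u)"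
        by (simp add: G(4)[OF u] scaleR_scaleC bl(2) exp_of_nat_mult[symmetric])
      have "os.T t (?g (c *\<^sub>C u + v)) = c *\<^sub>C os.T t (?g u) + os.T t (?g v)"
        using gB uB step t os.csubspace_K
        by (simp add: g_add bl(2) os.T_add os.T_scaleC complex_vector.subspace_scale)
      moreover have "?g (G (c *\<^sub>C u + v)) = c *\<^sub>C ?g (G u) + ?g (G v)"
        using uB step by (simp add: lin unital_subalgebra_closed_ops[OF sub] g_add bl(2))
      ultimately show ?case using Tu step uB by (simp add: unital_subalgebra_closed_ops[OF sub])
    qed
    \<comment> \<open>Both sides are continuous in \<open>b\<close> for the algebra norm:
      \<open>G\<close> is a contraction there, \<open>os.T t\<close> is one on the Hilbert space,
      and the embedding links the two norms.\<close>
    have "?g (G b) = os.T t (?g b)" if "b \<in> B" for b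
    proof -
      obtain f where f: "\<And>n::nat. f n \<in> polys \<Lambda> x" "f \<longlonglongrightarrow> b"
        using \<open>b \<in> B\<close> unfolding B closure_sequential by blast
      have fB: "f n \<in> B" for n using polys[OF f(1)] by blast
      have to0: "(\<lambda>n. norm (f n - b)) \<longlonglongrightarrow> 0" using f(2) by (simp add: LIM_zero tendsto_norm_zero)
      have "(\<lambda>n. G (f n)) \<longlonglongrightarrow> G b"
      proof (rule LIM_zero_cancel, rule Lim_null_comparison[OF _ to0], intro always_eventually allI)
        show "norm (G (f n) - G b) \<le> norm (f n - b)" for n
          using G(2)[OF unital_subalgebra_closed_ops(4)[OF sub fB \<open>b \<in> B\<close>]] G_diff[OF fB \<open>b \<in> B\<close>] by simp
      qed
      then have 1: "(\<lambda>n. ?g (G (f n))) \<longlonglongrightarrow> ?g (G b)" by (rule bounded_linear.tendsto[OF bl(1)])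
      have to0': "(\<lambda>n. norm (?g (f n) - ?g b)) \<longlonglongrightarrow> 0"
        using bounded_linear.tendsto[OF bl(1) f(2)] by (simp add: LIM_zero tendsto_norm_zero)
      have "(\<lambda>n. os.T t (?g (f n))) \<longlonglongrightarrow> os.T t (?g b)"
      proof (rule LIM_zero_cancel, rule Lim_null_comparison[OF _ to0'], intro always_eventually allI)
        show "norm (os.T t (?g (f n)) - os.T t (?g b)) \<le> norm (?g (f n) - ?g b)" for n
          using os.T_contract[OF complex_vector.subspace_diff[OF os.csubspace_K gB[OF fB] gB[OF \<open>b \<in> B\<close>]] t]
            os.T_diff[OF gB[OF fB] gB[OF \<open>b \<in> B\<close>] t] by simp
      qed
      moreover have "(\<lambda>n. ?g (G (f n))) = (\<lambda>n. os.T t (?g (f n)))" using polys[OF f(1)] by simp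
      ultimately show ?thesis using 1 LIMSEQ_unique by simp
    qed
    moreover have "G 1 = 1" using G(4)[of 1 0] by (simp add: words_0)
    ultimately show ?thesis using G by blast
  qed
  then show ?thesis
    unfolding term_eq op_eq K using os.summable_T os.contraction_semigroup_T by blast
qed

end
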